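(* Let $D$ be a subsemigroup of $(\mathbb N_0,+)$. Then $\mathcal I_D$ is generated as a category as follows: (1) if $\mathbb N\setminus D$ is finite and $0\in D$: $\mathcal I_D=\langle \mathrm{Br}_\bullet(\mathbb N\setminus D)\rangle$; (2) if $\mathbb N\setminus D$ is finite and $0\notin D$: $\mathcal I_D=\langle \mathrm{Br}_\bullet(\mathbb N\setminus D),\,h\rangle$; (3) if $\mathbb N\setminus D$ is infinite and $0\in D$: $\mathcal I_D=\langle \mathrm{Br}_\bullet(\{1,\dots,v\}\setminus D)\mid v\in\mathbb N\rangle$; (4) if $\mathbb N\setminus D$ is infinite and $0\notin D$: $\mathcal I_D=\langle \mathrm{Br}_\bullet(\{1,\dots,v\}\setminus D),\,h\mid v\in\mathbb N\rangle$.
   Context: $\mathbb N=\{1,2,\dots\}$, $\mathbb N_0=\mathbb N\cup\{0\}$. A (two-colored) partition $p$ consists of two finite totally ordered sets $U$ (upper row, left to right) and $L$ (lower row), a decomposition of $U\sqcup L$ (the points) into non-empty pairwise disjoint blocks, and a coloring of each point by $\circ$ or $\bullet$. A pair partition has only two-point blocks. Operations: tensor product $p\otimes p'$ (append the rows of $p'$ to the right of those of $p$); involution $p^*$ (exchange the rows); composition $pp'$, defined when the lower row of $p'$ and the upper row of $p$ agree in length and coloring: put $p'$ on top of $p$, identify the lower row of $p'$ with the upper row of $p$, keep the upper row of $p'$ and lower row of $p$, and let two remaining points be in the same block iff connected through blocks of $p,p'$ via the middle points (components entirely in the middle are discarded). A category of partitions is a set of partitions closed under these three operations and containing the partitions with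 one upper and one lower point of equal color $c\in\{\circ,\bullet\}$ forming a block, and the partitions with empty upper row and lower row $\circ\bullet$ resp. $\bullet\circ$ forming a block. $\langle\mathcal G\rangle$ is the smallest category containing $\mathcal G$. On the points of $p$ consider the cyclic order obtained by traversing the lower row left to right and then the upper row right to left. $]\alpha,\beta[$: points strictly after $\alpha$ and before $\beta$ in this cyclic order; $]\alpha,\beta]:=]\alpha,\beta[\cup\{\beta\}$ for $\alpha\ne\beta$, $]\alpha,\alpha]:=\emptyset$. Normalized color: the color for lower points, the opposite color for upper points. $\sigma_p(S)$ = #normalized-$\circ$ points of $S$ $-$ #normalized-$\bullet$ points of $S$. Distinct blocks $B,B'$ cross if there are $\alpha,\beta\in B,\gamma,\delta\in B'$ in cyclic order $\alpha,\gamma,\beta,\delta$. $\mathcal P^{\circ\bullet}_{2,\mathrm{nb}}$: pair partitions each block of which has one point of each normalized color. $\mathcal S_0$: those $p\in\mathcal P^{\circ\bullet}_{2,\mathrm{nb}}$ with $\sigma_p(]\alpha,\beta[)=0$ for all blocks $\{\alpha,\beta\}$. For $p\in\mathcal S_0$: $\delta_p(\alpha,\beta)=\sigma_p(]\alpha,\beta[)$ for different normalized colors, $\sigma_p(]\alpha,\beta])$ for equal ones; $d_p(B,B')=|\delta_p(\alpha,\alpha')|$ for any $\alpha\in B,\alpha'\in B'$ (well defined). A subsemigroup of $(\mathbb N_0,+)$ is a possibly empty subset closed under addition. $\mathcal I_D$: all $p\in\mathcal S_0$ with $d_p(B,B')\notin D$ for all crossing blocks $B,B'$. $h$ is the partition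 with upper row $\circ\bullet\circ$ and lower row $\circ\bullet\circ$ whose blocks are $\{$1st lower, 3rd upper$\}$, $\{$2nd lower, 2nd upper$\}$, $\{$3rd lower, 1st upper$\}$. For a finite subset $w\subseteq\mathbb N$ let $m=\max(w)$ (with $\max(\emptyset):=0$). $\mathrm{Br}_\bullet(w)$ is the partition whose lower row, left to right, is $b_m,\dots,b_1,b_0,c_0,c_1,\dots,c_m$ and whose upper row, left to right, is $b'_m,\dots,b'_0,c'_0,\dots,c'_m$, where all $b_k,b'_k$ are black and all $c_k,c'_k$ are white, with blocks: for $k\in w$, $\{b_k,c_k\}$ and $\{b'_k,c'_k\}$; for $0\le k\le m$ with $k\notin w$, $\{b_k,b'_k\}$ and $\{c_k,c'_k\}$. *)

theory Defs
  imports Main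
begin

datatype col = Wh | Bl

fun opp :: "col \<Rightarrow> col" where
  "opp Wh = Bl" | "opp Bl = Wh"

(* points: Up i = i-th upper point (0-based, left to right),
           Lo j = j-th lower point (0-based, left to right) *)
datatype pt = Up nat | Lo nat

type_synonym part = "col list \<times> col list \<times> pt set set"

definition upr :: "part \<Rightarrow> col list" where "upr p = fst p"
definition lwr :: "part \<Rightarrow> col list" where "lwr p = fst (snd p)"
definition blocks :: "part \<Rightarrow> pt set set" where "blocks p = snd (snd p)"

definition points :: "part \<Rightarrow> pt set" where
  "points p = Up ` {..<length (upr p)} \<union> Lo ` {..<length (lwr p)}"

definition is_part :: "part \<Rightarrow> bool" where
  "is_part p \<longleftrightarrow> (\<forall>B\<in>blocks p. B \<noteq> {})
     \<and> (\<forall>B\<in>blocks p. \<forall>B'\<in>blocks p. B \<noteq> B' \<longrightarrow> B \<inter> B' = {})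
     \<and> \<Union>(blocks p) = points p"

fun shift :: "nat \<Rightarrow> nat \<Rightarrow> pt \<Rightarrow> pt" where
  "shift k l (Up i) = Up (i + k)" | "shift k l (Lo j) = Lo (j + l)"

definition tens :: "part \<Rightarrow> part \<Rightarrow> part" where
  "tens p q = (upr p @ upr q, lwr p @ lwr q,
     blocks p \<union> (image (shift (length (upr p)) (length (lwr p)))) ` blocks q)"

fun flip :: "pt \<Rightarrow> pt" where
  "flip (Up i) = Lo i" | "flip (Lo i) = Up i"

definition invol :: "part \<Rightarrow> part" where
  "invol p = (lwr p, upr p, (image flip) ` blocks p)"

(* points of the stacked picture for a composition: top row of q,
   middle row (= lower row of q = upper row of p), bottom row of p *)
datatype cpt = T nat | M nat | Bo nat

fun top_emb :: "pt \<Rightarrow> cpt" where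
  "top_emb (Up i) = T i" | "top_emb (Lo i) = M i"

fun bot_emb :: "pt \<Rightarrow> cpt" where
  "bot_emb (Up i) = M i" | "bot_emb (Lo i) = Bo i"

definition clink :: "part \<Rightarrow> part \<Rightarrow> cpt \<Rightarrow> cpt \<Rightarrow> bool" where
  "clink p q x y \<longleftrightarrow> (\<exists>B\<in>blocks q. x \<in> top_emb ` B \<and> y \<in> top_emb ` B)
                   \<or> (\<exists>B\<in>blocks p. x \<in> bot_emb ` B \<and> y \<in> bot_emb ` B)"

fun outer :: "cpt \<Rightarrow> bool" where
  "outer (M _) = False" | "outer _ = True"

fun cback :: "cpt \<Rightarrow> pt" where
  "cback (T i) = Up i" | "cback (Bo i) = Lo i" | "cback (M i) = Up i"

(* composition p q: q is put on top of p (defined when lwr q = upr p) *)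
definition comp :: "part \<Rightarrow> part \<Rightarrow> part" where
  "comp p q = (upr q, lwr p,
     {cback ` {y. outer y \<and> (clink p q)\<^sup>*\<^sup>* x y} | x.
        x \<in> T ` {..<length (upr q)} \<union> Bo ` {..<length (lwr p)}})"

inductive_set gen_cat :: "part set \<Rightarrow> part set" for G :: "part set" where
  base: "p \<in> G \<Longrightarrow> p \<in> gen_cat G"
| idp: "([c], [c], {{Up 0, Lo 0}}) \<in> gen_cat G"
| pairWB: "([], [Wh, Bl], {{Lo 0, Lo 1}}) \<in> gen_cat G"
| pairBW: "([], [Bl, Wh], {{Lo 0, Lo 1}}) \<in> gen_cat G"
| tens: "p \<in> gen_cat G \<Longrightarrow> q \<in> gen_cat G \<Longrightarrow> tens p q \<in> gen_cat G"
| invol: "p \<in> gen_cat G \<Longrightarrow> invol p \<in> gen_cat G"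
| comp: "p \<in> gen_cat G \<Longrightarrow> q \<in> gen_cat G \<Longrightarrow> lwr q = upr p \<Longrightarrow> comp p q \<in> gen_cat G"

(* position in the cyclic order: lower row left to right, then upper row right to left *)
fun pos :: "part \<Rightarrow> pt \<Rightarrow> nat" where
  "pos p (Lo j) = j"
| "pos p (Up i) = length (lwr p) + (length (upr p) - 1 - i)"

definition cyc_btw :: "nat \<Rightarrow> nat \<Rightarrow> nat \<Rightarrow> bool" where
  "cyc_btw x y z \<longleftrightarrow> (if x < z then x < y \<and> y < z
                       else if z < x then x < y \<or> y < z else y \<noteq> x)"

definition open_int :: "part \<Rightarrow> pt \<Rightarrow> pt \<Rightarrow> pt set" where
  "open_int p a b = {c \<in> points p. cyc_btw (pos p a) (pos p c) (pos p b)}"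

definition half_open :: "part \<Rightarrow> pt \<Rightarrow> pt \<Rightarrow> pt set" where
  "half_open p a b = (if a = b then {} else open_int p a b \<union> {b})"

fun ncol :: "part \<Rightarrow> pt \<Rightarrow> col" where
  "ncol p (Lo j) = lwr p ! j"
| "ncol p (Up i) = opp (upr p ! i)"

definition sigma :: "part \<Rightarrow> pt set \<Rightarrow> int" where
  "sigma p S = int (card {x\<in>S. ncol p x = Wh}) - int (card {x\<in>S. ncol p x = Bl})"

definition crosses :: "part \<Rightarrow> pt set \<Rightarrow> pt set \<Rightarrow> bool" where
  "crosses p B B' \<longleftrightarrow> B \<noteq> B' \<and>
     (\<exists>a\<in>B. \<exists>b\<in>B. \<exists>c\<in>B'. \<exists>d\<in>B'. a \<noteq> b \<and> c \<in> open_int p a b \<and> d \<in> open_int p b a)"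

definition pair_part :: "part \<Rightarrow> bool" where
  "pair_part p \<longleftrightarrow> is_part p \<and> (\<forall>B\<in>blocks p. card B = 2)"

definition P2nb :: "part set" where
  "P2nb = {p. pair_part p \<and> (\<forall>B\<in>blocks p. \<exists>a b. B = {a, b} \<and> ncol p a \<noteq> ncol p b)}"

definition S0 :: "part set" where
  "S0 = {p \<in> P2nb. \<forall>B\<in>blocks p. \<forall>a\<in>B. \<forall>b\<in>B. a \<noteq> b \<longrightarrow> sigma p (open_int p a b) = 0}"

definition delta :: "part \<Rightarrow> pt \<Rightarrow> pt \<Rightarrow> int" where
  "delta p a b = (if ncol p a \<noteq> ncol p b then sigma p (open_int p a b)
                  else sigma p (half_open p a b))"

(* d_p(B,B') = |delta_p(a,a')| for any a in B, a' in B' (well defined on S0) *)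
definition dist_bl :: "part \<Rightarrow> pt set \<Rightarrow> pt set \<Rightarrow> nat" where
  "dist_bl p B B' = nat \<bar>delta p (SOME a. a \<in> B) (SOME a'. a' \<in> B')\<bar>"

definition I_D :: "nat set \<Rightarrow> part set" where
  "I_D D = {p \<in> S0. \<forall>B\<in>blocks p. \<forall>B'\<in>blocks p. crosses p B B' \<longrightarrow> dist_bl p B B' \<notin> D}"

definition maxw :: "nat set \<Rightarrow> nat" where
  "maxw w = (if w = {} then 0 else Max w)"

(* Br_bullet(w): lower/upper rows b_m..b_0 c_0..c_m; b_k at index m-k, c_k at index m+1+k *)
definition Br :: "nat set \<Rightarrow> part" where
  "Br w = (let m = maxw w in
     (replicate (m+1) Bl @ replicate (m+1) Wh,
      replicate (m+1) Bl @ replicate (m+1) Wh,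
      {{Lo (m - k), Lo (m + 1 + k)} | k. k \<in> w}
      \<union> {{Up (m - k), Up (m + 1 + k)} | k. k \<in> w}
      \<union> {{Lo (m - k), Up (m - k)} | k. k \<le> m \<and> k \<notin> w}
      \<union> {{Lo (m + 1 + k), Up (m + 1 + k)} | k. k \<le> m \<and> k \<notin> w}))"

definition h :: part where
  "h = ([Wh, Bl, Wh], [Wh, Bl, Wh], {{Lo 0, Up 2}, {Lo 1, Up 1}, {Lo 2, Up 0}})"

end

theory Submission
  imports Defs
begin

text \<open>
  Read a partition in cyclic order as a word in which the two points of a block carry the same
  label, once white and once black.  Composition of partitions becomes repeated contraction of
  adjacent letters of opposite colour, which identifies their labels.  If the word is drawn as a
  path of heights, going up at white and down at black points, membership in \<open>I_D D\<close> says that both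
  points of a block lie on the same level and that crossing blocks have a level difference outside
  \<open>D\<close>; both conditions survive contraction, so \<open>I_D D\<close> is a category.

  Conversely, read words as elements of a free group.  The words generated by a category, with
  labels identified at will, form a normal subgroup.  The brackets give a relation in the quotient:
  in a closed path above height \<open>0\<close> the labels on the levels \<open>{0} \<union> D\<close> may be replaced by others that
  depend on the level only.  So an arc at the lowest level may be moved across a segment if the
  strings leaving the segment have levels outside \<open>D\<close>; the strings inside the segment are restored
  by multiplying with a shorter legal word.  Such moves (and, for \<open>0 \<notin> D\<close>, exchanging two arcs of
  the lowest level by means of \<open>h\<close>) shorten every legal word until it is empty.
\<close>

text \<open>Composition glues strings, hence identifies labels; closing the generated words under
  arbitrary substitutions of labels turns gluing into cancellation in a group. Nothing is lost by
  this: a word in which every label occurs once per colour cannot arise by merging labels of another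
  such word, so its triviality in the quotient gives back the partition itself.

  With the lowest level normalized to \<open>0\<close>, a string crossing an arc of level
  \<open>0\<close> has its own level as distance. Legality puts this level outside \<open>D\<close>,
  which is where the bracket relation leaves labels alone. The obstacle is the strings with both
  ends inside the segment below the arc: their levels may lie in \<open>D\<close>, and then the
  relation needs all of them on one level to share a label. Cutting and restoring them takes a word
  of twice the length of the segment. The outer induction covers this word if it is shorter than the
  given one, so an arc is exchanged only over a segment of less than half the length. When the
  neighbouring arc has the shorter segment, the inner induction starts from that arc
  instead.\<close>

section \<open>Labelled coloured words\<close>

type_synonym 'a word = "('a \<times> col) list"

text \<open>The upper row read from right to left in normalized colours. In the free group this is
  the inverse.\<close>

definition mirror :: "'a word \<Rightarrow> 'a word" where
  "mirror z = rev (map (apsnd opp) z)"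

definition lmap :: "('a \<Rightarrow> 'b) \<Rightarrow> 'a word \<Rightarrow> 'b word" where
  "lmap f = map (apfst f)"

abbreviation labels :: "'a word \<Rightarrow> 'a set" where
  "labels z \<equiv> fst ` set z"

abbreviation cyc :: "'a word \<Rightarrow> 'a word \<Rightarrow> 'a word" where
  "cyc U L \<equiv> L @ mirror U"

lemma opp_opp [simp]: "opp (opp c) = c"
  by (cases c) auto

lemma opp_neq [simp]: "opp c \<noteq> c" "c \<noteq> opp c"
  by (cases c; simp)+

lemma opp_inj [simp]: "opp c = opp d \<longleftrightarrow> c = d"
  by (cases c; cases d; simp)

lemma neq_iff_opp: "c \<noteq> d \<longleftrightarrow> c = opp d"
  by (cases c; cases d; simp)

lemma mirror_simps [simp]:
  "mirror [] = []"
  "mirror (x # z) = mirror z @ [(fst x, opp (snd x))]"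
  "mirror (y @ z) = mirror z @ mirror y"
  "mirror (mirror z) = z"
  "length (mirror z) = length z"
  "labels (mirror z) = labels z"
  by (auto simp: mirror_def rev_map apsnd_def map_prod_def image_image split_beta intro!: map_idI)

lemma lmap_simps [simp]:
  "lmap f [] = []"
  "lmap f (x # z) = (f (fst x), snd x) # lmap f z"
  "lmap f (y @ z) = lmap f y @ lmap f z"
  "lmap f (mirror z) = mirror (lmap f z)"
  "length (lmap f z) = length z"
  "labels (lmap f z) = f ` labels z"
  "map snd (lmap f z) = map snd z"
  by (auto simp: mirror_def lmap_def rev_map o_def apsnd_def apfst_def map_prod_def
      image_image split_beta)

lemma lmap_lmap [simp]: "lmap f (lmap g z) = lmap (f \<circ> g) z"
  by (auto simp: lmap_def o_def apfst_def map_prod_def split_beta)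

lemma lmap_id [simp]: "lmap id z = z"
  by (auto simp: lmap_def apfst_def map_prod_def split_beta map_idI)

lemma lmap_cong: "(\<And>a. a \<in> labels z \<Longrightarrow> f a = g a) \<Longrightarrow> lmap f z = lmap g z"
  by (auto simp: lmap_def apfst_def map_prod_def split_beta)

lemma lmap_ident: "(\<And>a. a \<in> labels z \<Longrightarrow> f a = a) \<Longrightarrow> lmap f z = z"
  using lmap_cong[of z f id] by simp

definition cnt :: "'a word \<Rightarrow> 'a \<Rightarrow> col \<Rightarrow> nat" where
  "cnt z a c = count_list z (a, c)"

lemma cnt_simps [simp]:
  "cnt [] a c = 0"
  "cnt (x # z) a c = (if fst x = a \<and> snd x = c then 1 else 0) + cnt z a c"
  "cnt (y @ z) a c = cnt y a c + cnt z a c"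
  by (auto simp: cnt_def)

lemma cnt_mirror [simp]: "cnt (mirror z) a c = cnt z a (opp c)"
  by (induction z) (auto simp: neq_iff_opp)

lemma cnt_0_iff: "cnt z a c = 0 \<longleftrightarrow> (a, c) \<notin> set z"
  by (auto simp: cnt_def count_list_0_iff)

lemma cnt_notin: "a \<notin> labels z \<Longrightarrow> cnt z a c = 0"
  by (metis cnt_0_iff fst_conv image_eqI)

lemma cnt_lmap_inj:
  assumes "inj_on f (insert a (labels z))"
  shows "cnt (lmap f z) (f a) c = cnt z a c"
  using assms
proof (induction z)
  case (Cons x z)
  have "inj_on f (insert a (labels z))"
    by (rule inj_on_subset[OF Cons.prems]) auto
  moreover have "f (fst x) = f a \<longleftrightarrow> fst x = a"
    by (rule inj_on_eq_iff[OF Cons.prems]) simp_all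
  ultimately show ?case using Cons.IH by simp
qed simp

lemma cnt_lmap_notin: "a \<notin> f ` labels z \<Longrightarrow> cnt (lmap f z) a c = 0"
proof (induction z)
  case (Cons x z)
  then have "f (fst x) \<noteq> a" "cnt (lmap f z) a c = 0" by auto
  then show ?case by simp
qed simp

definition ren :: "'a \<Rightarrow> 'a \<Rightarrow> 'a \<Rightarrow> 'a" where
  "ren a b = id(a := b)"

lemma ren_apply [simp]: "ren a b x = (if x = a then b else x)"
  by (simp add: ren_def)

lemma cnt_rename:
  assumes "a \<noteq> b"
  shows "cnt (lmap (ren a b) z) e c
    = (if e = b then cnt z a c + cnt z b c else if e = a then 0 else cnt z e c)"
proof (induction z)
  case (Cons x z)
  show ?case
    unfolding lmap_simps cnt_simps Cons.IH fst_conv snd_conv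
    using assms by simp
qed simp

section \<open>Gauss words and contraction\<close>

text \<open>Signed Gauss words: the labels are the blocks of a partition in \<open>P2nb\<close>, the
  colours are the normalized ones.\<close>

definition gauss :: "'a word \<Rightarrow> bool" where
  "gauss z \<longleftrightarrow> (\<forall>a. cnt z a Wh = cnt z a Bl \<and> cnt z a Wh \<le> 1)"

lemma gaussD:
  assumes "gauss z"
  shows "cnt z a Wh = cnt z a Bl" "cnt z a c \<le> 1"
proof -
  from assms have *: "cnt z a Wh = cnt z a Bl \<and> cnt z a Wh \<le> 1" unfolding gauss_def by blast
  then show "cnt z a Wh = cnt z a Bl" by blast
  from * show "cnt z a c \<le> 1" by (cases c) simp_all
qed

lemma gaussI:
  "(\<And>a. cnt z a Wh = cnt z a Bl) \<Longrightarrow> (\<And>a. cnt z a Wh \<le> 1) \<Longrightarrow> gauss z"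
  by (simp add: gauss_def)

lemma gauss_lmap_inj:
  assumes "inj_on f (labels z)"
  shows "gauss (lmap f z) \<longleftrightarrow> gauss z"
proof -
  have 1: "cnt (lmap f z) (f a) c = cnt z a c" if "a \<in> labels z" for a c
    using assms that by (intro cnt_lmap_inj) (simp add: insert_absorb)
  have 2: "cnt z a c = 0" if "a \<notin> labels z" for a c
    using that by (force simp: cnt_0_iff)
  show ?thesis
  proof
    assume g: "gauss (lmap f z)"
    show "gauss z"
      unfolding gauss_def
    proof
      fix a
      show "cnt z a Wh = cnt z a Bl \<and> cnt z a Wh \<le> 1"
      proof (cases "a \<in> labels z")
        case True
        then show ?thesis using g 1[OF True] unfolding gauss_def by metis
      qed (use 2 in simp)
    qed
  next
    assume g: "gauss z"
    show "gauss (lmap f z)"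
      unfolding gauss_def
    proof
      fix e
      show "cnt (lmap f z) e Wh = cnt (lmap f z) e Bl \<and> cnt (lmap f z) e Wh \<le> 1"
      proof (cases "e \<in> f ` labels z")
        case True
        then obtain a where "a \<in> labels z" "e = f a" by blast
        then show ?thesis using gaussD[OF g, of a] 1[of a] by simp
      next
        case False
        then show ?thesis by (simp add: cnt_lmap_notin)
      qed
    qed
  qed
qed

lemma gauss_append:
  assumes "gauss y" "gauss z" "labels y \<inter> labels z = {}"
  shows "gauss (y @ z)"
proof -
  have "cnt (y @ z) a Wh = cnt (y @ z) a Bl \<and> cnt (y @ z) a Wh \<le> 1" for a
  proof (cases "a \<in> labels y")
    case True
    then have "a \<notin> labels z" using assms(3) by blast
    then show ?thesis using gaussD[OF assms(1), of a] by (simp add: cnt_notin)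
  next
    case False
    then show ?thesis using gaussD[OF assms(2), of a] by (simp add: cnt_notin)
  qed
  then show ?thesis unfolding gauss_def by blast
qed

text \<open>For \<open>a \<noteq> b\<close> the deletion leaves one letter of each label, of
  opposite colours, and merging makes them a new pair. For \<open>a = b\<close> a whole block
  disappears.\<close>

lemma gauss_contract:
  assumes "gauss (A @ (a, c) # (b, opp c) # B)"
  shows "gauss (lmap (ren a b) (A @ B))"
proof -
  define w where "w = A @ B"
  define da where "da d e = (if e = a \<and> d = c then 1 else 0::nat)" for d e
  define db where "db d e = (if e = b \<and> d = opp c then 1 else 0::nat)" for d e
  have cnt: "cnt (A @ (a, c) # (b, opp c) # B) e d = cnt w e d + da d e + db d e" for e d
    by (auto simp: w_def da_def db_def)
  have g: "cnt w e Wh + da Wh e + db Wh e = cnt w e Bl + da Bl e + db Bl e"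
          "cnt w e Wh + da Wh e + db Wh e \<le> 1" "cnt w e Bl + da Bl e + db Bl e \<le> 1" for e
    using gaussD(1)[OF assms, of e] gaussD(2)[OF assms, of e Wh] gaussD(2)[OF assms, of e Bl]
    unfolding cnt by blast+
  have "gauss (lmap (ren a b) w)"
  proof (cases "a = b")
    case True
    then have *: "lmap (ren a b) w = w"
      by (intro lmap_ident) auto
    have "cnt w e Wh = cnt w e Bl \<and> cnt w e Wh \<le> 1" for e
      using g(1)[of e] g(2)[of e] True by (cases c) (simp_all add: da_def db_def split: if_splits)
    then show ?thesis unfolding * gauss_def by blast
  next
    case False
    have "cnt w a Wh + cnt w b Wh = cnt w a Bl + cnt w b Bl \<and> cnt w a Wh + cnt w b Wh \<le> 1"
      using g[of a] g[of b] False by (cases c) (simp_all add: da_def db_def)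
    moreover have "cnt w e Wh = cnt w e Bl \<and> cnt w e Wh \<le> 1" if "e \<noteq> a" "e \<noteq> b" for e
      using g(1)[of e] g(2)[of e] that by (simp add: da_def db_def)
    ultimately show ?thesis
      unfolding gauss_def cnt_rename[OF False] by (smt (verit, best) zero_le)
  qed
  then show ?thesis unfolding w_def .
qed

text \<open>Cancels \<open>m\<close> against the mirrored \<open>m'\<close> from the inside
  outwards; the renamings forced on the way accumulate in \<open>\<psi>\<close>. The equation
  \<open>\<Phi> \<circ> \<psi> = \<Phi>\<close> records that nothing is identified beyond what
  \<open>\<Phi>\<close> identifies, so a labelling of the uncontracted word descends to the
  contracted one. \<open>Q\<close> is abstract in order to serve both \<open>gauss\<close> and
  \<open>legal D\<close>.\<close>

lemma contract:
  assumes step: "\<And>A a b c B. Q (A @ (a, c) # (b, opp c) # B) \<Longrightarrow> Q (lmap (ren a b) (A @ B))"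
    and "Q (A @ m @ mirror m' @ B)" "map snd m = map snd m'" "lmap \<Phi> m = lmap \<Phi> m'"
  shows "\<exists>\<psi>. lmap \<psi> m = lmap \<psi> m' \<and> Q (lmap \<psi> (A @ B)) \<and> \<Phi> \<circ> \<psi> = \<Phi>"
  using assms(2-)
\<comment> \<open>Induction on the length, since every cancellation relabels the rest of
  \<open>m\<close>.\<close>
proof (induction m arbitrary: A B m' rule: length_induct)
  case (1 m)
  show ?case
  proof (cases m rule: rev_cases)
    case Nil
    then have "m' = []" "Q (A @ B)" using 1(2,3) by simp_all
    then show ?thesis using Nil by (intro exI[of _ id] conjI) (simp_all only: lmap_simps lmap_id o_id)
  next
    case (snoc m0 x)
    obtain a c where x: "x = (a, c)" by (cases x)
    from snoc 1(3) obtain m0' y where m': "m' = m0' @ [y]" by (cases m' rule: rev_cases) auto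
    obtain b c' where y: "y = (b, c')" by (cases y)
    have c: "c' = c" "map snd m0 = map snd m0'" and ab: "\<Phi> a = \<Phi> b" "lmap \<Phi> m0 = lmap \<Phi> m0'"
      using 1(3,4) snoc x y m' by auto
    let ?r = "ren a b"
    have \<Phi>r: "\<Phi> \<circ> ?r = \<Phi>" using ab by auto
    have "Q (lmap ?r ((A @ m0) @ (mirror m0' @ B)))"
      using 1(2) snoc x y m' c by (intro step[of _ a c b]) auto
    then have "Q (lmap ?r A @ lmap ?r m0 @ mirror (lmap ?r m0') @ lmap ?r B)" by simp
    moreover have "map snd (lmap ?r m0) = map snd (lmap ?r m0')"
      "lmap \<Phi> (lmap ?r m0) = lmap \<Phi> (lmap ?r m0')"
      using c(2) ab(2) \<Phi>r by (simp_all only: lmap_simps lmap_lmap)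
    moreover have "length (lmap ?r m0) < length m" using snoc by simp
    ultimately obtain \<psi> where \<psi>: "lmap \<psi> (lmap ?r m0) = lmap \<psi> (lmap ?r m0')"
      "Q (lmap \<psi> (lmap ?r A @ lmap ?r B))" "\<Phi> \<circ> \<psi> = \<Phi>"
      using 1(1) by blast
    have "(\<psi> \<circ> ?r) a = (\<psi> \<circ> ?r) b" by simp
    moreover have "\<Phi> \<circ> (\<psi> \<circ> ?r) = \<Phi>" using \<psi>(3) \<Phi>r by (simp only: comp_assoc[symmetric])
    moreover have "lmap (\<psi> \<circ> ?r) m0 = lmap (\<psi> \<circ> ?r) m0'" "Q (lmap (\<psi> \<circ> ?r) (A @ B))"
      using \<psi>(1,2) by (simp_all only: lmap_simps lmap_lmap)
    ultimately show ?thesis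
      using snoc x y m' c
      by (intro exI[of _ "\<psi> \<circ> ?r"] conjI) (simp_all only: lmap_simps fst_conv snd_conv)
  qed
qed

subsection \<open>Levels and crossings\<close>

text \<open>\<open>path lv k z l\<close>: the word \<open>z\<close> leads from height \<open>k\<close> to height \<open>l\<close>, where the step between the
  heights \<open>i\<close> and \<open>i + 1\<close>, in either direction, has level \<open>i\<close>.\<close>

fun path :: "('a \<Rightarrow> int) \<Rightarrow> int \<Rightarrow> 'a word \<Rightarrow> int \<Rightarrow> bool" where
  "path lv k [] l \<longleftrightarrow> k = l"
| "path lv k ((a, Wh) # z) l \<longleftrightarrow> lv a = k \<and> path lv (k + 1) z l"
| "path lv k ((a, Bl) # z) l \<longleftrightarrow> lv a = k - 1 \<and> path lv (k - 1) z l"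

lemma path_append: "path lv k (y @ z) l \<longleftrightarrow> (\<exists>i. path lv k y i \<and> path lv i z l)"
proof (induction y arbitrary: k)
  case (Cons x y)
  then show ?case by (cases x; cases "snd x") simp_all
qed simp

lemma path_snoc:
  "path lv k (z @ [(a, Wh)]) l \<longleftrightarrow> lv a = l - 1 \<and> path lv k z (l - 1)"
  "path lv k (z @ [(a, Bl)]) l \<longleftrightarrow> lv a = l \<and> path lv k z (l + 1)"
proof -
  have *: "path lv i [(a, Wh)] l \<longleftrightarrow> i = l - 1 \<and> lv a = l - 1"
    "path lv i [(a, Bl)] l \<longleftrightarrow> i = l + 1 \<and> lv a = l" for i
    by auto
  show "path lv k (z @ [(a, Wh)]) l \<longleftrightarrow> lv a = l - 1 \<and> path lv k z (l - 1)"
    unfolding path_append * by blast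
  show "path lv k (z @ [(a, Bl)]) l \<longleftrightarrow> lv a = l \<and> path lv k z (l + 1)"
    unfolding path_append * by blast
qed

lemma path_mirror: "path lv k (mirror z) l \<longleftrightarrow> path lv l z k"
proof (induction z arbitrary: l)
  case (Cons x z)
  obtain a c where x: "x = (a, c)" by (cases x)
  show ?case
    by (cases c) (simp_all add: x path_snoc Cons.IH)
qed auto

lemma path_lmap: "path lv k (lmap f z) l \<longleftrightarrow> path (\<lambda>a. lv (f a)) k z l"
proof (induction z arbitrary: k)
  case (Cons x z)
  then show ?case by (cases x; cases "snd x") simp_all
qed simp

lemma path_shift: "path (\<lambda>a. lv a + i) (k + i) z (l + i) \<longleftrightarrow> path lv k z l"
proof (induction z arbitrary: k)
  case (Cons x z)
  from Cons[of "k + 1"] Cons[of "k - 1"] show ?case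
    by (cases x; cases "snd x") (simp_all add: algebra_simps)
qed simp

lemma path_cong: "(\<And>a. a \<in> labels z \<Longrightarrow> lv a = lv' a) \<Longrightarrow> path lv k z l \<longleftrightarrow> path lv' k z l"
proof (induction z arbitrary: k)
  case (Cons x z)
  then show ?case by (cases x; cases "snd x") simp_all
qed simp

lemma path_functional: "path lv k z l \<Longrightarrow> path lv k z l' \<Longrightarrow> l = l'"
proof (induction z arbitrary: k)
  case (Cons x z)
  then show ?case by (cases x; cases "snd x") auto
qed simp

definition restr :: "'a \<Rightarrow> 'a \<Rightarrow> 'a word \<Rightarrow> 'a list" where
  "restr a b z = filter (\<lambda>x. x = a \<or> x = b) (map fst z)"

lemma restr_simps [simp]:
  "restr a b [] = []"
  "restr a b (x # z) = (if fst x = a \<or> fst x = b then fst x # restr a b z else restr a b z)"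
  "restr a b (y @ z) = restr a b y @ restr a b z"
  "restr a b (mirror z) = rev (restr a b z)"
  by (auto simp: restr_def rev_filter mirror_def rev_map o_def)

definition cross :: "'a word \<Rightarrow> 'a \<Rightarrow> 'a \<Rightarrow> bool" where
  "cross z a b \<longleftrightarrow> a \<noteq> b \<and> restr a b z \<in> {[a, b, a, b], [b, a, b, a]}"

lemma restr_commute: "restr a b z = restr b a z"
  by (auto simp: restr_def intro!: arg_cong2[of _ _ _ _ filter])

lemma cross_commute: "cross z a b \<longleftrightarrow> cross z b a"
  by (auto simp: cross_def restr_commute)

definition okay :: "nat set \<Rightarrow> ('a \<Rightarrow> int) \<Rightarrow> 'a word \<Rightarrow> bool" where
  "okay D lv z \<longleftrightarrow> (\<forall>a b. cross z a b \<longrightarrow> nat \<bar>lv a - lv b\<bar> \<notin> D)"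

text \<open>The base height \<open>k\<close> is left free so that legality is invariant under
  rotation, which moves the starting point to another height.\<close>

definition legal :: "nat set \<Rightarrow> 'a word \<Rightarrow> bool" where
  "legal D z \<longleftrightarrow> gauss z \<and> (\<exists>lv k. path lv k z k \<and> okay D lv z)"

lemma restr_lmap_inj:
  assumes "inj_on f (insert a (insert b (labels z)))"
  shows "restr (f a) (f b) (lmap f z) = map f (restr a b z)"
  using assms
proof (induction z)
  case (Cons x z)
  have "inj_on f (insert a (insert b (labels z)))"
    by (rule inj_on_subset[OF Cons.prems]) auto
  moreover have "f (fst x) = f a \<longleftrightarrow> fst x = a" "f (fst x) = f b \<longleftrightarrow> fst x = b"
    by (rule inj_on_eq_iff[OF Cons.prems]; simp)+
  ultimately show ?case using Cons.IH by simp
qed simp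

lemma restr_subset: "set (restr a b z) = {a, b} \<inter> labels z"
  by (auto simp: restr_def)

lemma cross_in:
  assumes "cross z a b"
  shows "a \<in> labels z \<and> b \<in> labels z"
proof -
  from assms have "restr a b z = [a, b, a, b] \<or> restr a b z = [b, a, b, a]"
    by (simp add: cross_def)
  then have "a \<in> set (restr a b z)" "b \<in> set (restr a b z)" by (elim disjE; simp)+
  then show ?thesis by (auto simp: restr_subset)
qed

lemma cross_lmap_inj:
  assumes "inj_on f (labels z)"
  shows "cross (lmap f z) e g \<longleftrightarrow> (\<exists>a b. e = f a \<and> g = f b \<and> cross z a b)"
proof -
  have *: "cross (lmap f z) (f a) (f b) \<longleftrightarrow> cross z a b"
    if ab: "a \<in> labels z" "b \<in> labels z" for a b
  proof -
    have r: "restr (f a) (f b) (lmap f z) = map f (restr a b z)"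
      by (rule restr_lmap_inj) (use ab assms in \<open>simp add: insert_absorb\<close>)
    have i: "inj_on f (set (restr a b z) \<union> {a, b})"
      by (rule inj_on_subset[OF assms]) (use ab restr_subset[of a b z] in auto)
    have "map f (restr a b z) = map f [a, b, a, b] \<longleftrightarrow> restr a b z = [a, b, a, b]"
      "map f (restr a b z) = map f [b, a, b, a] \<longleftrightarrow> restr a b z = [b, a, b, a]"
      by (rule inj_on_map_eq_map; use i in \<open>simp add: insert_commute\<close>)+
    moreover have "f a = f b \<longleftrightarrow> a = b" using ab assms by (simp add: inj_on_eq_iff)
    ultimately show ?thesis
      unfolding cross_def r by (simp only: insert_iff empty_iff list.map)
  qed
  show ?thesis
  proof
    assume c: "cross (lmap f z) e g"
    have "e \<in> f ` (labels z)" "g \<in> f ` (labels z)"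
      using cross_in[OF c] by simp_all
    from this(1) obtain a where a: "e = f a" "a \<in> labels z" by (rule imageE)
    from \<open>g \<in> f ` (labels z)\<close> obtain b where b: "g = f b" "b \<in> labels z" by (rule imageE)
    note ab = a(2) b(2) a(1) b(1)
    then have "cross z a b" using c *[OF ab(1,2)] by simp
    then show "\<exists>a b. e = f a \<and> g = f b \<and> cross z a b" using ab by blast
  next
    assume "\<exists>a b. e = f a \<and> g = f b \<and> cross z a b"
    then obtain a b where ab: "e = f a" "g = f b" "cross z a b" by blast
    then show "cross (lmap f z) e g" using *[of a b] cross_in[OF ab(3)] by simp
  qed
qed

lemma legal_lmap_inj:
  assumes "inj_on f (labels z)" "legal D z"
  shows "legal D (lmap f z)"
proof -
  from assms obtain lv k where *: "gauss z" "path lv k z k" "okay D lv z" by (auto simp: legal_def)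
  let ?lv' = "\<lambda>e. lv (inv_into (labels z) f e)"
  have inv: "?lv' (f a) = lv a" if "a \<in> labels z" for a
    using assms that by simp
  have "path (\<lambda>a. ?lv' (f a)) k z k"
    by (subst path_cong[OF inv]) (use * in simp_all)
  then have "path ?lv' k (lmap f z) k" by (simp only: path_lmap)
  moreover have "okay D ?lv' (lmap f z)"
    unfolding okay_def
  proof (intro allI impI)
    fix e g assume "cross (lmap f z) e g"
    then obtain a b where ab: "e = f a" "g = f b" "cross z a b"
      using cross_lmap_inj[OF assms(1)] by blast
    show "nat \<bar>?lv' e - ?lv' g\<bar> \<notin> D"
      unfolding ab(1,2) inv[OF cross_in[OF ab(3), THEN conjunct1]]
        inv[OF cross_in[OF ab(3), THEN conjunct2]]
      using *(3) ab(3) by (simp add: okay_def)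
  qed
  ultimately show ?thesis
    using *(1) gauss_lmap_inj[OF assms(1)] unfolding legal_def by blast
qed

section \<open>Occurrences and interlacing of two labels\<close>

definition occ :: "'a word \<Rightarrow> 'a \<Rightarrow> nat" where
  "occ z a = count_list (map fst z) a"

lemma occ_simps [simp]:
  "occ [] a = 0"
  "occ (x # z) a = (if fst x = a then 1 else 0) + occ z a"
  "occ (y @ z) a = occ y a + occ z a"
  by (auto simp: occ_def)

lemma occ_cnt: "occ z a = cnt z a Wh + cnt z a Bl"
proof (induction z)
  case (Cons x z)
  then show ?case by (cases "snd x") simp_all
qed simp

lemma occ_0_iff: "occ z a = 0 \<longleftrightarrow> a \<notin> labels z"
  by (simp add: occ_def count_list_0_iff)

lemma occ_mirror [simp]: "occ (mirror z) a = occ z a"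
  by (simp add: occ_cnt)

lemma gauss_occ:
  assumes "gauss z" "a \<in> labels z"
  shows "occ z a = 2"
proof -
  have "occ z a \<noteq> 0" using assms by (simp add: occ_0_iff)
  then show ?thesis
    using gaussD(1)[OF assms(1), of a] gaussD(2)[OF assms(1), of a Wh] by (simp add: occ_cnt)
qed

lemma gauss_occ_cases:
  assumes "gauss z"
  shows "occ z a = 0 \<or> occ z a = 2"
  using gauss_occ[OF assms, of a] occ_0_iff[of z a] by blast

lemma restr_replicate: "occ z b = 0 \<Longrightarrow> restr a b z = replicate (occ z a) a"
  by (induction z) (auto split: if_splits)

lemma restr_replicate': "occ z a = 0 \<Longrightarrow> restr a b z = replicate (occ z b) b"
  by (induction z) (auto split: if_splits)

lemma restr_none: "occ z a = 0 \<Longrightarrow> occ z b = 0 \<Longrightarrow> restr a b z = []"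
  by (simp add: restr_replicate)

lemma count_restr: "count_list (restr a b z) a = occ z a" "count_list (restr a b z) b = occ z b"
  by (induction z) auto

lemma length_restr: "a \<noteq> b \<Longrightarrow> length (restr a b z) = occ z a + occ z b"
  by (induction z) auto

lemma restr_1_1:
  assumes "a \<noteq> b" "occ z a = 1" "occ z b = 1"
  shows "restr a b z = [a, b] \<or> restr a b z = [b, a]"
proof -
  have "length (restr a b z) = 2" using assms by (simp add: length_restr)
  then obtain p q where pq: "restr a b z = [p, q]"
    by (metis (no_types) One_nat_def Suc_1 length_0_conv length_Suc_conv)
  have "p \<in> {a, b}" "q \<in> {a, b}" using pq restr_subset[of a b z] by auto
  then show ?thesis using pq count_restr[of a b z] assms by auto
qed

lemma restr_2_1:
  assumes "a \<noteq> b" "occ z a = 2" "occ z b = 1"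
  shows "restr a b z = [a, a, b] \<or> restr a b z = [a, b, a] \<or> restr a b z = [b, a, a]"
proof -
  have "length (restr a b z) = 3" using assms by (simp add: length_restr)
  then obtain p q r where pq: "restr a b z = [p, q, r]"
    by (metis (no_types) length_0_conv length_Suc_conv numeral_3_eq_3)
  have "p \<in> {a, b}" "q \<in> {a, b}" "r \<in> {a, b}" using pq restr_subset[of a b z] by auto
  then show ?thesis using pq count_restr[of a b z] assms by auto
qed

lemma crossD:
  assumes "cross z a b"
  shows "a \<noteq> b" "restr a b z = [a, b, a, b] \<or> restr a b z = [b, a, b, a]"
  using assms by (simp_all add: cross_def)

lemma cross_occ:
  assumes "cross z a b"
  shows "occ z a = 2" "occ z b = 2"
  using crossD[OF assms] count_restr[of a b z] by auto

lemma okayI: "(\<And>a b. cross z a b \<Longrightarrow> nat \<bar>lv a - lv b\<bar> \<notin> D) \<Longrightarrow> okay D lv z"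
  unfolding okay_def by blast

lemma okayD: "okay D lv z \<Longrightarrow> cross z a b \<Longrightarrow> nat \<bar>lv a - lv b\<bar> \<notin> D"
  unfolding okay_def by blast

text \<open>For surgery that affects the crossings of a single string \<open>u\<close>; symmetry of
  crossing reduces the pairs containing \<open>u\<close> to those with \<open>u\<close> in
  front.\<close>

lemma okay_by_focus:
  assumes "\<And>b. cross z u b \<Longrightarrow> nat \<bar>lv u - lv b\<bar> \<notin> D"
    and "\<And>a b. a \<noteq> u \<Longrightarrow> b \<noteq> u \<Longrightarrow> cross z a b \<Longrightarrow> nat \<bar>lv a - lv b\<bar> \<notin> D"
  shows "okay D lv z"
proof (rule okayI)
  fix a b assume c: "cross z a b"
  show "nat \<bar>lv a - lv b\<bar> \<notin> D"
  proof (cases "b = u")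
    case True
    then have "nat \<bar>lv b - lv a\<bar> \<notin> D" using c assms(1)[of a] by (simp add: cross_commute)
    then show ?thesis by (simp add: abs_minus_commute)
  next
    case False
    then show ?thesis using c assms(1)[of b] assms(2)[of a b] by (cases "a = u") simp_all
  qed
qed

text \<open>\<open>X\<close> and \<open>Y\<close> list the labels \<open>a\<close>,
  \<open>b\<close>, \<open>e\<close> to the left and to the right of the contracted pair. The chord
  \<open>e\<close> separates the two remaining ends of the merged string, so it separates the place
  of contraction from one of them; hence \<open>e\<close> crosses \<open>a\<close> or
  \<open>b\<close> already before.\<close>

lemma ren_crossing:
  assumes "map (ren a b) (X @ Y) = [b, e, b, e] \<or> map (ren a b) (X @ Y) = [e, b, e, b]"
    and "count_list (X @ Y) a = 1" "a \<noteq> b" "e \<noteq> a" "e \<noteq> b"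
  defines "F \<equiv> \<lambda>c. filter (\<lambda>x. x = c \<or> x = e) (X @ [a, b] @ Y)"
  shows "(F a = [a, e, a, e] \<or> F a = [e, a, e, a]) \<or> (F b = [b, e, b, e] \<or> F b = [e, b, e, b])"
proof -
  have r: "ren a b x = e \<longleftrightarrow> x = e" "ren a b x = b \<longleftrightarrow> x = a \<or> x = b" for x
    using assms(3-5) by auto
  have "length xs = 4" if "xs = [b, e, b, e] \<or> xs = [e, b, e, b]" for xs
    using that by auto
  from this[OF assms(1)] have "length (map (ren a b) (X @ Y)) = 4" .
  then have "length (X @ Y) = 4" by (simp only: length_map)
  have "\<exists>p q s t. xs = [p, q, s, t]" if "length xs = 4" for xs :: "'a list"
    using that by (auto simp: length_Suc_conv eval_nat_numeral)
  from this[OF \<open>length (X @ Y) = 4\<close>] obtain p q s t where XY: "X @ Y = [p, q, s, t]" by blast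
  have "length X \<le> 4" using \<open>length (X @ Y) = 4\<close> by simp
  then have "length X \<in> {0, 1, 2, 3, 4}" unfolding insert_iff by linarith
  moreover have "X = take (length X) [p, q, s, t]" "Y = drop (length X) [p, q, s, t]"
    unfolding XY[symmetric] by simp_all
  \<comment> \<open>Five places for the contracted pair and four arrangements of the letters leave
    finitely many configurations to check.\<close>
  ultimately have sp: "(X = [] \<and> Y = [p, q, s, t]) \<or> (X = [p] \<and> Y = [q, s, t]) \<or>
      (X = [p, q] \<and> Y = [s, t]) \<or> (X = [p, q, s] \<and> Y = [t]) \<or> (X = [p, q, s, t] \<and> Y = [])"
    by (elim insertE emptyE) (simp_all add: eval_nat_numeral)
  from assms(1) have "((p = a \<or> p = b) \<and> q = e \<and> (s = a \<or> s = b) \<and> t = e) \<or>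
      (p = e \<and> (q = a \<or> q = b) \<and> s = e \<and> (t = a \<or> t = b))"
    unfolding XY by (simp only: list.map list.inject r) blast
  then have "(p = a \<and> q = e \<and> s = b \<and> t = e) \<or> (p = b \<and> q = e \<and> s = a \<and> t = e) \<or>
     (p = e \<and> q = a \<and> s = e \<and> t = b) \<or> (p = e \<and> q = b \<and> s = e \<and> t = a)"
    using assms(2-) unfolding XY by auto
  then show ?thesis
    using sp assms(3-5) unfolding F_def
    by (elim disjE conjE; simp)
qed

text \<open>A crossing of the merged string is inherited from \<open>a\<close> or from
  \<open>b\<close>, and both have the level of the merged string.\<close>

lemma okay_contract:
  assumes g: "gauss (A @ (a, c) # (b, opp c) # B)"
    and ok: "okay D lv (A @ (a, c) # (b, opp c) # B)" and lv: "lv a = lv b"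
  shows "okay D lv (lmap (ren a b) (A @ B))"
proof (cases "a = b")
  case True
  have *: "lmap (ren a b) (A @ B) = A @ B"
    by (rule lmap_ident) (simp add: True)
  have b0: "occ (A @ B) b = 0"
    using gauss_occ_cases[OF g, of b] True by auto
  show ?thesis
    unfolding *
  proof (rule okayI)
    fix e f assume c: "cross (A @ B) e f"
    have "e \<noteq> b" "f \<noteq> b" using cross_occ[OF c] b0 by auto
    then have "restr e f (A @ (a, c) # (b, opp c) # B) = restr e f (A @ B)"
      using True by simp
    then have "cross (A @ (a, c) # (b, opp c) # B) e f" using c by (simp add: cross_def)
    then show "nat \<bar>lv e - lv f\<bar> \<notin> D" by (rule okayD[OF ok])
  qed
next
  case False
  let ?z = "A @ (a, c) # (b, opp c) # B" and ?z' = "lmap (ren a b) (A @ B)"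
  have a1: "occ (A @ B) a = 1"
    using gauss_occ[OF g, of a] False by simp
  have na: "occ ?z' a = 0" using False by (auto simp: occ_0_iff)
  show ?thesis
  proof (rule okay_by_focus[of _ b])
    fix e assume c: "cross ?z' b e"
    have e: "e \<noteq> b" "e \<noteq> a" using crossD(1)[OF c] cross_occ[OF c] na by auto
    let ?F = "filter (\<lambda>x. x = a \<or> x = b \<or> x = e)"
    have F: "restr b e (lmap (ren a b) w) = map (ren a b) (?F (map fst w))" for w
      using e False by (induction w) auto
    have G: "restr d e w = filter (\<lambda>x. x = d \<or> x = e) (?F (map fst w))" if "d = a \<or> d = b" for w d
      using that by (induction w) auto
    have "count_list (?F (map fst w)) a = occ w a" for w
      by (induction w) auto
    then have cl: "count_list (?F (map fst A) @ ?F (map fst B)) a = 1"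
      using a1 by simp
    have "map (ren a b) (?F (map fst A) @ ?F (map fst B)) = [b, e, b, e] \<or>
          map (ren a b) (?F (map fst A) @ ?F (map fst B)) = [e, b, e, b]"
      using crossD(2)[OF c] unfolding F map_append filter_append .
    from ren_crossing[OF this cl False e(2,1)]
    have "cross ?z a e \<or> cross ?z b e"
      using e False unfolding cross_def by (simp add: G)
    then show "nat \<bar>lv b - lv e\<bar> \<notin> D" using okayD[OF ok] lv by metis
  next
    fix e f assume ef: "e \<noteq> b" "f \<noteq> b" "cross ?z' e f"
    have ea: "e \<noteq> a" "f \<noteq> a" using cross_occ[OF ef(3)] na by auto
    have "restr e f (lmap (ren a b) w) = restr e f w" for w
      using ef ea by (induction w) auto
    then have "restr e f ?z = restr e f ?z'" using ef ea by simp
    then have "cross ?z e f" using ef(3) by (simp add: cross_def)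
    then show "nat \<bar>lv e - lv f\<bar> \<notin> D" by (rule okayD[OF ok])
  qed
qed

lemma path_ren: "lv a = lv b \<Longrightarrow> path lv k (lmap (ren a b) z) l \<longleftrightarrow> path lv k z l"
  by (simp only: path_lmap, rule path_cong) simp

text \<open>Adjacent letters of opposite colour traverse the same step of the path up and down, so
  their levels agree automatically.\<close>

lemma legal_contract:
  assumes "legal D (A @ (a, c) # (b, opp c) # B)"
  shows "legal D (lmap (ren a b) (A @ B))"
proof -
  from assms obtain lv k where z: "gauss (A @ (a, c) # (b, opp c) # B)"
    "path lv k (A @ (a, c) # (b, opp c) # B) k" "okay D lv (A @ (a, c) # (b, opp c) # B)"
    unfolding legal_def by blast
  from z(2) obtain i where i: "path lv k A i" "path lv i ((a, c) # (b, opp c) # B) k"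
    unfolding path_append by blast
  have lv: "lv a = lv b \<and> path lv i B k"
    using i(2) by (cases c) simp_all
  then have "path lv k (A @ B) k" using i(1) unfolding path_append by blast
  then have "path lv k (lmap (ren a b) (A @ B)) k" using lv path_ren by metis
  then show ?thesis
    using gauss_contract[OF z(1)] okay_contract[OF z(1,3)] lv unfolding legal_def by blast
qed

lemma okay_append:
  assumes "labels y \<inter> labels z = {}" "okay D lv y" "okay D lv z"
  shows "okay D lv (y @ z)"
proof (rule okayI)
  fix a b assume c: "cross (y @ z) a b"
  have d: "occ y e = 0 \<or> occ z e = 0" for e using assms(1) unfolding occ_0_iff by blast
  note cd = crossD[OF c]
  have "restr a b z = [] \<or> restr a b y = []"
  proof (rule ccontr)
    assume "\<not> ?thesis"
    then have "(occ y a = 0 \<and> occ z b = 0) \<or> (occ z a = 0 \<and> occ y b = 0)"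
      using d[of a] d[of b] restr_none[of y a b] restr_none[of z a b] by auto
    then show False
    proof
      assume *: "occ y a = 0 \<and> occ z b = 0"
      then have "restr a b (y @ z) = replicate (occ y b) b @ replicate (occ z a) a"
        by (simp add: restr_replicate restr_replicate')
      moreover have "occ y b = 2" "occ z a = 2" using * cross_occ[OF c] by simp_all
      ultimately show False using cd by (simp add: numeral_2_eq_2)
    next
      assume *: "occ z a = 0 \<and> occ y b = 0"
      then have "restr a b (y @ z) = replicate (occ y a) a @ replicate (occ z b) b"
        by (simp add: restr_replicate restr_replicate')
      moreover have "occ z b = 2" "occ y a = 2" using * cross_occ[OF c] by simp_all
      ultimately show False using cd by (simp add: numeral_2_eq_2)
    qed
  qed
  then have "cross y a b \<or> cross z a b" using cd by (auto simp: cross_def)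
  then show "nat \<bar>lv a - lv b\<bar> \<notin> D" using okayD assms(2,3) by metis
qed

lemma okay_cong:
  assumes "\<And>a. a \<in> labels z \<Longrightarrow> lv a = lv' a" "okay D lv z"
  shows "okay D lv' z"
proof (rule okayI)
  fix a b assume c: "cross z a b"
  then have "nat \<bar>lv a - lv b\<bar> \<notin> D" using assms(2) okayD by metis
  moreover have "lv a = lv' a" "lv b = lv' b" using cross_in[OF c] assms(1) by blast+
  ultimately show "nat \<bar>lv' a - lv' b\<bar> \<notin> D" by simp
qed

lemma legal_append:
  assumes "labels y \<inter> labels z = {}" "legal D y" "legal D z"
  shows "legal D (y @ z)"
proof -
  from assms(2) obtain lv k where y: "gauss y" "path lv k y k" "okay D lv y"
    unfolding legal_def by blast
  from assms(3) obtain lv' k' where z: "gauss z" "path lv' k' z k'" "okay D lv' z"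
    unfolding legal_def by blast
  \<comment> \<open>The second word is lifted to start at the height \<open>k\<close> where the
    first one ends.\<close>
  define m where "m a = (if a \<in> labels y then lv a else lv' a + (k - k'))" for a
  have my: "lv a = m a" if "a \<in> labels y" for a using that by (simp add: m_def)
  have mz: "lv' a + (k - k') = m a" if "a \<in> labels z" for a
    using that assms(1) by (auto simp: m_def)
  have "path m k y k" using y(2) path_cong[of y lv m k k] my by blast
  moreover have "path (\<lambda>a. lv' a + (k - k')) (k' + (k - k')) z (k' + (k - k'))"
    using z(2) path_shift[of lv' "k - k'" k' z k'] by blast
  then have "path m k z k" using path_cong[of z "\<lambda>a. lv' a + (k - k')" m k k] mz by simp
  ultimately have "path m k (y @ z) k" unfolding path_append by blast
  moreover have "okay D m y" using okay_cong[of y lv m] my y(3) by blast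
  moreover have "okay D (\<lambda>a. lv' a + (k - k')) z" using z(3) by (simp add: okay_def)
  then have "okay D m z" using okay_cong[of z "\<lambda>a. lv' a + (k - k')" m] mz by blast
  ultimately show ?thesis
    using gauss_append[OF y(1) z(1) assms(1)] okay_append[OF assms(1)] unfolding legal_def by blast
qed

section \<open>Partitions given by labelled rows\<close>

definition pts :: "'a word \<Rightarrow> 'a word \<Rightarrow> pt set" where
  "pts U L = Up ` {..<length U} \<union> Lo ` {..<length L}"

fun labp :: "'a word \<Rightarrow> 'a word \<Rightarrow> pt \<Rightarrow> 'a" where
  "labp U L (Up i) = fst (U ! i)"
| "labp U L (Lo j) = fst (L ! j)"

definition cls :: "'a word \<Rightarrow> 'a word \<Rightarrow> 'a \<Rightarrow> pt set" where
  "cls U L a = {x \<in> pts U L. labp U L x = a}"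

definition gp :: "'a word \<Rightarrow> 'a word \<Rightarrow> part" where
  "gp U L = (map snd U, map snd L, cls U L ` labels (cyc U L))"

lemma gp_simps [simp]:
  "upr (gp U L) = map snd U" "lwr (gp U L) = map snd L"
  "blocks (gp U L) = cls U L ` (labels (cyc U L))" "points (gp U L) = pts U L"
  by (simp_all only: gp_def upr_def lwr_def blocks_def points_def pts_def fst_conv snd_conv length_map)

abbreviation cpos :: "'a word \<Rightarrow> 'a word \<Rightarrow> pt \<Rightarrow> nat" where
  "cpos U L \<equiv> pos (gp U L)"

lemma finite_pts: "finite (pts U L)"
  by (simp add: pts_def)

lemma pos_less: "x \<in> pts U L \<Longrightarrow> cpos U L x < length (cyc U L)"
  by (auto simp: pts_def)

lemma bij_pos: "bij_betw (cpos U L) (pts U L) {..<length (cyc U L)}"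
proof (rule bij_betw_imageI)
  show "inj_on (cpos U L) (pts U L)"
    by (rule inj_onI) (auto simp: pts_def)
  show "cpos U L ` pts U L = {..<length (cyc U L)}"
  proof (intro equalityI subsetI)
    fix i assume i: "i \<in> {..<length (cyc U L)}"
    show "i \<in> cpos U L ` pts U L"
    proof (cases "i < length L")
      case True
      then have "Lo i \<in> pts U L" "cpos U L (Lo i) = i" by (auto simp: pts_def)
      then show ?thesis by (metis imageI)
    next
      case False
      let ?k = "length U - 1 - (i - length L)"
      have "Up ?k \<in> pts U L" "cpos U L (Up ?k) = i"
        using False i by (auto simp: pts_def)
      then show ?thesis by (metis imageI)
    qed
  qed (use pos_less in auto)
qed

lemma pos_inj: "x \<in> pts U L \<Longrightarrow> y \<in> pts U L \<Longrightarrow> cpos U L x = cpos U L y \<longleftrightarrow> x = y"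
  using bij_pos[of U L] by (meson bij_betw_imp_inj_on inj_on_eq_iff)

lemma pos_surj:
  assumes "i < length (cyc U L)"
  obtains x where "x \<in> pts U L" "cpos U L x = i"
proof -
  have "i \<in> cpos U L ` pts U L"
    using assms bij_betw_imp_surj_on[OF bij_pos[of U L]] by simp
  then show thesis using that by blast
qed

lemma nth_pos:
  assumes "x \<in> pts U L"
  shows "(cyc U L) ! cpos U L x = (labp U L x, ncol (gp U L) x)"
proof (cases x)
  case (Up i)
  then have i: "i < length U" using assms by (auto simp: pts_def)
  have "cpos U L x = length L + (length U - Suc i)"
    using Up by simp
  then have "(cyc U L) ! cpos U L x = mirror U ! (length U - Suc i)"
    by (simp only: nth_append_length_plus)
  also have "\<dots> = apsnd opp (U ! i)"
    using i by (simp add: mirror_def rev_nth)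
  finally show ?thesis using Up i by (simp add: apsnd_def map_prod_def split_beta)
next
  case (Lo j)
  then have "j < length L" using assms by (auto simp: pts_def)
  then show ?thesis using Lo by (simp add: nth_append)
qed

lemma labp_in: "x \<in> pts U L \<Longrightarrow> labp U L x \<in> labels (cyc U L)"
  using nth_pos[of x U L] pos_less[of x U L] nth_mem[of "cpos U L x" "L @ mirror U"]
  by (metis fst_conv imageI)

lemma card_pts:
  "card {x \<in> pts U L. Q (labp U L x) (ncol (gp U L) x)}
    = length (filter (\<lambda>x. Q (fst x) (snd x)) (cyc U L))"
proof -
  let ?z = "L @ mirror U"
  have "bij_betw (cpos U L) {x \<in> pts U L. Q (labp U L x) (ncol (gp U L) x)}
     {i. i < length ?z \<and> Q (fst (?z ! i)) (snd (?z ! i))}"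
  proof (rule bij_betw_imageI)
    show "inj_on (cpos U L) {x \<in> pts U L. Q (labp U L x) (ncol (gp U L) x)}"
      by (rule inj_onI) (simp add: pos_inj)
    show "cpos U L ` {x \<in> pts U L. Q (labp U L x) (ncol (gp U L) x)} =
       {i. i < length ?z \<and> Q (fst (?z ! i)) (snd (?z ! i))}"
    proof (intro equalityI subsetI)
      fix i assume "i \<in> {i. i < length ?z \<and> Q (fst (?z ! i)) (snd (?z ! i))}"
      then have i: "i < length ?z" "Q (fst (?z ! i)) (snd (?z ! i))" by blast+
      from i(1) obtain x where x: "x \<in> pts U L" "cpos U L x = i" by (rule pos_surj)
      then show "i \<in> cpos U L ` {x \<in> pts U L. Q (labp U L x) (ncol (gp U L) x)}"
        using i(2) nth_pos[OF x(1)] by auto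
    next
      fix i assume "i \<in> cpos U L ` {x \<in> pts U L. Q (labp U L x) (ncol (gp U L) x)}"
      then obtain x where x: "x \<in> pts U L" "i = cpos U L x"
         "Q (labp U L x) (ncol (gp U L) x)" by blast
      then show "i \<in> {i. i < length ?z \<and> Q (fst (?z ! i)) (snd (?z ! i))}"
        using nth_pos[OF x(1)] pos_less[OF x(1)] by simp
    qed
  qed
  then show ?thesis by (simp only: bij_betw_same_card length_filter_conv_card)
qed

lemma card_cls: "card (cls U L a) = occ (cyc U L) a"
proof -
  have "card (cls U L a) = length (filter (\<lambda>x. fst x = a) (cyc U L))"
    using card_pts[of U L "\<lambda>b c. b = a"] by (simp only: cls_def)
  also have "length (filter (\<lambda>x. fst x = a) z) = occ z a" for z
    by (induction z) auto
  finally show ?thesis .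
qed

lemma card_cls_col: "card {x \<in> cls U L a. ncol (gp U L) x = c} = cnt (cyc U L) a c"
proof -
  have "card {x \<in> cls U L a. ncol (gp U L) x = c} =
      length (filter (\<lambda>x. fst x = a \<and> snd x = c) (cyc U L))"
    using card_pts[of U L "\<lambda>b d. b = a \<and> d = c"] by (simp only: cls_def mem_Collect_eq conj_assoc)
  also have "length (filter (\<lambda>x. fst x = a \<and> snd x = c) z) = cnt z a c" for z
    by (induction z) auto
  finally show ?thesis .
qed

lemma cls_pair:
  assumes "gauss (cyc U L)" "a \<in> labels (cyc U L)"
  obtains u v where "cls U L a = {u, v}" "u \<noteq> v" "ncol (gp U L) u = Wh" "ncol (gp U L) v = Bl"
    "u \<in> pts U L" "v \<in> pts U L"
proof -
  have "cnt (cyc U L) a Wh = 1" "cnt (cyc U L) a Bl = 1"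
    using gaussD(1)[OF assms(1), of a] gauss_occ[OF assms] unfolding occ_cnt by linarith+
  then have c: "card {x \<in> cls U L a. ncol (gp U L) x = Wh} = 1"
    "card {x \<in> cls U L a. ncol (gp U L) x = Bl} = 1"
    unfolding card_cls_col .
  from c(1) obtain u where u: "{x \<in> cls U L a. ncol (gp U L) x = Wh} = {u}"
    by (rule card_1_singletonE)
  from c(2) obtain v where v: "{x \<in> cls U L a. ncol (gp U L) x = Bl} = {v}"
    by (rule card_1_singletonE)
  note uv = u v
  have "cls U L a = {x \<in> cls U L a. ncol (gp U L) x = Wh} \<union> {x \<in> cls U L a. ncol (gp U L) x = Bl}"
  proof -
    have "ncol (gp U L) x = Wh \<or> ncol (gp U L) x = Bl" for x by (metis col.exhaust)
    then show ?thesis by blast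
  qed
  then have "cls U L a = {u, v}" unfolding uv by blast
  moreover have "ncol (gp U L) u = Wh" "ncol (gp U L) v = Bl" using uv by blast+
  moreover have "u \<in> pts U L" "v \<in> pts U L" using \<open>cls U L a = {u, v}\<close> by (auto simp: cls_def)
  moreover have "u \<noteq> v" using \<open>ncol (gp U L) u = Wh\<close> \<open>ncol (gp U L) v = Bl\<close>
    by (metis col.distinct(1))
  ultimately show thesis by (intro that[of u v])
qed

lemma gp_P2nb:
  assumes "gauss (cyc U L)"
  shows "gp U L \<in> P2nb"
proof -
  let ?A = "labels (cyc U L)"
  have 1: "cls U L a \<noteq> {}" if "a \<in> ?A" for a
    using cls_pair[OF assms that] by blast
  have 2: "cls U L a \<inter> cls U L b = {}" if "a \<noteq> b" for a b
    using that by (auto simp: cls_def)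
  have 3: "\<Union> (cls U L ` ?A) = pts U L"
    using labp_in[of _ U L] by (auto simp: cls_def simp del: set_append)
  have "is_part (gp U L)"
    unfolding is_part_def gp_simps
  proof (intro conjI ballI impI)
    fix B B' assume "B \<in> cls U L ` ?A" "B' \<in> cls U L ` ?A" "B \<noteq> B'"
    then show "B \<inter> B' = {}" using 2 by (elim imageE) metis
  next
    fix B assume "B \<in> cls U L ` ?A"
    then obtain a where "B = cls U L a" "a \<in> ?A" by (rule imageE)
    then show "B \<noteq> {}" using 1 by simp
  qed (rule 3)
  moreover have "card (cls U L a) = 2" if "a \<in> ?A" for a
    unfolding card_cls using gauss_occ[OF assms that] .
  moreover have "\<exists>u v. cls U L a = {u, v} \<and> ncol (gp U L) u \<noteq> ncol (gp U L) v" if "a \<in> ?A" for a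
  proof -
    from cls_pair[OF assms that] obtain u v where "cls U L a = {u, v}"
      "ncol (gp U L) u = Wh" "ncol (gp U L) v = Bl" .
    then show ?thesis by (intro exI[of _ u] exI[of _ v]) simp
  qed
  ultimately show ?thesis
    by (simp add: P2nb_def pair_part_def ball_simps del: set_append)
qed

text \<open>The finitely many blocks are numbered and every point is labelled by the number of its
  block. Hence \<open>nat\<close> words suffice as representatives.\<close>

lemma P2nb_gp:
  assumes p: "p \<in> P2nb"
  obtains U L :: "nat word" where "p = gp U L" "gauss (cyc U L)"
proof -
  from p have part: "is_part p" and two: "\<And>B. B \<in> blocks p \<Longrightarrow> card B = 2"
    and nb: "\<And>B. B \<in> blocks p \<Longrightarrow> \<exists>a b. B = {a, b} \<and> ncol p a \<noteq> ncol p b"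
    unfolding P2nb_def pair_part_def by blast+
  have un: "\<Union>(blocks p) = points p" and dj: "\<And>B B'. B \<in> blocks p \<Longrightarrow> B' \<in> blocks p \<Longrightarrow> B \<noteq> B' \<Longrightarrow> B \<inter> B' = {}"
    using part unfolding is_part_def by blast+
  have fin: "finite (blocks p)"
    by (rule finite_UnionD) (simp add: un points_def)
  obtain f :: "pt set \<Rightarrow> nat" where f: "inj_on f (blocks p)"
    using finite_imp_inj_to_nat_seg[OF fin] by blast
  define blk where "blk x = (THE B. B \<in> blocks p \<and> x \<in> B)" for x
  have blk: "blk x = B" if "B \<in> blocks p" "x \<in> B" for x B
    unfolding blk_def using that dj by (intro the_equality) blast+
  define U where "U = map (\<lambda>i. (f (blk (Up i)), upr p ! i)) [0..<length (upr p)]"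
  define L where "L = map (\<lambda>i. (f (blk (Lo i)), lwr p ! i)) [0..<length (lwr p)]"
  have UL: "map snd U = upr p" "map snd L = lwr p"
    by (simp_all add: U_def L_def o_def map_nth)
  have len: "length U = length (upr p)" "length L = length (lwr p)" by (simp_all add: U_def L_def)
  have pts: "pts U L = points p" by (simp add: pts_def points_def len)
  have lab: "labp U L x = f (blk x)" if "x \<in> pts U L" for x
    using that by (auto simp: pts_def U_def L_def)
  have nc: "ncol (gp U L) x = ncol p x" for x by (cases x) (simp_all add: UL)
  have cls: "cls U L (f B) = B" if B: "B \<in> blocks p" for B
  proof (intro equalityI subsetI)
    fix x assume "x \<in> cls U L (f B)"
    then have x: "x \<in> points p" "f (blk x) = f B" using lab pts by (auto simp: cls_def)
    from x(1) un obtain B' where B': "B' \<in> blocks p" "x \<in> B'" by blast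
    then have "B' = B" using x(2) blk[OF B'] f B by (auto dest: inj_onD)
    then show "x \<in> B" using B' by simp
  next
    fix x assume "x \<in> B"
    then show "x \<in> cls U L (f B)" using B un lab[of x] blk[OF B] pts by (auto simp: cls_def)
  qed
  have labs: "labels (cyc U L) = f ` blocks p"
  proof (intro equalityI subsetI)
    fix a assume a: "a \<in> labels (cyc U L)"
    then have "occ (cyc U L) a \<noteq> 0" unfolding occ_0_iff by simp
    then have "cls U L a \<noteq> {}" unfolding card_cls[symmetric] by auto
    then obtain x where x: "x \<in> points p" "a = f (blk x)" using lab pts by (auto simp: cls_def)
    with un obtain B where "B \<in> blocks p" "x \<in> B" by blast
    then show "a \<in> f ` blocks p" using x blk by blast
  next
    fix a assume "a \<in> f ` blocks p"
    then obtain B where B: "B \<in> blocks p" "a = f B" by blast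
    then have "card (cls U L a) = 2" using cls two by simp
    then show "a \<in> labels (cyc U L)" unfolding card_cls using occ_0_iff
      by (metis zero_neq_numeral)
  qed
  have "gp U L = p"
  proof -
    have "cls U L ` f ` blocks p = blocks p" using cls by force
    then show ?thesis
      unfolding gp_def labs UL by (simp add: upr_def lwr_def blocks_def)
  qed
  moreover have "gauss (cyc U L)"
  proof -
    have "cnt (cyc U L) a c = 1" if a: "a \<in> f ` blocks p" for a c
    proof -
      obtain B where B: "B \<in> blocks p" "a = f B" using a by blast
      obtain x y where xy: "B = {x, y}" "ncol p x \<noteq> ncol p y" using nb[OF B(1)] by blast
      have "{e \<in> B. ncol p e = c} = {x} \<or> {e \<in> B. ncol p e = c} = {y}"
        using xy by (cases c; cases "ncol p x"; cases "ncol p y") auto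
      then have "card {e \<in> B. ncol p e = c} = 1" by auto
      then show ?thesis unfolding card_cls_col[symmetric] B(2) cls[OF B(1)] nc .
    qed
    moreover have "cnt (cyc U L) a c = 0" if "a \<notin> f ` blocks p" for a c
      using that cnt_notin labs by metis
    ultimately show ?thesis
      unfolding gauss_def by (metis le_numeral_extra(4) zero_le)
  qed
  ultimately show thesis using that by blast
qed

section \<open>Heights, levels and color sums\<close>

fun sg :: "col \<Rightarrow> int" where "sg Wh = 1" | "sg Bl = - 1"

definition ht :: "'a word \<Rightarrow> nat \<Rightarrow> int" where
  "ht z i = (\<Sum>k<i. sg (snd (z ! k)))"

text \<open>The lower of the two heights joined by the \<open>i\<close>-th step.\<close>

definition lev :: "'a word \<Rightarrow> nat \<Rightarrow> int" where
  "lev z i = (if snd (z ! i) = Wh then ht z i else ht z i - 1)"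

lemma ht_Suc: "ht z (Suc i) = ht z i + sg (snd (z ! i))"
  by (simp add: ht_def)

lemma ht_Cons: "ht (x # z) (Suc i) = sg (snd x) + ht z i"
  unfolding ht_def by (subst sum.lessThan_Suc_shift) simp

lemma ht_0 [simp]: "ht z 0 = 0"
  by (simp add: ht_def)

lemma lev_Cons: "lev (x # z) (Suc i) = sg (snd x) + lev z i"
  by (simp add: lev_def ht_Cons)

lemma lev_0: "lev (x # z) 0 = (if snd x = Wh then 0 else - 1)"
  by (simp add: lev_def)

lemma path_lev:
  "path lv k z l \<longleftrightarrow> l = k + ht z (length z) \<and> (\<forall>i<length z. lv (fst (z ! i)) = k + lev z i)"
proof (induction z arbitrary: k)
  case (Cons x z)
  obtain a c where x: "x = (a, c)" by (cases x)
  have *: "(\<forall>i<length (x # z). lv (fst ((x # z) ! i)) = k + lev (x # z) i) \<longleftrightarrow>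
      lv a = k + (if c = Wh then 0 else - 1) \<and>
      (\<forall>i<length z. lv (fst (z ! i)) = k + sg c + lev z i)"
    unfolding length_Cons All_less_Suc2 by (simp add: lev_Cons lev_0 x add.assoc)
  show ?case
    unfolding * by (cases c) (auto simp: x Cons.IH ht_Cons)
qed auto

lemma ht_cnt: "gauss z \<Longrightarrow> ht z (length z) = 0"
proof -
  assume g: "gauss z"
  have 1: "ht z (length z) = (\<Sum>a\<in>labels z. int (cnt z a Wh) - int (cnt z a Bl))"
  proof -
    \<comment> \<open>Summing over a fixed superset \<open>S\<close> of the labels keeps the index
      set unchanged while the word grows.\<close>
    have "finite S \<Longrightarrow> labels z \<subseteq> S \<Longrightarrow>
        ht z (length z) = (\<Sum>a\<in>S. int (cnt z a Wh) - int (cnt z a Bl))" for S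
    proof (induction z)
      case (Cons x z)
      have "(\<Sum>a\<in>S. int (cnt (x # z) a Wh) - int (cnt (x # z) a Bl)) =
         (\<Sum>a\<in>S. (if a = fst x then sg (snd x) else 0) + (int (cnt z a Wh) - int (cnt z a Bl)))"
        by (rule sum.cong) (cases "snd x"; auto)+
      also have "\<dots> = sg (snd x) + (\<Sum>a\<in>S. int (cnt z a Wh) - int (cnt z a Bl))"
        unfolding sum.distrib using Cons.prems by (subst sum.delta) auto
      finally show ?case using Cons by (simp add: ht_Cons)
    qed (simp add: ht_def)
    then show ?thesis by simp
  qed
  show ?thesis unfolding 1 using gaussD(1)[OF g] by simp
qed

lemma sigma_gp:
  assumes "S \<subseteq> pts U L"
  shows "sigma (gp U L) S = (\<Sum>i\<in>cpos U L ` S. sg (snd ((cyc U L) ! i)))"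
proof -
  have fin: "finite S" using assms finite_pts finite_subset by blast
  have inj: "inj_on (cpos U L) S"
    by (rule inj_on_subset[OF bij_betw_imp_inj_on[OF bij_pos] assms])
  have "(\<Sum>i\<in>cpos U L ` S. sg (snd ((cyc U L) ! i))) = (\<Sum>x\<in>S. sg (ncol (gp U L) x))"
    unfolding sum.reindex[OF inj] using assms nth_pos[of _ U L] by (intro sum.cong) auto
  also have "\<dots> = (\<Sum>x\<in>S. (if ncol (gp U L) x = Wh then 1 else 0) - (if ncol (gp U L) x = Bl then 1 else 0))"
  proof (rule sum.cong)
    fix x show "sg (ncol (gp U L) x) =
      (if ncol (gp U L) x = Wh then 1 else 0) - (if ncol (gp U L) x = Bl then 1 else 0)"
      by (cases "ncol (gp U L) x") simp_all
  qed simp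
  also have "\<dots> = sigma (gp U L) S"
    unfolding sigma_def sum_subtractf using fin
    by (simp add: sum.If_cases Int_def)
  finally show ?thesis by simp
qed

lemma ht_diff: "i \<le> j \<Longrightarrow> (\<Sum>k\<in>{i..<j}. sg (snd (z ! k))) = ht z j - ht z i"
  unfolding ht_def lessThan_atLeast0
  using sum.atLeastLessThan_concat[of 0 i j "\<lambda>k. sg (snd (z ! k))"] by simp

lemma pos_open_int:
  "cpos U L ` open_int (gp U L) x y
    = {i. i < length (cyc U L) \<and> cyc_btw (cpos U L x) i (cpos U L y)}"
proof (intro equalityI subsetI)
  fix i assume "i \<in> cpos U L ` open_int (gp U L) x y"
  then obtain w where "w \<in> pts U L" "i = cpos U L w" "cyc_btw (cpos U L x) i (cpos U L y)"
    unfolding open_int_def gp_simps by blast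
  then show "i \<in> {i. i < length (cyc U L) \<and> cyc_btw (cpos U L x) i (cpos U L y)}"
    using pos_less by blast
next
  fix i assume i: "i \<in> {i. i < length (cyc U L) \<and> cyc_btw (cpos U L x) i (cpos U L y)}"
  then obtain w where "w \<in> pts U L" "cpos U L w = i" using pos_surj[of i L U] by blast
  then show "i \<in> cpos U L ` open_int (gp U L) x y"
    using i unfolding open_int_def gp_simps by blast
qed

text \<open>A color sum over an interval is a difference of heights. This stays true for intervals
  that wrap around, because a Gauss word has total height \<open>0\<close>.\<close>

lemma sigma_open_int:
  assumes g: "gauss (cyc U L)" and x: "x \<in> pts U L" and y: "y \<in> pts U L" and "x \<noteq> y"
  shows "sigma (gp U L) (open_int (gp U L) x y)
    = ht (cyc U L) (cpos U L y) - ht (cyc U L) (Suc (cpos U L x))"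
proof -
  let ?z = "L @ mirror U"
  define n where "n = length ?z"
  define i where "i = cpos U L x"
  define j where "j = cpos U L y"
  have ij: "i \<noteq> j" "i < n" "j < n"
    using pos_inj[OF x y] pos_less[OF x] pos_less[OF y] \<open>x \<noteq> y\<close> unfolding i_def j_def n_def by blast+
  have "sigma (gp U L) (open_int (gp U L) x y) = (\<Sum>k\<in>{k. k < n \<and> cyc_btw i k j}. sg (snd (?z ! k)))"
    by (subst sigma_gp) (simp_all only: pos_open_int i_def j_def n_def, auto simp: open_int_def)
  also have "\<dots> = ht ?z j - ht ?z (Suc i)"
  proof (cases "i < j")
    case True
    then have "{k. k < n \<and> cyc_btw i k j} = {Suc i..<j}" using ij by (auto simp: cyc_btw_def)
    then show ?thesis using True by (simp add: ht_diff del: set_append)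
  next
    case False
    then have "{k. k < n \<and> cyc_btw i k j} = {Suc i..<n} \<union> {0..<j}"
      using ij by (auto simp: cyc_btw_def)
    moreover have "(\<Sum>k\<in>{Suc i..<n} \<union> {0..<j}. sg (snd (?z ! k)))
        = (\<Sum>k\<in>{Suc i..<n}. sg (snd (?z ! k))) + (\<Sum>k\<in>{0..<j}. sg (snd (?z ! k)))"
      using False ij by (intro sum.union_disjoint) auto
    moreover have "ht ?z n = 0" using ht_cnt[OF g] by (simp only: n_def)
    ultimately show ?thesis using ij by (simp only: ht_diff Suc_leI le0 ht_0)
  qed
  finally show ?thesis by (simp only: i_def j_def)
qed

lemma ncol_pos: "x \<in> pts U L \<Longrightarrow> ncol (gp U L) x = snd ((cyc U L) ! cpos U L x)"
  by (simp only: nth_pos snd_conv)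

lemma sigma_0_iff:
  assumes g: "gauss (cyc U L)" and x: "x \<in> pts U L" and y: "y \<in> pts U L"
    and n: "ncol (gp U L) x \<noteq> ncol (gp U L) y"
  shows "sigma (gp U L) (open_int (gp U L) x y) = lev (cyc U L) (cpos U L y) - lev (cyc U L) (cpos U L x)"
proof -
  have "x \<noteq> y" using n by blast
  from sigma_open_int[OF g x y this] show ?thesis
    using n unfolding lev_def ht_Suc ncol_pos[OF x] ncol_pos[OF y]
    by (cases "snd ((cyc U L) ! cpos U L x)"; cases "snd ((cyc U L) ! cpos U L y)")
      simp_all
qed

text \<open>The two cases in the definition of \<open>delta\<close> are just the corrections that
  turn differences of heights into differences of levels: for equal colours the end point
  \<open>y\<close> supplies the missing unit, for different colours the corrections at both ends
  cancel.\<close>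

lemma delta_gp:
  assumes g: "gauss (cyc U L)" and x: "x \<in> pts U L" and y: "y \<in> pts U L" and "x \<noteq> y"
  shows "delta (gp U L) x y = lev (cyc U L) (cpos U L y) - lev (cyc U L) (cpos U L x)"
proof (cases "ncol (gp U L) x = ncol (gp U L) y")
  case False
  then show ?thesis by (simp add: delta_def sigma_0_iff[OF g x y] del: mirror_simps)
next
  case True
  have sub: "open_int (gp U L) x y \<subseteq> pts U L" by (auto simp: open_int_def)
  have fin: "finite (open_int (gp U L) x y)" using sub finite_pts finite_subset by blast
  have nin: "y \<notin> open_int (gp U L) x y"
    using \<open>x \<noteq> y\<close> by (auto simp: open_int_def cyc_btw_def)
  have ho: "half_open (gp U L) x y = insert y (open_int (gp U L) x y)"
    using \<open>x \<noteq> y\<close> by (simp add: half_open_def)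
  have "{w \<in> insert y (open_int (gp U L) x y). ncol (gp U L) w = c} =
     (if ncol (gp U L) y = c then insert y {w \<in> open_int (gp U L) x y. ncol (gp U L) w = c}
      else {w \<in> open_int (gp U L) x y. ncol (gp U L) w = c})" for c by auto
  then have "sigma (gp U L) (half_open (gp U L) x y)
      = sigma (gp U L) (open_int (gp U L) x y) + sg (ncol (gp U L) y)"
    unfolding sigma_def ho using fin nin by (cases "ncol (gp U L) y") simp_all
  then show ?thesis
    using True unfolding delta_def sigma_open_int[OF g x y \<open>x \<noteq> y\<close>] lev_def ht_Suc
      ncol_pos[OF x] ncol_pos[OF y]
    by (cases "snd ((cyc U L) ! cpos U L x)"; cases "snd ((cyc U L) ! cpos U L y)")
      simp_all
qed

text \<open>The points of a block have opposite colours, so a vanishing color sum between them means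
  equal levels. Thus the level is a function of the label, and this is what \<open>path\<close> asks
  for.\<close>

lemma gp_S0:
  assumes g: "gauss (cyc U L)"
  shows "gp U L \<in> S0 \<longleftrightarrow> (\<exists>lv. path lv 0 (cyc U L) 0)"
proof -
  let ?z = "L @ mirror U"
  have "gp U L \<in> S0 \<longleftrightarrow> (\<forall>x\<in>pts U L. \<forall>y\<in>pts U L. labp U L x = labp U L y \<longrightarrow>
      lev ?z (cpos U L x) = lev ?z (cpos U L y))" (is "_ \<longleftrightarrow> ?R")
  proof
    assume S: "gp U L \<in> S0"
    show ?R
    proof (intro ballI impI)
      fix x y assume x: "x \<in> pts U L" and y: "y \<in> pts U L" and xy: "labp U L x = labp U L y"
      obtain u v where uv: "cls U L (labp U L x) = {u, v}" "u \<noteq> v" "ncol (gp U L) u = Wh"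
        "ncol (gp U L) v = Bl" "u \<in> pts U L" "v \<in> pts U L"
        by (rule cls_pair[OF g labp_in[OF x]])
      have "{u, v} \<in> blocks (gp U L)" unfolding gp_simps uv(1)[symmetric]
        by (rule imageI) (rule labp_in[OF x])
      moreover have "\<forall>B\<in>blocks (gp U L). \<forall>a\<in>B. \<forall>b\<in>B. a \<noteq> b \<longrightarrow> sigma (gp U L) (open_int (gp U L) a b) = 0"
        using S by (simp only: S0_def mem_Collect_eq) (elim conjE)
      ultimately have "sigma (gp U L) (open_int (gp U L) u v) = 0"
        using uv(2) by (meson insertI1 insertI2)
      then have "lev ?z (cpos U L u) = lev ?z (cpos U L v)"
        using sigma_0_iff[OF g uv(5,6)] uv(3,4) by simp
      moreover have "x \<in> {u, v}" "y \<in> {u, v}" using x y xy uv(1)[symmetric] by (simp_all add: cls_def)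
      ultimately show "lev ?z (cpos U L x) = lev ?z (cpos U L y)"
        by (elim insertE emptyE) simp_all
    qed
  next
    assume R: ?R
    have sig: "sigma (gp U L) (open_int (gp U L) x y) = 0"
      if a: "a \<in> labels ?z" and xy: "x \<in> cls U L a" "y \<in> cls U L a" "x \<noteq> y" for a x y
    proof -
      from cls_pair[OF g a] obtain u v where uv: "cls U L a = {u, v}" "ncol (gp U L) u = Wh"
        "ncol (gp U L) v = Bl" .
      have "ncol (gp U L) x \<noteq> ncol (gp U L) y"
        using xy uv(2,3) unfolding uv(1) by (elim insertE emptyE) simp_all
      moreover have px: "x \<in> pts U L" and py: "y \<in> pts U L" and l: "labp U L x = labp U L y"
        using xy by (simp_all add: cls_def)
      moreover have "lev ?z (cpos U L x) = lev ?z (cpos U L y)" using R px py l by blast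
      ultimately show ?thesis using sigma_0_iff[OF g px py] by linarith
    qed
    have "\<forall>B\<in>blocks (gp U L). \<forall>x\<in>B. \<forall>y\<in>B. x \<noteq> y \<longrightarrow> sigma (gp U L) (open_int (gp U L) x y) = 0"
      unfolding gp_simps proof (intro ballI impI)
      fix B x y assume B: "B \<in> cls U L ` (labels ?z)" and xy: "x \<in> B" "y \<in> B" "x \<noteq> y"
      from B obtain a where "B = cls U L a" "a \<in> labels ?z" by (rule imageE)
      then show "sigma (gp U L) (open_int (gp U L) x y) = 0"
        using xy sig by blast
    qed
    then show "gp U L \<in> S0"
      using gp_P2nb[OF g] by (simp only: S0_def mem_Collect_eq)
  qed
  also have "\<dots> \<longleftrightarrow> (\<forall>i<length ?z. \<forall>j<length ?z. fst (?z ! i) = fst (?z ! j) \<longrightarrow> lev ?z i = lev ?z j)"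
    (is "_ \<longleftrightarrow> ?Q")
  proof
    assume R: ?R
    show ?Q
    proof (intro allI impI)
      fix i j assume i: "i < length ?z" and j: "j < length ?z" and ij: "fst (?z ! i) = fst (?z ! j)"
      obtain x where x: "x \<in> pts U L" "cpos U L x = i" using i by (rule pos_surj)
      obtain y where y: "y \<in> pts U L" "cpos U L y = j" using j by (rule pos_surj)
      have "labp U L x = labp U L y"
        using ij nth_pos[OF x(1)] nth_pos[OF y(1)] unfolding x(2) y(2) by simp
      then show "lev ?z i = lev ?z j" using R x y by blast
    qed
  next
    assume Q: ?Q
    show ?R
    proof (intro ballI impI)
      fix x y assume x: "x \<in> pts U L" and y: "y \<in> pts U L" and xy: "labp U L x = labp U L y"
      then show "lev ?z (cpos U L x) = lev ?z (cpos U L y)"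
        using Q pos_less[OF x] pos_less[OF y] nth_pos[OF x] nth_pos[OF y] by (metis fst_conv)
    qed
  qed
  also have "\<dots> \<longleftrightarrow> (\<exists>lv. \<forall>i<length ?z. lv (fst (?z ! i)) = lev ?z i)"
  proof
    assume Q: ?Q
    \<comment> \<open>The level is read off at an arbitrary occurrence of the label; by
      \<open>?Q\<close> all occurrences give the same value.\<close>
    define lv where "lv a = lev ?z (SOME i. i < length ?z \<and> fst (?z ! i) = a)" for a
    have "lv (fst (?z ! i)) = lev ?z i" if "i < length ?z" for i
    proof -
      have "\<exists>j. j < length ?z \<and> fst (?z ! j) = fst (?z ! i)" using that by blast
      from someI_ex[OF this] show ?thesis unfolding lv_def using Q that by blast
    qed
    then show "\<exists>lv. \<forall>i<length ?z. lv (fst (?z ! i)) = lev ?z i" by blast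
  next
    assume "\<exists>lv. \<forall>i<length ?z. lv (fst (?z ! i)) = lev ?z i"
    then show ?Q by metis
  qed
  also have "\<dots> \<longleftrightarrow> (\<exists>lv. path lv 0 ?z 0)"
    unfolding path_lev ht_cnt[OF g] by simp
  finally show ?thesis .
qed

section \<open>Crossings and distances read from the word\<close>

lemma restr_nth:
  "restr a b z = map (\<lambda>i. fst (z ! i)) (filter (\<lambda>i. fst (z ! i) = a \<or> fst (z ! i) = b) [0..<length z])"
proof -
  have "map fst z = map (\<lambda>i. fst (z ! i)) [0..<length z]"
    by (rule nth_equalityI) simp_all
  then show ?thesis unfolding restr_def by (simp only: filter_map o_def)
qed

lemma cross_index:
  assumes g: "gauss z" and "a \<noteq> b"
  shows "cross z a b \<longleftrightarrow> (\<exists>i j k l. i < j \<and> j < k \<and> k < l \<and> l < length z \<and>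
    (fst (z ! i) = a \<and> fst (z ! j) = b \<and> fst (z ! k) = a \<and> fst (z ! l) = b \<or>
     fst (z ! i) = b \<and> fst (z ! j) = a \<and> fst (z ! k) = b \<and> fst (z ! l) = a))" (is "_ \<longleftrightarrow> ?R")
proof -
  define q where "q = filter (\<lambda>i. fst (z ! i) = a \<or> fst (z ! i) = b) [0..<length z]"
  have r: "restr a b z = map (\<lambda>i. fst (z ! i)) q" unfolding q_def by (rule restr_nth)
  have sorted: "sorted_wrt (<) q"
    unfolding q_def by (rule sorted_wrt_filter) simp
  have setq: "set q = {i. i < length z \<and> (fst (z ! i) = a \<or> fst (z ! i) = b)}"
    by (auto simp: q_def)
  show ?thesis
  proof
    assume c: "cross z a b"
    then have "length q = 4" using crossD(2)[OF c] unfolding r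
      by (metis length_map length_Cons list.size(3) numeral_2_eq_2 Suc_1 numeral_Bit0 add_2_eq_Suc')
    then have "\<exists>i j k l. q = [i, j, k, l]" by (auto simp: length_Suc_conv eval_nat_numeral)
    then obtain i j k l where q: "q = [i, j, k, l]" by blast
    have "i < j" "j < k" "k < l" using sorted by (simp_all add: q)
    moreover have "l < length z" using setq by (auto simp: q)
    moreover have "fst (z ! i) = a \<and> fst (z ! j) = b \<and> fst (z ! k) = a \<and> fst (z ! l) = b \<or>
     fst (z ! i) = b \<and> fst (z ! j) = a \<and> fst (z ! k) = b \<and> fst (z ! l) = a"
      using crossD(2)[OF c] unfolding r q by simp
    ultimately show ?R by blast
  next
    assume ?R
    then obtain i j k l where o: "i < j" "j < k" "k < l" "l < length z" and
      lab: "fst (z ! i) = a \<and> fst (z ! j) = b \<and> fst (z ! k) = a \<and> fst (z ! l) = b \<or>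
     fst (z ! i) = b \<and> fst (z ! j) = a \<and> fst (z ! k) = b \<and> fst (z ! l) = a" by blast
    \<comment> \<open>\<open>q\<close> lists all positions of \<open>a\<close> and \<open>b\<close>,
      at most four of them. As it contains the four given ones, it is the sorted list of
      these.\<close>
    have sub: "{i, j, k, l} \<subseteq> set q" using o lab unfolding setq by auto
    have card4: "card {i, j, k, l} = 4" using o by simp
    have "distinct q" unfolding q_def by simp
    have "length q = occ z a + occ z b"
      using length_restr[OF \<open>a \<noteq> b\<close>, of z] unfolding r by simp
    then have "length q \<le> 4"
      using gauss_occ_cases[OF g, of a] gauss_occ_cases[OF g, of b] by auto
    then have "card (set q) \<le> 4" using \<open>distinct q\<close> by (simp add: distinct_card)
    then have "set q = {i, j, k, l}"
      using card_seteq[OF finite_set sub] card4 by simp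
    moreover have "sorted_wrt (<) [i, j, k, l]" using o by simp
    moreover have "set q = set [i, j, k, l]" using calculation(1) by simp
    ultimately have "q = [i, j, k, l]"
      using sorted strict_sorted_equal by blast
    then show "cross z a b" using lab \<open>a \<noteq> b\<close> unfolding cross_def r by auto
  qed
qed

lemma crosses_gp:
  assumes g: "gauss (cyc U L)" and a: "a \<in> labels (cyc U L)"
    and b: "b \<in> labels (cyc U L)"
  shows "crosses (gp U L) (cls U L a) (cls U L b) \<longleftrightarrow> cross (cyc U L) a b"
proof (cases "a = b")
  case True
  then show ?thesis by (simp add: crosses_def cross_def)
next
  case False
  let ?z = "L @ mirror U"
  let ?p = "cpos U L"
  have ne: "cls U L a \<noteq> cls U L b"
    using cls_pair[OF g a] False unfolding cls_def by (metis (mono_tags, lifting) insertI1 mem_Collect_eq)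
  have lab: "fst (?z ! ?p x) = e \<and> ?p x < length ?z" if "x \<in> cls U L e" for x e
    using that nth_pos[of x U L] pos_less[of x U L] by (simp add: cls_def)
  have pt: "\<exists>x. x \<in> cls U L e \<and> ?p x = i" if e: "fst (?z ! i) = e" and i: "i < length ?z" for i e
  proof -
    obtain x where x: "x \<in> pts U L" "?p x = i" using i by (rule pos_surj)
    then have "labp U L x = e" using nth_pos[OF x(1)] e by simp
    then show ?thesis using x by (auto simp: cls_def)
  qed
  have oi: "w \<in> open_int (gp U L) x y \<longleftrightarrow> cyc_btw (?p x) (?p w) (?p y)" if "w \<in> cls U L e" for w x y e
    using that by (simp add: open_int_def cls_def)
  have inj: "x = y" if "x \<in> cls U L e" "y \<in> cls U L e" "?p x = ?p y" for x y e
    using that pos_inj[of x U L y] by (simp add: cls_def)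
  show ?thesis
  proof
    assume "crosses (gp U L) (cls U L a) (cls U L b)"
    then obtain x y u v where xy: "x \<in> cls U L a" "y \<in> cls U L a" "u \<in> cls U L b" "v \<in> cls U L b"
      "x \<noteq> y" "cyc_btw (?p x) (?p u) (?p y)" "cyc_btw (?p y) (?p v) (?p x)"
      unfolding crosses_def using oi by blast
    define i j k l where d: "i = ?p x" "j = ?p y" "k = ?p u" "l = ?p v"
    have "i \<noteq> j" using inj xy d by blast
    have L: "fst (?z ! i) = a" "fst (?z ! j) = a" "fst (?z ! k) = b" "fst (?z ! l) = b"
      "i < length ?z" "j < length ?z" "k < length ?z" "l < length ?z"
      using lab[OF xy(1)] lab[OF xy(2)] lab[OF xy(3)] lab[OF xy(4)] unfolding d by blast+
    have c: "cyc_btw i k j" "cyc_btw j l i" using xy(6,7) unfolding d .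
    \<comment> \<open>The cyclic order \<open>i, k, j, l\<close> may be cut open at each of its four
      places.\<close>
    consider "i < k" "k < j" "j < l" | "l < i" "i < k" "k < j" | "j < l" "l < i" "i < k" | "k < j" "j < l" "l < i"
      using c \<open>i \<noteq> j\<close> by (cases "i < j") (auto simp: cyc_btw_def)
    then show "cross ?z a b"
      unfolding cross_index[OF g False] using L by cases metis+
  next
    assume "cross ?z a b"
    then obtain i j k l where o: "i < j" "j < k" "k < l" "l < length ?z" and
      lb: "fst (?z ! i) = a \<and> fst (?z ! j) = b \<and> fst (?z ! k) = a \<and> fst (?z ! l) = b \<or>
     fst (?z ! i) = b \<and> fst (?z ! j) = a \<and> fst (?z ! k) = b \<and> fst (?z ! l) = a"
      unfolding cross_index[OF g False] by blast
    have o': "i < length ?z" "j < length ?z" "k < length ?z" using o by linarith+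
    \<comment> \<open>The alternation is rotated to begin with \<open>a\<close>; then the last
      position \<open>l'\<close> is the one that may lie before the others.\<close>
    obtain i' j' k' l' where i': "i' < length ?z" "fst (?z ! i') = a"
      and j': "j' < length ?z" "fst (?z ! j') = b" and k': "k' < length ?z" "fst (?z ! k') = a"
      and l': "l' < length ?z" "fst (?z ! l') = b"
      and ord: "i' < j' \<and> j' < k' \<and> k' < l' \<or> l' < i' \<and> i' < j' \<and> j' < k'"
      using lb
    proof (elim disjE conjE)
      assume "fst (?z ! i) = a" "fst (?z ! j) = b" "fst (?z ! k) = a" "fst (?z ! l) = b"
      then show thesis using that[of i j k l] o o' by blast
    next
      assume "fst (?z ! i) = b" "fst (?z ! j) = a" "fst (?z ! k) = b" "fst (?z ! l) = a"
      then show thesis using that[of j k l i] o o' by blast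
    qed
    obtain x where x: "x \<in> cls U L a" "?p x = i'" using pt[OF i'(2,1)] by blast
    obtain u where u: "u \<in> cls U L b" "?p u = j'" using pt[OF j'(2,1)] by blast
    obtain y where y: "y \<in> cls U L a" "?p y = k'" using pt[OF k'(2,1)] by blast
    obtain v where v: "v \<in> cls U L b" "?p v = l'" using pt[OF l'(2,1)] by blast
    have "i' \<noteq> k'" using ord by linarith
    then have "x \<noteq> y" using x(2) y(2) by blast
    moreover have "cyc_btw i' j' k'" "cyc_btw k' l' i'"
      using ord by (auto simp: cyc_btw_def)
    then have "u \<in> open_int (gp U L) x y" "v \<in> open_int (gp U L) y x"
      unfolding oi[OF u(1)] oi[OF v(1)] x(2) y(2) u(2) v(2) .
    ultimately show "crosses (gp U L) (cls U L a) (cls U L b)"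
      unfolding crosses_def using ne x(1) y(1) u(1) v(1) by blast
  qed
qed

lemma dist_gp:
  assumes g: "gauss (cyc U L)" and p: "path lv k (cyc U L) k"
    and a: "a \<in> labels (cyc U L)" and b: "b \<in> labels (cyc U L)" and "a \<noteq> b"
  shows "dist_bl (gp U L) (cls U L a) (cls U L b) = nat \<bar>lv a - lv b\<bar>"
proof -
  define x where "x = (SOME x. x \<in> cls U L a)"
  define y where "y = (SOME x. x \<in> cls U L b)"
  have "card (cls U L a) = 2" "card (cls U L b) = 2"
    unfolding card_cls using gauss_occ[OF g a] gauss_occ[OF g b] .
  then have "cls U L a \<noteq> {}" "cls U L b \<noteq> {}" by auto
  then have "x \<in> cls U L a" "y \<in> cls U L b" unfolding x_def y_def by (simp_all add: some_in_eq)
  then have x: "x \<in> pts U L" "labp U L x = a" and y: "y \<in> pts U L" "labp U L y = b"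
    by (simp_all add: cls_def)
  have "lv a = k + lev (cyc U L) (cpos U L x)"
    using p[unfolded path_lev] pos_less[OF x(1)] nth_pos[OF x(1)] x(2) by (metis fst_conv)
  moreover have "lv b = k + lev (cyc U L) (cpos U L y)"
    using p[unfolded path_lev] pos_less[OF y(1)] nth_pos[OF y(1)] y(2) by (metis fst_conv)
  moreover have "x \<noteq> y" using x y \<open>a \<noteq> b\<close> by blast
  ultimately show ?thesis
    unfolding dist_bl_def x_def[symmetric] y_def[symmetric] delta_gp[OF g x(1) y(1) \<open>x \<noteq> y\<close>]
    by (simp add: abs_minus_commute)
qed

text \<open>The dictionary between partitions and words: from here on membership in
  \<open>I_D D\<close> is a statement about the cyclic word alone.\<close>

lemma gp_I_D:
  assumes g: "gauss (cyc U L)"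
  shows "gp U L \<in> I_D D \<longleftrightarrow> legal D (cyc U L)"
proof -
  let ?z = "L @ mirror U"
  have okay: "(\<forall>B\<in>blocks (gp U L). \<forall>B'\<in>blocks (gp U L).
      crosses (gp U L) B B' \<longrightarrow> dist_bl (gp U L) B B' \<notin> D) \<longleftrightarrow> okay D lv ?z"
    if p: "path lv k ?z k" for lv k
  proof -
    have "(\<forall>B\<in>blocks (gp U L). \<forall>B'\<in>blocks (gp U L).
        crosses (gp U L) B B' \<longrightarrow> dist_bl (gp U L) B B' \<notin> D) \<longleftrightarrow>
      (\<forall>a\<in>labels ?z. \<forall>b\<in>labels ?z. cross ?z a b \<longrightarrow> nat \<bar>lv a - lv b\<bar> \<notin> D)"
      unfolding gp_simps
    proof (intro iffI ballI impI)
      fix a b assume *: "\<forall>B\<in>cls U L ` (labels ?z). \<forall>B'\<in>cls U L ` (labels ?z).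
          crosses (gp U L) B B' \<longrightarrow> dist_bl (gp U L) B B' \<notin> D"
        and ab: "a \<in> labels ?z" "b \<in> labels ?z" and c: "cross ?z a b"
      have "dist_bl (gp U L) (cls U L a) (cls U L b) \<notin> D"
        using *[rule_format, OF imageI[OF ab(1)] imageI[OF ab(2)]] crosses_gp[OF g ab] c by blast
      then show "nat \<bar>lv a - lv b\<bar> \<notin> D" using dist_gp[OF g p ab crossD(1)[OF c]] by simp
    next
      fix B B' assume *: "\<forall>a\<in>labels ?z. \<forall>b\<in>labels ?z. cross ?z a b \<longrightarrow> nat \<bar>lv a - lv b\<bar> \<notin> D"
        and B: "B \<in> cls U L ` (labels ?z)" and B': "B' \<in> cls U L ` (labels ?z)"
        and c: "crosses (gp U L) B B'"
      from B obtain a where a: "B = cls U L a" "a \<in> labels ?z" by (rule imageE)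
      from B' obtain b where b: "B' = cls U L b" "b \<in> labels ?z" by (rule imageE)
      have c': "cross ?z a b" using c crosses_gp[OF g a(2) b(2)] unfolding a b by blast
      then have "nat \<bar>lv a - lv b\<bar> \<notin> D" using * a(2) b(2) by blast
      then show "dist_bl (gp U L) B B' \<notin> D"
        using dist_gp[OF g p a(2) b(2) crossD(1)[OF c']] unfolding a b by simp
    qed
    also have "\<dots> \<longleftrightarrow> okay D lv ?z" unfolding okay_def using cross_in[of ?z] by blast
    finally show ?thesis .
  qed
  show ?thesis
  proof
    assume I: "gp U L \<in> I_D D"
    then have "gp U L \<in> S0" by (simp add: I_D_def)
    then obtain lv where lv: "path lv 0 ?z 0" using gp_S0[OF g] by blast
    then show "legal D ?z" using okay[OF lv] I g unfolding I_D_def legal_def by blast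
  next
    assume l: "legal D ?z"
    then obtain lv k where lv: "path lv k ?z k" "okay D lv ?z" unfolding legal_def by blast
    \<comment> \<open>\<open>gp_S0\<close> starts at height \<open>0\<close>, \<open>legal\<close>
      at an arbitrary height.\<close>
    have "path (\<lambda>a. lv a + (- k)) (k + (- k)) ?z (k + (- k))" using lv(1) path_shift by blast
    then have "path (\<lambda>a. lv a + (- k)) 0 ?z 0" by simp
    then have "gp U L \<in> S0" using gp_S0[OF g] by blast
    then show "gp U L \<in> I_D D" using okay[OF lv(1)] lv(2) unfolding I_D_def by blast
  qed
qed

subsection \<open>Operations on labelled partitions\<close>

lemma labp_image: "labp U L ` pts U L = labels (cyc U L)"
proof (intro equalityI subsetI)
  fix a assume "a \<in> labels (cyc U L)"
  then have "occ (cyc U L) a \<noteq> 0" unfolding occ_0_iff by simp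
  then have "cls U L a \<noteq> {}" unfolding card_cls[symmetric] by auto
  then show "a \<in> labp U L ` pts U L" by (auto simp: cls_def)
qed (use labp_in in blast)

text \<open>A set closed under passing to the other point of a block meets the points in whole
  blocks, which have two elements each. The map \<open>e\<close> embeds the points into the stacked
  picture of a composition.\<close>

lemma even_closed:
  assumes g: "gauss (cyc U L)" and e: "inj e"
    and cl: "\<And>x y. x \<in> pts U L \<Longrightarrow> y \<in> pts U L \<Longrightarrow> labp U L x = labp U L y \<Longrightarrow> e x \<in> X \<Longrightarrow> e y \<in> X"
  shows "even (card (X \<inter> e ` pts U L))"
proof -
  define P where "P = {x \<in> pts U L. e x \<in> X}"
  have "X \<inter> e ` pts U L = e ` P" by (auto simp: P_def)
  then have c: "card (X \<inter> e ` pts U L) = card P" using e by (simp add: card_image inj_on_def inj_def)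
  have P: "P = (\<Union>a\<in>labp U L ` P. cls U L a)"
  proof (intro equalityI subsetI)
    fix x assume "x \<in> (\<Union>a\<in>labp U L ` P. cls U L a)"
    then obtain y where "y \<in> P" "x \<in> cls U L (labp U L y)" by blast
    then show "x \<in> P" using cl[of y x] unfolding P_def cls_def by simp
  qed (auto simp: P_def cls_def)
  have fin: "finite (cls U L a)" for a
    using finite_pts[of U L] by (simp add: cls_def)
  have "finite P" using finite_pts[of U L] by (simp add: P_def)
  then have "card (\<Union>a\<in>labp U L ` P. cls U L a) = (\<Sum>a\<in>labp U L ` P. card (cls U L a))"
    using fin by (intro card_UN_disjoint) (auto simp: cls_def)
  also have "even (\<Sum>a\<in>labp U L ` P. card (cls U L a))"
    using gauss_occ_cases[OF g] by (intro dvd_sum) (metis card_cls dvd_0_right dvd_refl)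
  finally show ?thesis unfolding c P[symmetric] .
qed

lemma lmap_nth: "i < length z \<Longrightarrow> lmap f z ! i = (f (fst (z ! i)), snd (z ! i))"
  by (simp add: lmap_def apfst_def map_prod_def split_beta)

lemma lmap_snd: "lmap f y = lmap g z \<Longrightarrow> map snd y = map snd z"
  by (metis lmap_simps(7))

lemma inj_embs: "inj top_emb" "inj bot_emb"
proof -
  show "inj top_emb"
  proof (rule injI)
    fix x y assume "top_emb x = top_emb y" then show "x = y" by (cases x; cases y) simp_all
  qed
  show "inj bot_emb"
  proof (rule injI)
    fix x y assume "bot_emb x = bot_emb y" then show "x = y" by (cases x; cases y) simp_all
  qed
qed

text \<open>Every connected component meets the two outer rows in an even number of points, since
  the points of either factor lying in it come in blocks of size two.  So a component of an outer
  point fills the class of outer points with its label as soon as that class has two elements.\<close>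

lemma comp_gp:
  assumes g1: "gauss (M1 @ mirror U)" and g2: "gauss (L @ mirror M2)"
    and lab: "lmap f1 M1 = lmap f2 M2" and g: "gauss (lmap f2 L @ mirror (lmap f1 U))"
  shows "comp (gp M2 L) (gp U M1) = gp (lmap f1 U) (lmap f2 L)"
proof -
  let ?p = "gp M2 L" and ?q = "gp U M1" and ?U = "lmap f1 U" and ?L = "lmap f2 L"
  \<comment> \<open>The final label of a point in the stacked picture. On the middle row both
    renamings give the same value by \<open>lab\<close>, so links preserve it.\<close>
  define val where "val x = (case x of T i \<Rightarrow> f1 (fst (U ! i)) | M i \<Rightarrow> f1 (fst (M1 ! i)) | Bo i \<Rightarrow> f2 (fst (L ! i)))" for x
  have len: "length M1 = length M2" using lab by (metis lmap_simps(5))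
  have val_top: "val (top_emb x) = f1 (labp U M1 x)" for x
    by (cases x) (simp_all add: val_def)
  have val_bot: "val (bot_emb x) = f2 (labp M2 L x)" if "x \<in> pts M2 L" for x
  proof (cases x)
    case (Up i)
    then have i: "i < length M2" using that by (auto simp: pts_def)
    have "lmap f1 M1 ! i = lmap f2 M2 ! i" using lab by simp
    then have "f1 (fst (M1 ! i)) = f2 (fst (M2 ! i))" using i len by (simp add: lmap_nth)
    then show ?thesis using Up by (simp add: val_def)
  qed (simp add: val_def)
  define OV where "OV = T ` {..<length U} \<union> Bo ` {..<length L}"
  define VT where "VT = top_emb ` pts U M1"
  define VB where "VB = bot_emb ` pts M2 L"
  define MV where "MV = M ` {..<length M1}"
  have VT: "VT = T ` {..<length U} \<union> MV" unfolding VT_def MV_def pts_def by (simp add: image_Un image_image)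
  have VB: "VB = Bo ` {..<length L} \<union> MV" unfolding VB_def MV_def pts_def by (auto simp add: image_Un image_image len)
  have finV: "finite VT" "finite VB" unfolding VT_def VB_def using finite_pts by blast+
  let ?R = "clink ?p ?q"
  have linkI1: "?R (top_emb x) (top_emb y)" if "x \<in> pts U M1" "y \<in> pts U M1" "labp U M1 x = labp U M1 y" for x y
  proof -
    have "x \<in> cls U M1 (labp U M1 x)" "y \<in> cls U M1 (labp U M1 x)" using that by (simp_all add: cls_def)
    moreover have "cls U M1 (labp U M1 x) \<in> blocks ?q" unfolding gp_simps by (rule imageI, rule labp_in[OF that(1)])
    ultimately show ?thesis unfolding clink_def by blast
  qed
  have linkI2: "?R (bot_emb x) (bot_emb y)" if "x \<in> pts M2 L" "y \<in> pts M2 L" "labp M2 L x = labp M2 L y" for x y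
  proof -
    have "x \<in> cls M2 L (labp M2 L x)" "y \<in> cls M2 L (labp M2 L x)" using that by (simp_all add: cls_def)
    moreover have "cls M2 L (labp M2 L x) \<in> blocks ?p" unfolding gp_simps by (rule imageI, rule labp_in[OF that(1)])
    ultimately show ?thesis unfolding clink_def by blast
  qed
  have linkD: "val x = val y \<and> y \<in> VT \<union> VB" if R: "?R x y" for x y
  proof -
    from R consider B where "B \<in> blocks ?q" "x \<in> top_emb ` B" "y \<in> top_emb ` B"
      | B where "B \<in> blocks ?p" "x \<in> bot_emb ` B" "y \<in> bot_emb ` B" unfolding clink_def by blast
    then show ?thesis
    proof cases
      case 1
      from 1(1) obtain a where a: "B = cls U M1 a" unfolding gp_simps by (rule imageE)
      from 1(2) obtain u where u: "x = top_emb u" "u \<in> B" by (rule imageE)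
      from 1(3) obtain v where v: "y = top_emb v" "v \<in> B" by (rule imageE)
      show ?thesis using u(2) v(2) unfolding a u(1) v(1) val_top VT_def by (simp add: cls_def)
    next
      case 2
      from 2(1) obtain a where a: "B = cls M2 L a" unfolding gp_simps by (rule imageE)
      from 2(2) obtain u where u: "x = bot_emb u" "u \<in> B" by (rule imageE)
      from 2(3) obtain v where v: "y = bot_emb v" "v \<in> B" by (rule imageE)
      have "u \<in> pts M2 L" "v \<in> pts M2 L" "labp M2 L u = labp M2 L v"
        using u(2) v(2) unfolding a by (simp_all add: cls_def)
      then show ?thesis unfolding u(1) v(1) VB_def by (simp add: val_bot)
    qed
  qed
  have comp: "cback ` {y. outer y \<and> ?R\<^sup>*\<^sup>* x y} = cls ?U ?L (val x)" if x: "x \<in> OV" for x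
  proof -
    define X where "X = {y. ?R\<^sup>*\<^sup>* x y}"
    have X: "val y = val x \<and> y \<in> VT \<union> VB" if "y \<in> X" for y
    proof -
      from that have "?R\<^sup>*\<^sup>* x y" by (simp add: X_def)
      then show ?thesis
      proof (induction rule: rtranclp_induct)
        case base
        then show ?case using x unfolding OV_def VT VB by blast
      next
        case (step y z)
        then show ?case using linkD[OF step(2)] by simp
      qed
    qed
    have closed: "z \<in> X" if "y \<in> X" "?R y z" for y z
      using that unfolding X_def by (simp add: rtranclp.rtrancl_into_rtrancl)
    have finX: "finite X" by (rule finite_subset[of _ "VT \<union> VB"]) (use X finV in auto)
    have e1: "even (card (X \<inter> VT))" unfolding VT_def
      by (rule even_closed[OF g1 inj_embs(1)]) (use closed linkI1 in blast)
    have e2: "even (card (X \<inter> VB))" unfolding VB_def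
      by (rule even_closed[OF g2 inj_embs(2)]) (use closed linkI2 in blast)
    have c1: "card (X \<inter> VT) = card (X \<inter> T ` {..<length U}) + card (X \<inter> MV)"
      unfolding VT Int_Un_distrib by (rule card_Un_disjoint) (auto simp: finX MV_def)
    have c2: "card (X \<inter> VB) = card (X \<inter> Bo ` {..<length L}) + card (X \<inter> MV)"
      unfolding VB Int_Un_distrib by (rule card_Un_disjoint) (auto simp: finX MV_def)
    have c3: "card (X \<inter> OV) = card (X \<inter> T ` {..<length U}) + card (X \<inter> Bo ` {..<length L})"
      unfolding OV_def Int_Un_distrib by (rule card_Un_disjoint) (auto simp: finX)
    \<comment> \<open>The middle points are counted in \<open>VT\<close> and again in
      \<open>VB\<close>, so they drop out modulo 2.\<close>
    have "even (card (X \<inter> OV))" using e1 e2 unfolding c1 c2 c3 by presburger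
    moreover have "x \<in> X \<inter> OV" using x by (simp add: X_def)
    moreover have "finite (X \<inter> OV)" using finX by simp
    ultimately have "card (X \<inter> OV) \<noteq> 0" "even (card (X \<inter> OV))"
      using card_0_eq[of "X \<inter> OV"] by blast+
    then have ge2: "card (X \<inter> OV) \<ge> 2" by (cases "card (X \<inter> OV) = 1") simp_all
    define F where "F = {y \<in> OV. val y = val x}"
    have labF: "cback y \<in> pts ?U ?L \<and> labp ?U ?L (cback y) = val y" if "y \<in> OV" for y
      using that by (auto simp: OV_def pts_def val_def lmap_nth)
    have injF: "inj_on cback OV" by (rule inj_onI) (auto simp: OV_def)
    have imF: "cback ` F = cls ?U ?L (val x)"
    proof (intro equalityI subsetI)
      fix w assume "w \<in> cback ` F"
      then obtain y where y: "w = cback y" "y \<in> F" by (rule imageE)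
      then show "w \<in> cls ?U ?L (val x)" using labF[of y] by (simp add: F_def cls_def)
    next
      fix w assume w: "w \<in> cls ?U ?L (val x)"
      then have "w \<in> pts ?U ?L" by (simp add: cls_def)
      then obtain y where y: "y \<in> OV" "w = cback y"
      proof (cases w)
        case (Up i)
        then show thesis using that[of "T i"] \<open>w \<in> pts ?U ?L\<close> by (auto simp: pts_def OV_def)
      next
        case (Lo i)
        then show thesis using that[of "Bo i"] \<open>w \<in> pts ?U ?L\<close> by (auto simp: pts_def OV_def)
      qed
      then have "val y = val x" using w labF[OF y(1)] by (simp add: cls_def)
      then show "w \<in> cback ` F" using y unfolding F_def by blast
    qed
    have "card F = card (cls ?U ?L (val x))"
      unfolding imF[symmetric] by (rule card_image[symmetric]) (rule inj_on_subset[OF injF], simp add: F_def)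
    then have "card F \<le> 2" unfolding card_cls using gauss_occ_cases[OF g, of "val x"] by linarith
    moreover have "finite F" by (simp add: F_def OV_def)
    moreover have "X \<inter> OV \<subseteq> F" using X by (auto simp: F_def)
    ultimately have "X \<inter> OV = F" using ge2 card_seteq[of F "X \<inter> OV"] by linarith
    moreover have "{y. outer y \<and> ?R\<^sup>*\<^sup>* x y} = X \<inter> OV"
    proof (intro equalityI subsetI)
      fix y assume y: "y \<in> {y. outer y \<and> ?R\<^sup>*\<^sup>* x y}"
      then have "y \<in> X" "outer y" by (simp_all add: X_def)
      then show "y \<in> X \<inter> OV" using X[of y] unfolding VT VB OV_def MV_def by auto
    qed (auto simp: X_def OV_def)
    ultimately show ?thesis using imF by simp
  qed
  have "val ` OV = labels (?L @ mirror ?U)"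
  proof -
    have "cback ` OV = pts ?U ?L"
      unfolding OV_def pts_def by (simp add: image_Un image_image)
    then have "labp ?U ?L ` cback ` OV = labels (?L @ mirror ?U)" by (simp only: labp_image)
    moreover have "labp ?U ?L (cback y) = val y" if "y \<in> OV" for y
      using that by (auto simp: OV_def val_def lmap_nth)
    then have "labp ?U ?L ` cback ` OV = val ` OV" unfolding image_image by (rule image_cong[OF refl])
    ultimately show ?thesis by simp
  qed
  note vOV = this
  have "{cback ` {y. outer y \<and> ?R\<^sup>*\<^sup>* x y} | x. x \<in> OV} =
      (\<lambda>x. cback ` {y. outer y \<and> ?R\<^sup>*\<^sup>* x y}) ` OV" by (rule Setcompr_eq_image)
  also have "\<dots> = (\<lambda>x. cls ?U ?L (val x)) ` OV" by (rule image_cong[OF refl comp])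
  also have "\<dots> = cls ?U ?L ` (labels (?L @ mirror ?U))" unfolding vOV[symmetric] image_image ..
  finally show ?thesis
    unfolding comp_def gp_simps length_map OV_def by (simp only: gp_def lmap_simps)
qed

lemma gp_inj:
  assumes "inj_on f (labels (cyc U L))"
  shows "gp (lmap f U) (lmap f L) = gp U L"
proof -
  have lab: "labp (lmap f U) (lmap f L) x = f (labp U L x)" if "x \<in> pts U L" for x
    using that by (auto simp: pts_def lmap_nth)
  have pts: "pts (lmap f U) (lmap f L) = pts U L" by (simp add: pts_def)
  have "cls (lmap f U) (lmap f L) (f a) = cls U L a" if "a \<in> labels (cyc U L)" for a
  proof -
    have "labp (lmap f U) (lmap f L) x = f a \<longleftrightarrow> labp U L x = a" if "x \<in> pts U L" for x
      unfolding lab[OF that] by (rule inj_on_eq_iff[OF assms labp_in[OF that] \<open>a \<in> labels (cyc U L)\<close>])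
    then show ?thesis unfolding cls_def pts by blast
  qed
  then have "cls (lmap f U) (lmap f L) ` f ` labels (cyc U L) = cls U L ` labels (cyc U L)"
    unfolding image_image by (intro image_cong) (simp_all del: set_append)
  moreover have "labels (lmap f L @ mirror (lmap f U)) = f ` labels (cyc U L)"
    by (simp add: image_Un)
  ultimately show ?thesis unfolding gp_def by (simp only: lmap_simps)
qed

lemma tens_gp:
  assumes dj: "labels (cyc U L) \<inter> labels (L' @ mirror U') = {}"
  shows "tens (gp U L) (gp U' L') = gp (U @ U') (L @ L')"
proof -
  let ?A = "labels (cyc U L)" and ?A' = "labels (L' @ mirror U')"
  let ?s = "shift (length U) (length L)"
  have pts: "pts (U @ U') (L @ L') = pts U L \<union> ?s ` pts U' L'"
  proof (intro equalityI subsetI)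
    fix x assume x: "x \<in> pts (U @ U') (L @ L')"
    show "x \<in> pts U L \<union> ?s ` pts U' L'"
    proof (cases x)
      case (Up i)
      show ?thesis
      proof (cases "i < length U")
        case False
        then have "x = ?s (Up (i - length U))" "Up (i - length U) \<in> pts U' L'"
          using x Up by (auto simp: pts_def)
        then show ?thesis by blast
      qed (use Up in \<open>simp add: pts_def\<close>)
    next
      case (Lo i)
      show ?thesis
      proof (cases "i < length L")
        case False
        then have "x = ?s (Lo (i - length L))" "Lo (i - length L) \<in> pts U' L'"
          using x Lo by (auto simp: pts_def)
        then show ?thesis by blast
      qed (use Lo in \<open>simp add: pts_def\<close>)
    qed
  qed (auto simp: pts_def)
  have l1: "labp (U @ U') (L @ L') x = labp U L x" if "x \<in> pts U L" for x
    using that by (auto simp: pts_def nth_append)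
  have l2: "labp (U @ U') (L @ L') (?s x) = labp U' L' x" for x
    by (cases x) (simp_all add: nth_append)
  have c1: "cls (U @ U') (L @ L') a = cls U L a" if "a \<in> ?A" for a
  proof (intro equalityI subsetI)
    fix x assume x: "x \<in> cls (U @ U') (L @ L') a"
    then have "x \<in> pts U L"
    proof -
      have "x \<notin> ?s ` pts U' L'"
      proof
        assume "x \<in> ?s ` pts U' L'"
        then obtain y where "x = ?s y" "y \<in> pts U' L'" by (rule imageE)
        then have "a \<in> ?A'" using x labp_in[of y U' L'] l2[of y] unfolding cls_def by simp
        then show False using that dj by blast
      qed
      then show ?thesis using x pts unfolding cls_def by blast
    qed
    then show "x \<in> cls U L a" using x l1 by (simp add: cls_def)
  qed (use l1 pts in \<open>auto simp: cls_def\<close>)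
  have c2: "cls (U @ U') (L @ L') a = ?s ` cls U' L' a" if "a \<in> ?A'" for a
  proof (intro equalityI subsetI)
    fix x assume x: "x \<in> cls (U @ U') (L @ L') a"
    have "x \<notin> pts U L"
    proof
      assume "x \<in> pts U L"
      then have "a \<in> ?A" using x labp_in[of x U L] l1[of x] unfolding cls_def by simp
      then show False using that dj by blast
    qed
    then have "x \<in> ?s ` pts U' L'" using x pts unfolding cls_def by blast
    then obtain y where "x = ?s y" "y \<in> pts U' L'" by (rule imageE)
    then show "x \<in> ?s ` cls U' L' a" using x l2[of y] by (simp add: cls_def)
  next
    fix x assume "x \<in> ?s ` cls U' L' a"
    then obtain y where "x = ?s y" "y \<in> cls U' L' a" by (rule imageE)
    then show "x \<in> cls (U @ U') (L @ L') a" using l2[of y] by (simp add: cls_def pts)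
  qed
  have A: "labels ((L @ L') @ mirror (U @ U')) = ?A \<union> ?A'"
    by (simp add: image_Un Un_ac)
  have "cls (U @ U') (L @ L') ` (?A \<union> ?A') = cls U L ` ?A \<union> image ?s ` cls U' L' ` ?A'"
  proof -
    have "cls (U @ U') (L @ L') ` ?A = cls U L ` ?A" by (rule image_cong[OF refl c1])
    moreover have "cls (U @ U') (L @ L') ` ?A' = (\<lambda>a. ?s ` cls U' L' a) ` ?A'"
      by (rule image_cong[OF refl c2])
    ultimately show ?thesis unfolding image_Un by (simp only: image_image)
  qed
  then show ?thesis
    unfolding tens_def gp_simps length_map gp_def[of "U @ U'"] A by (simp only: map_append)
qed

lemma invol_gp: "invol (gp U L) = gp L U"
proof -
  have ff: "flip (flip x) = x" for x by (cases x) simp_all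
  have pf: "flip x \<in> pts L U \<longleftrightarrow> x \<in> pts U L" for x by (cases x) (auto simp: pts_def)
  have lf: "labp L U (flip x) = labp U L x" for x by (cases x) simp_all
  have "flip ` cls U L a = cls L U a" for a
  proof (intro equalityI subsetI)
    fix x assume "x \<in> cls L U a"
    then have "flip x \<in> cls U L a" using pf[of "flip x"] lf[of "flip x"] ff[of x] by (simp add: cls_def)
    then show "x \<in> flip ` cls U L a" using ff[of x] by (metis imageI)
  qed (use pf lf in \<open>auto simp: cls_def\<close>)
  moreover have "labels (U @ mirror L) = labels (cyc U L)"
    by (simp add: image_Un Un_commute)
  ultimately show ?thesis
    unfolding invol_def gp_simps gp_def[of L U] by (simp only: image_image)
qed

lemma gp_idp: "([c], [c], {{Up 0, Lo 0}}) = gp [(a, c)] [(a, c)]"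
  by (auto simp: gp_def cls_def pts_def mirror_def)

lemma gp_pair: "([], [c, d], {{Lo 0, Lo 1}}) = gp [] [(a, c), (a, d)]"
  by (auto simp: gp_def cls_def pts_def mirror_def less_Suc_eq)

subsection \<open>The legal words form a category\<close>

lemma map_snd_mirror: "map snd (mirror z) = rev (map opp (map snd z))"
  by (simp add: mirror_def rev_map o_def apsnd_def map_prod_def split_beta)

lemma mirror_colours: "map snd y = map snd z \<Longrightarrow> map snd (mirror y) = map snd (mirror z)"
  by (simp only: map_snd_mirror)

lemma gauss_commute: "gauss (A @ B) \<longleftrightarrow> gauss (B @ A)"
  by (simp add: gauss_def add.commute)

lemma gauss_mirror: "gauss (mirror z) \<longleftrightarrow> gauss z"
proof -
  have "gauss (mirror z)" if "gauss z" for z :: "'a word"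
    by (rule gaussI) (use gaussD(1)[OF that] gaussD(2)[OF that] in simp_all)
  from this[of z] this[of "mirror z"] show ?thesis by auto
qed

lemma rotate_alternating:
  "Y @ X = [a, b, a, b] \<or> Y @ X = [b, a, b, a] \<Longrightarrow> X @ Y = [a, b, a, b] \<or> X @ Y = [b, a, b, a]"
  by (auto simp: append_eq_Cons_conv Cons_eq_append_conv)

lemma cross_rotate: "cross (B @ A) a b \<longleftrightarrow> cross (A @ B) a b"
  using rotate_alternating[of "restr a b A" "restr a b B" a b]
    rotate_alternating[of "restr a b B" "restr a b A" a b]
  unfolding cross_def by auto

lemma okay_rotate: "okay D lv (A @ B) \<Longrightarrow> okay D lv (B @ A)"
  unfolding okay_def cross_rotate[of B A] .

lemma path_rotate: "path lv k (A @ B) k \<Longrightarrow> path lv k A i \<Longrightarrow> path lv i (B @ A) i"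
  unfolding path_append using path_functional[of lv k A] by metis

lemma legal_rotate:
  assumes "legal D (A @ B)"
  shows "legal D (B @ A)"
proof -
  from assms obtain lv k where z: "gauss (A @ B)" "path lv k (A @ B) k" "okay D lv (A @ B)"
    unfolding legal_def by blast
  from z(2) obtain i where "path lv k A i" unfolding path_append by blast
  from path_rotate[OF z(2) this] show ?thesis
    using z(1) gauss_commute[of A B] okay_rotate[OF z(3)] unfolding legal_def by blast
qed

lemma legal_mirror:
  assumes "legal D z"
  shows "legal D (mirror z)"
proof -
  from assms obtain lv k where z: "gauss z" "path lv k z k" "okay D lv z"
    unfolding legal_def by blast
  have "cross (mirror z) a b \<longleftrightarrow> cross z a b" for a b
    unfolding cross_def by (auto simp: rev_swap)
  then have "okay D lv (mirror z)" using z(3) by (simp add: okay_def)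
  then show ?thesis
    using z(1,2) gauss_mirror[of z] path_mirror[of lv k z k] unfolding legal_def by blast
qed

text \<open>In cyclic reading a tensor product inserts the second word between the lower and the
  upper row of the first. Rotation moves this gap to the end, where insertion is
  concatenation.\<close>

lemma legal_insert:
  assumes "legal D (A @ B)" "legal D z" "labels (A @ B) \<inter> labels z = {}"
  shows "legal D (A @ z @ B)"
proof -
  have "labels (B @ A) \<inter> labels z = {}" using assms(3) by (simp add: image_Un Un_commute)
  then have "legal D ((B @ A) @ z)" by (rule legal_append[OF _ legal_rotate[OF assms(1)] assms(2)])
  then have "legal D (B @ (A @ z))" by simp
  from legal_rotate[OF this] show ?thesis by simp
qed

lemma legal_pair: "legal D [(a, c), (a, opp c)]"
proof -
  have "gauss [(a, c), (a, opp c)]" by (cases c) (auto simp: gauss_def)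
  moreover have "okay D lv [(a, c), (a, opp c)]" for lv
    by (auto simp: okay_def cross_def)
  moreover have "path (\<lambda>_. 0) (if c = Wh then 0 else 1) [(a, c), (a, opp c)] (if c = Wh then 0 else 1)"
    by (cases c) simp_all
  ultimately show ?thesis unfolding legal_def by blast
qed

lemma I_D_P2nb: "p \<in> I_D D \<Longrightarrow> p \<in> P2nb"
  by (simp add: I_D_def S0_def)

lemma I_D_gp:
  assumes "p \<in> I_D D"
  obtains U L :: "nat word" where "p = gp U L" "legal D (cyc U L)"
proof -
  obtain U L :: "nat word" where "p = gp U L" "gauss (cyc U L)"
    by (rule P2nb_gp[OF I_D_P2nb[OF assms]])
  then show thesis using that gp_I_D[of L U D] assms by blast
qed

lemma legal_gauss: "legal D z \<Longrightarrow> gauss z"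
  by (simp add: legal_def)

lemma gp_legal: "legal D (cyc U L) \<Longrightarrow> gp U L \<in> I_D D"
  using gp_I_D[OF legal_gauss] by blast

lemma disjoint_sum: "labels (lmap Inl y) \<inter> labels (lmap Inr z) = {}"
  unfolding lmap_simps by auto

lemma lmap_const:
  fixes y z :: "'b word"
  assumes "map snd y = map snd z"
  shows "lmap (\<lambda>_. u) y = lmap (\<lambda>_. u) z"
proof -
  have "lmap (\<lambda>_. u) z = map (Pair u) (map snd z)" for z :: "'b word"
    by (simp add: lmap_def apfst_def map_prod_def split_beta)
  then show ?thesis using assms by metis
qed

text \<open>The common core of \<open>I_D_comp\<close> and \<open>eqv_trans\<close>. With labels
  made disjoint by the sum type, the cyclic words are put side by side so that
  \<open>mirror M2\<close> meets \<open>M1\<close>; contracting the two middle rows leaves the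
  cyclic word of the composite.\<close>

lemma contract_composite:
  fixes L M2 :: "'a word" and M1 U :: "'b word" and Q :: "('a + 'b) word \<Rightarrow> bool"
  assumes step: "\<And>A a b c B. Q (A @ (a, c) # (b, opp c) # B) \<Longrightarrow> Q (lmap (ren a b) (A @ B))"
    and z: "Q (lmap Inl (L @ mirror M2) @ lmap Inr (M1 @ mirror U))"
    and e: "lmap \<phi> M1 = lmap \<phi>' M2"
  obtains f1 f2 where "lmap f1 M1 = lmap f2 M2" "Q (lmap f2 L @ mirror (lmap f1 U))"
    "case_sum \<phi>' \<phi> \<circ> f1 = \<phi>" "case_sum \<phi>' \<phi> \<circ> f2 = \<phi>'"
proof -
  let ?m = "mirror (lmap Inl M2) :: ('a + 'b) word" and ?m' = "mirror (lmap Inr M1) :: ('a + 'b) word"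
  have z': "Q (lmap Inl L @ ?m @ mirror ?m' @ mirror (lmap Inr U))" using z by simp
  have c: "map snd ?m = map snd ?m'"
    by (rule mirror_colours) (simp only: lmap_simps lmap_snd[OF e])
  have l: "lmap (case_sum \<phi>' \<phi>) ?m = lmap (case_sum \<phi>' \<phi>) ?m'"
    by (simp only: lmap_simps lmap_lmap case_sum_o_inj e)
  have "\<exists>\<psi> :: 'a + 'b \<Rightarrow> 'a + 'b. lmap \<psi> ?m = lmap \<psi> ?m' \<and>
      Q (lmap \<psi> (lmap Inl L @ mirror (lmap Inr U))) \<and> case_sum \<phi>' \<phi> \<circ> \<psi> = case_sum \<phi>' \<phi>"
    by (rule contract[where Q = Q and \<Phi> = "case_sum \<phi>' \<phi>", OF _ z' c l]) (rule step)
  then obtain \<psi> :: "'a + 'b \<Rightarrow> 'a + 'b" where \<psi>: "lmap \<psi> ?m = lmap \<psi> ?m'"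
    "Q (lmap \<psi> (lmap Inl L @ mirror (lmap Inr U)))" "case_sum \<phi>' \<phi> \<circ> \<psi> = case_sum \<phi>' \<phi>" by blast
  show thesis
  proof (rule that)
    show "lmap (\<psi> \<circ> Inr) M1 = lmap (\<psi> \<circ> Inl) M2"
      using \<psi>(1) by (metis lmap_lmap lmap_simps(4) mirror_simps(4))
    show "Q (lmap (\<psi> \<circ> Inl) L @ mirror (lmap (\<psi> \<circ> Inr) U))"
      using \<psi>(2) by (simp only: lmap_simps lmap_lmap)
  qed (simp_all only: comp_assoc[symmetric] \<psi>(3) case_sum_o_inj)
qed

lemma I_D_comp:
  assumes "p \<in> I_D D" "q \<in> I_D D" "lwr q = upr p"
  shows "comp p q \<in> I_D D"
proof -
  obtain M2 L :: "nat word" where p: "p = gp M2 L" "legal D (L @ mirror M2)"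
    using assms(1) by (rule I_D_gp)
  obtain U M1 :: "nat word" where q: "q = gp U M1" "legal D (M1 @ mirror U)"
    using assms(2) by (rule I_D_gp)
  \<comment> \<open>Labels from a one-element type see nothing but colours, so matching colours of
    the middle rows are enough for the contraction.\<close>
  have col: "lmap (\<lambda>_. ()) M1 = lmap (\<lambda>_. ()) M2"
    using assms(3) unfolding p q gp_simps by (rule lmap_const)
  have z: "legal D (lmap Inl (L @ mirror M2) @ lmap Inr (M1 @ mirror U))"
    by (intro legal_append disjoint_sum legal_lmap_inj p q) simp_all
  obtain f1 f2 :: "nat \<Rightarrow> nat + nat" where m: "lmap f1 M1 = lmap f2 M2"
    and l: "legal D (lmap f2 L @ mirror (lmap f1 U))"
    by (rule contract_composite[where Q = "legal D", OF _ z col]) (erule legal_contract, rule that)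
  have "comp p q = gp (lmap f1 U) (lmap f2 L)"
    unfolding p(1) q(1)
    by (rule comp_gp[OF legal_gauss[OF q(2)] legal_gauss[OF p(2)] m legal_gauss[OF l]])
  then show ?thesis using gp_legal[OF l] by simp
qed

lemma I_D_tens:
  assumes "p \<in> I_D D" "q \<in> I_D D"
  shows "tens p q \<in> I_D D"
proof -
  obtain U L :: "nat word" where p: "p = gp U L" "legal D (cyc U L)"
    using assms(1) by (rule I_D_gp)
  obtain U' L' :: "nat word" where q: "q = gp U' L'" "legal D (L' @ mirror U')"
    using assms(2) by (rule I_D_gp)
  let ?l = "Inl :: nat \<Rightarrow> nat + nat" and ?r = "Inr :: nat \<Rightarrow> nat + nat"
  have p': "p = gp (lmap ?l U) (lmap ?l L)" unfolding p(1) by (rule gp_inj[symmetric]) simp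
  have q': "q = gp (lmap ?r U') (lmap ?r L')" unfolding q(1) by (rule gp_inj[symmetric]) simp
  have lp: "legal D (lmap ?l (cyc U L))" and lq: "legal D (lmap ?r (L' @ mirror U'))"
    by (intro legal_lmap_inj p q; simp)+
  have "tens p q = gp (lmap ?l U @ lmap ?r U') (lmap ?l L @ lmap ?r L')"
    unfolding p' q' using disjoint_sum[of "L @ mirror U" "L' @ mirror U'"]
    by (intro tens_gp) (simp only: lmap_simps)
  moreover have "legal D (lmap ?l L @ lmap ?r (L' @ mirror U') @ mirror (lmap ?l U))"
    by (rule legal_insert) (use lp lq disjoint_sum[of "L @ mirror U" "L' @ mirror U'"] in \<open>simp_all only: lmap_simps\<close>)
  then have "legal D ((lmap ?l L @ lmap ?r L') @ mirror (lmap ?l U @ lmap ?r U'))" by simp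
  ultimately show ?thesis using gp_legal by metis
qed

lemma I_D_invol:
  assumes "p \<in> I_D D"
  shows "invol p \<in> I_D D"
proof -
  obtain U L :: "nat word" where p: "p = gp U L" "legal D (cyc U L)"
    using assms(1) by (rule I_D_gp)
  then have "legal D (U @ mirror L)" using legal_mirror[OF p(2)] by simp
  then show ?thesis unfolding p(1) invol_gp by (rule gp_legal)
qed

lemma gen_cat_subset_I_D:
  assumes "G \<subseteq> I_D D"
  shows "gen_cat G \<subseteq> I_D D"
proof
  fix p assume "p \<in> gen_cat G"
  then show "p \<in> I_D D"
  proof induction
    case (base p)
    then show ?case using assms by blast
  next
    case (idp c)
    have "legal D ([(0::nat, c)] @ mirror [(0, c)])" using legal_pair by simp
    then show ?case unfolding gp_idp[of c "0::nat"] by (rule gp_legal)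
  next
    case pairWB
    have "legal D ([(0::nat, Wh), (0, Bl)] @ mirror [])" using legal_pair[of D "0::nat" Wh] by simp
    then show ?case unfolding gp_pair[of _ _ "0::nat"] by (rule gp_legal)
  next
    case pairBW
    have "legal D ([(0::nat, Bl), (0, Wh)] @ mirror [])" using legal_pair[of D "0::nat" Bl] by simp
    then show ?case unfolding gp_pair[of _ _ "0::nat"] by (rule gp_legal)
  qed (simp_all add: I_D_tens I_D_invol I_D_comp)
qed

subsection \<open>The generator \<open>h\<close>\<close>

text \<open>Label classes of a Gauss word have at most two points, so a two-point set with constant
  label is a full class, and a cover by such sets consists of all classes.\<close>

lemma gp_eqI:
  assumes g: "gauss (cyc U L)"
    and P: "\<And>B. B \<in> P \<Longrightarrow> \<exists>x y. B = {x, y} \<and> x \<noteq> y \<and> x \<in> pts U L \<and> y \<in> pts U L \<and> labp U L x = labp U L y"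
    and cover: "pts U L \<subseteq> \<Union>P"
  shows "(map snd U, map snd L, P) = gp U L"
proof -
  have cl: "B = cls U L a" if B: "B \<in> P" "x \<in> B" "labp U L x = a" for B x a
  proof -
    obtain u v where uv: "B = {u, v}" "u \<noteq> v" "u \<in> pts U L" "v \<in> pts U L" "labp U L u = labp U L v"
      using P[OF B(1)] by blast
    have "labp U L u = a" using B(2,3) uv(1,5) by auto
    then have "B \<subseteq> cls U L a" using uv by (simp add: cls_def)
    moreover have "finite (cls U L a)" using finite_pts[of U L] by (simp add: cls_def)
    moreover have "card (cls U L a) \<le> 2"
      unfolding card_cls using gauss_occ_cases[OF g, of a] by linarith
    moreover have "card B = 2" using uv(1,2) by simp
    ultimately show ?thesis by (intro card_seteq) simp_all
  qed
  have "P = cls U L ` (labp U L ` pts U L)"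
  proof (intro equalityI subsetI)
    fix B assume B: "B \<in> P"
    then obtain x where x: "x \<in> B" "x \<in> pts U L" using P[OF B] by blast
    then show "B \<in> cls U L ` (labp U L ` pts U L)" using cl[OF B x(1) refl] by blast
  next
    fix B assume "B \<in> cls U L ` (labp U L ` pts U L)"
    then obtain x where x: "x \<in> pts U L" "B = cls U L (labp U L x)" by blast
    then obtain B' where B': "B' \<in> P" "x \<in> B'" using cover by blast
    then show "B \<in> P" using cl[OF B' refl] x(2) by simp
  qed
  then show ?thesis unfolding gp_def labp_image by simp
qed

definition h_up :: "nat word" where "h_up = [(2, Wh), (1, Bl), (0, Wh)]"
definition h_lo :: "nat word" where "h_lo = [(0, Wh), (1, Bl), (2, Wh)]"

lemma gauss_h: "gauss (h_lo @ mirror h_up)"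
  by (auto simp: gauss_def h_lo_def h_up_def)

lemma h_gp: "h = gp h_up h_lo"
proof -
  have "h = (map snd h_up, map snd h_lo, {{Lo 0, Up 2}, {Lo 1, Up 1}, {Lo 2, Up 0}})"
    by (simp add: h_def h_up_def h_lo_def)
  also have "\<dots> = gp h_up h_lo"
  proof (rule gp_eqI[OF gauss_h])
    fix B assume "B \<in> {{Lo 0, Up 2}, {Lo 1, Up 1}, {Lo 2, Up 0}}"
    then consider "B = {Lo 0, Up 2}" | "B = {Lo 1, Up 1}" | "B = {Lo 2, Up 0}" by blast
    then show "\<exists>x y. B = {x, y} \<and> x \<noteq> y \<and> x \<in> pts h_up h_lo \<and> y \<in> pts h_up h_lo \<and>
        labp h_up h_lo x = labp h_up h_lo y"
      by cases (rule exI, rule exI, rule conjI, assumption, simp add: pts_def h_up_def h_lo_def)+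
  qed (auto simp: pts_def h_up_def h_lo_def less_Suc_eq numeral_3_eq_3 numeral_2_eq_2)
  finally show ?thesis .
qed

text \<open>All three strings of \<open>h\<close> have level \<open>0\<close>, so \<open>0\<close>
  is the only distance between them.\<close>

lemma h_in_I_D: "0 \<notin> D \<Longrightarrow> h \<in> I_D D"
proof -
  assume "0 \<notin> D"
  then have "okay D (\<lambda>_. 0) z" for z :: "nat word" by (simp add: okay_def)
  moreover have "path (\<lambda>_. 0) 0 (h_lo @ mirror h_up) 0" by (simp add: h_lo_def h_up_def)
  ultimately show ?thesis
    unfolding h_gp by (intro gp_legal) (use gauss_h in \<open>auto simp: legal_def\<close>)
qed

subsection \<open>Surgery on legal words\<close>

lemma gauss_cong: "(\<And>a c. cnt y a c = cnt z a c) \<Longrightarrow> gauss y \<longleftrightarrow> gauss z"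
  by (simp only: gauss_def)

lemma gauss_sub:
  assumes "gauss z" "\<And>e. (\<forall>c. cnt z' e c = cnt z e c) \<or> (\<forall>c. cnt z' e c = 0)"
  shows "gauss z'"
proof (rule gaussI)
  fix e
  show "cnt z' e Wh = cnt z' e Bl" using assms(2)[of e] gaussD(1)[OF assms(1), of e] by auto
  show "cnt z' e Wh \<le> 1" using assms(2)[of e] gaussD(2)[OF assms(1), of e Wh] by auto
qed

lemma okay_sub:
  assumes "okay D lv z"
    and "\<And>a b. a \<in> labels z' \<Longrightarrow> b \<in> labels z' \<Longrightarrow> restr a b z' = restr a b z"
  shows "okay D lv z'"
proof (rule okayI)
  fix a b assume c: "cross z' a b"
  have "restr a b z' = restr a b z" using cross_in[OF c] assms(2) by blast
  then have "cross z a b" using c by (simp add: cross_def)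
  then show "nat \<bar>lv a - lv b\<bar> \<notin> D" by (rule okayD[OF assms(1)])
qed

lemma cnt_0_of_occ: "occ z e = 0 \<Longrightarrow> cnt z e c = 0"
  unfolding occ_cnt by (cases c) simp_all

lemma pairs_sum_2:
  assumes "i + j + k = (2::nat)"
  obtains "i = 2" "j = 0" "k = 0" | "i = 0" "j = 2" "k = 0" | "i = 0" "j = 0" "k = 2"
    | "i = 1" "j = 1" "k = 0" | "i = 1" "j = 0" "k = 1" | "i = 0" "j = 1" "k = 1"
proof -
  have "i = 2 \<and> j = 0 \<and> k = 0 \<or> i = 0 \<and> j = 2 \<and> k = 0 \<or> i = 0 \<and> j = 0 \<and> k = 2
    \<or> i = 1 \<and> j = 1 \<and> k = 0 \<or> i = 1 \<and> j = 0 \<and> k = 1 \<or> i = 0 \<and> j = 1 \<and> k = 1"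
    using assms by presburger
  then show thesis using that by blast
qed

text \<open>Afterwards the arc \<open>u\<close> covers both \<open>s\<close> and \<open>t1\<close>.
  A string crossing it has one end in \<open>s\<close> or \<open>t1\<close> and the other in
  \<open>t2\<close>; in the first case it crossed \<open>x\<close> before, in the second
  \<open>u\<close>.\<close>

lemma slide_arc:
  assumes g: "gauss ((x, Wh) # s @ (x, Bl) # (u, Wh) # t1 @ (u, Bl) # t2)" (is "gauss ?z")
    and ok: "okay D lv ((x, Wh) # s @ (x, Bl) # (u, Wh) # t1 @ (u, Bl) # t2)" and lv: "lv x = lv u"
  shows "gauss ((u, Wh) # s @ t1 @ (u, Bl) # t2)" (is "gauss ?z'")
    and "okay D lv ((u, Wh) # s @ t1 @ (u, Bl) # t2)"
proof -
  have "occ ?z x = 2" by (rule gauss_occ[OF g]) simp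
  then have x: "occ s x = 0" "occ t1 x = 0" "occ t2 x = 0" "u \<noteq> x" by (auto split: if_splits)
  have "occ ?z u = 2" by (rule gauss_occ[OF g]) simp
  then have u: "occ s u = 0" "occ t1 u = 0" "occ t2 u = 0" using x(4) by auto
  show "gauss ?z'"
  proof (rule gauss_sub[OF g])
    fix e show "(\<forall>c. cnt ?z' e c = cnt ?z e c) \<or> (\<forall>c. cnt ?z' e c = 0)"
      using x by (cases "e = x") (auto simp: cnt_0_of_occ)
  qed
  have x': "occ ?z' x = 0" using x by simp
  show "okay D lv ?z'"
  proof (rule okay_by_focus[of _ u])
    fix b assume c: "cross ?z' u b"
    have b: "b \<noteq> u" "b \<noteq> x" using crossD(1)[OF c] cross_occ[OF c] x' by auto
    have "occ s b + occ t1 b + occ t2 b = 2" using cross_occ(2)[OF c] b by simp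
    moreover note cd = crossD(2)[OF c]
    have r: "restr u b s = replicate (occ s b) b" "restr u b t1 = replicate (occ t1 b) b"
      "restr u b t2 = replicate (occ t2 b) b" "restr x b s = replicate (occ s b) b"
      "restr x b t1 = replicate (occ t1 b) b" "restr x b t2 = replicate (occ t2 b) b"
      using u x by (simp_all add: restr_replicate')
    ultimately have "cross ?z x b \<or> cross ?z u b"
      using cd b x(4) unfolding cross_def
      by (elim pairs_sum_2) (simp_all add: r numeral_2_eq_2)
    then show "nat \<bar>lv u - lv b\<bar> \<notin> D" using okayD[OF ok] lv by metis
  next
    fix a b assume ab: "a \<noteq> u" "b \<noteq> u" "cross ?z' a b"
    have "a \<noteq> x" "b \<noteq> x" using cross_occ[OF ab(3)] x' by auto
    then have "restr a b ?z = restr a b ?z'" using ab by simp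
    then have "cross ?z a b" using ab(3) by (simp add: cross_def)
    then show "nat \<bar>lv a - lv b\<bar> \<notin> D" by (rule okayD[OF ok])
  qed
qed

lemma pairs_sum_2':
  assumes "i + j + k + l = (2::nat)"
  shows "(i = 2 \<and> j = 0 \<and> k = 0 \<and> l = 0) \<or> (i = 0 \<and> j = 2 \<and> k = 0 \<and> l = 0) \<or>
    (i = 0 \<and> j = 0 \<and> k = 2 \<and> l = 0) \<or> (i = 0 \<and> j = 0 \<and> k = 0 \<and> l = 2) \<or>
    (i = 1 \<and> j = 1 \<and> k = 0 \<and> l = 0) \<or> (i = 1 \<and> j = 0 \<and> k = 1 \<and> l = 0) \<or>
    (i = 1 \<and> j = 0 \<and> k = 0 \<and> l = 1) \<or> (i = 0 \<and> j = 1 \<and> k = 1 \<and> l = 0) \<or>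
    (i = 0 \<and> j = 1 \<and> k = 0 \<and> l = 1) \<or> (i = 0 \<and> j = 0 \<and> k = 1 \<and> l = 1)"
  using assms by presburger

text \<open>Exchanging the white ends uncrosses the two arcs: \<open>w\<close> now covers
  \<open>x\<close>. Running through the possible pairs among the four segments shows that a string
  crossing one of the new arcs crossed one of the old ones, which have the same level.\<close>

lemma swap_arcs:
  assumes g: "gauss ((x, Wh) # s @ (w, Wh) # A @ (x, Bl) # B @ (w, Bl) # C)" (is "gauss ?z")
    and ok: "okay D lv ((x, Wh) # s @ (w, Wh) # A @ (x, Bl) # B @ (w, Bl) # C)"
    and lv: "lv x = lv w" and "x \<noteq> w"
  shows "gauss ((w, Wh) # s @ (x, Wh) # A @ (x, Bl) # B @ (w, Bl) # C)" (is "gauss ?z'")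
    and "okay D lv ((w, Wh) # s @ (x, Wh) # A @ (x, Bl) # B @ (w, Bl) # C)"
proof -
  have "occ ?z x = 2" by (rule gauss_occ[OF g]) simp
  then have x: "occ s x = 0" "occ A x = 0" "occ B x = 0" "occ C x = 0" using \<open>x \<noteq> w\<close> by auto
  have "occ ?z w = 2" by (rule gauss_occ[OF g]) simp
  then have w: "occ s w = 0" "occ A w = 0" "occ B w = 0" "occ C w = 0" using \<open>x \<noteq> w\<close> by auto
  show "gauss ?z'"
  proof (rule gauss_sub[OF g])
    fix e show "(\<forall>c. cnt ?z' e c = cnt ?z e c) \<or> (\<forall>c. cnt ?z' e c = 0)" by auto
  qed
  have r: "restr e b s = replicate (occ s b) b" "restr e b A = replicate (occ A b) b"
    "restr e b B = replicate (occ B b) b" "restr e b C = replicate (occ C b) b"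
    if "e = x \<or> e = w" for e b
    using that x w by (auto simp add: restr_replicate')
  have key: "nat \<bar>lv e - lv b\<bar> \<notin> D" if c: "cross ?z' e b" and e: "e = x \<or> e = w" for e b
  proof -
    have "b \<noteq> x \<and> b \<noteq> w"
    proof (rule ccontr)
      assume "\<not> ?thesis"
      then have "(e = x \<and> b = w) \<or> (e = w \<and> b = x)" using crossD(1)[OF c] e by blast
      then show False
        using crossD(2)[OF c] x w r[of x w] r[of w x] \<open>x \<noteq> w\<close> by auto
    qed
    then have b: "b \<noteq> x" "b \<noteq> w" by blast+
    have "occ s b + occ A b + occ B b + occ C b = 2" using cross_occ(2)[OF c] b by simp
    note cases = pairs_sum_2'[OF this]
    have "cross ?z x b \<or> cross ?z w b"
      using e
    proof
      assume "e = x"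
      then show ?thesis using cases crossD(2)[OF c] b \<open>x \<noteq> w\<close> unfolding cross_def
        by (elim disjE conjE) (simp_all add: r numeral_2_eq_2)
    next
      assume "e = w"
      then show ?thesis using cases crossD(2)[OF c] b \<open>x \<noteq> w\<close> unfolding cross_def
        by (elim disjE conjE) (simp_all add: r numeral_2_eq_2)
    qed
    then show ?thesis using okayD[OF ok] lv e by metis
  qed
  show "okay D lv ?z'"
  proof (rule okayI)
    fix a b assume c: "cross ?z' a b"
    consider "a = x \<or> a = w" | "b = x \<or> b = w" | "a \<noteq> x" "a \<noteq> w" "b \<noteq> x" "b \<noteq> w" by blast
    then show "nat \<bar>lv a - lv b\<bar> \<notin> D"
    proof cases
      case 1
      then show ?thesis using key c by blast
    next
      case 2
      then have "nat \<bar>lv b - lv a\<bar> \<notin> D" using key[of b a] c by (simp add: cross_commute)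
      then show ?thesis by (simp add: abs_minus_commute)
    next
      case 3
      then have "restr a b ?z = restr a b ?z'" by simp
      then have "cross ?z a b" using c by (simp add: cross_def)
      then show ?thesis by (rule okayD[OF ok])
    qed
  qed
qed

text \<open>The word of the projection attached to a segment \<open>s\<close>: the strings leaving \<open>s\<close> run straight
  through, the strings inside \<open>s\<close> are kept on both sides.\<close>

definition through :: "'a word \<Rightarrow> 'a \<Rightarrow> 'a + 'a" where
  "through s a = (if occ s a = 2 then Inr a else Inl a)"

definition dbl :: "'a word \<Rightarrow> ('a + 'a) word" where
  "dbl s = lmap Inl s @ mirror (lmap (through s) s)"

lemma inj_through: "inj (through s)"
  by (rule injI) (auto simp: through_def split: if_splits)

lemma length_dbl: "length (dbl s) = 2 * length s"
  by (simp add: dbl_def)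

lemma cnt_lmap_Inl: "cnt (lmap Inl s) (Inl a) c = cnt s a c" "cnt (lmap Inl s) (Inr a) c = 0"
proof -
  show "cnt (lmap Inl s) (Inl a) c = cnt s a c" by (rule cnt_lmap_inj) (auto simp: inj_on_def)
  show "cnt (lmap Inl s) (Inr a) c = 0" by (rule cnt_lmap_notin) auto
qed

lemma cnt_lmap_through:
  "cnt (lmap (through s) s) (Inl a) c = (if occ s a = 2 then 0 else cnt s a c)"
  "cnt (lmap (through s) s) (Inr a) c = (if occ s a = 2 then cnt s a c else 0)"
proof -
  have 1: "cnt (lmap (through s) s) (through s a) c = cnt s a c"
    by (rule cnt_lmap_inj) (rule inj_on_subset[OF inj_through subset_UNIV])
  have 2: "cnt (lmap (through s) s) e c = 0" if "e \<notin> range (through s)" for e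
    by (rule cnt_lmap_notin) (use that in blast)
  show "cnt (lmap (through s) s) (Inl a) c = (if occ s a = 2 then 0 else cnt s a c)"
    using 1 2[of "Inl a"] by (auto simp: through_def split: if_splits)
  show "cnt (lmap (through s) s) (Inr a) c = (if occ s a = 2 then cnt s a c else 0)"
    using 1 2[of "Inr a"] by (auto simp: through_def split: if_splits)
qed

lemma gauss_dbl:
  assumes g: "gauss (s @ R)"
  shows "gauss (dbl s)"
proof -
  have "cnt (dbl s) e Wh = cnt (dbl s) e Bl \<and> cnt (dbl s) e Wh \<le> 1" for e
  proof -
    obtain a where a: "e = Inl a \<or> e = Inr a" by (cases e) auto
    have le: "cnt s a Wh \<le> 1" "cnt s a Bl \<le> 1"
      using gaussD(2)[OF g, of a Wh] gaussD(2)[OF g, of a Bl] by simp_all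
    have o: "occ s a = 0 \<or> occ s a = 1 \<or> occ s a = 2" using le by (auto simp: occ_cnt)
    show ?thesis
    proof (cases "occ s a = 2")
      case True
      then have "cnt s a Wh = 1" "cnt s a Bl = 1" using le by (simp_all add: occ_cnt)
      then show ?thesis using a True unfolding dbl_def cnt_simps cnt_mirror
        by (elim disjE) (simp_all add: cnt_lmap_Inl cnt_lmap_through)
    next
      case False
      then have "cnt s a Wh + cnt s a Bl \<le> 1" using o by (auto simp: occ_cnt)
      then show ?thesis using a False unfolding dbl_def cnt_simps cnt_mirror
        by (elim disjE) (simp_all add: cnt_lmap_Inl cnt_lmap_through)
    qed
  qed
  then show ?thesis unfolding gauss_def by blast
qed

lemma occ_lmap_inj: "inj f \<Longrightarrow> occ (lmap f z) (f a) = occ z a"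
  by (induction z) (auto simp: inj_eq)

lemma occ_lmap_notin: "e \<notin> range f \<Longrightarrow> occ (lmap f z) e = 0"
  by (induction z) auto

lemma restr_lmap_injU: "inj f \<Longrightarrow> restr (f a) (f b) (lmap f z) = map f (restr a b z)"
  by (rule restr_lmap_inj) (auto simp: inj_on_def inj_def)

text \<open>Forgetting the copy sends crossings of the doubled word to crossings of
  \<open>s @ R\<close>. A string running through the double stands for one that leaves
  \<open>s\<close>, and its end in the second copy plays the part of the end in \<open>R\<close>.
  Two such strings never cross in the double, since the second copy is reversed.\<close>

lemma cross_dbl:
  fixes s R :: "'a word"
  assumes g: "gauss (s @ R)" and c: "cross (dbl s) x y"
  shows "cross (s @ R) (case_sum id id x) (case_sum id id y)"
proof -
  let ?l = "Inl :: 'a \<Rightarrow> 'a + 'a"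
  have iT: "restr (through s a) (through s b) (lmap (through s) s) = map (through s) (restr a b s)" for a b
    by (rule restr_lmap_injU[OF inj_through])
  have iL: "restr (Inl a) (Inl b) (lmap Inl s) = map Inl (restr a b s)" for a b
    by (rule restr_lmap_injU) simp
  have occL: "occ (lmap Inl s) (Inl a) = occ s a" "occ (lmap Inl s) (Inr a) = 0" for a
    by (auto intro: occ_lmap_inj occ_lmap_notin)
  have occT: "occ (lmap (through s) s) (through s a) = occ s a" for a
    by (rule occ_lmap_inj[OF inj_through])
  have occT0: "occ (lmap (through s) s) e = 0" if "e \<notin> range (through s)" for e
    using that by (rule occ_lmap_notin)
  have oR: "occ s a + occ R a = 0 \<or> occ s a + occ R a = 2" for a
    using gauss_occ_cases[OF g, of a] by simp
  have thr_Inl: "through s a = Inl a" if "occ s a \<noteq> 2" for a using that by (simp add: through_def)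
  have thr_Inr: "through s a = Inr a" if "occ s a = 2" for a using that by (simp add: through_def)
  have nInl: "Inl a \<notin> range (through s)" if "occ s a = 2" for a
    using that by (auto simp: through_def split: if_splits)
  have nInr: "Inr a \<notin> range (through s)" if "occ s a \<noteq> 2" for a
    using that by (auto simp: through_def split: if_splits)
  have E: "restr e f (dbl s) = restr e f (lmap Inl s) @ rev (restr e f (lmap (through s) s))" for e f
    by (simp add: dbl_def)
  have two: "occ (dbl s) x = 2" "occ (dbl s) y = 2" using cross_occ[OF c] by blast+
  have occE: "occ (dbl s) e = occ (lmap Inl s) e + occ (lmap (through s) s) e" for e
    by (simp add: dbl_def)
  have LL: "cross (s @ R) a b" if xy: "x = Inl a" "y = Inl b" for a b
  proof -
    have "a \<noteq> b" using crossD(1)[OF c] xy by simp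
    have oa: "occ s a = 1 \<or> occ s a = 2"
      using two(1) occT[of a] occT0[of "Inl a"] nInl[of a] thr_Inl[of a] unfolding xy occE occL by fastforce
    have ob: "occ s b = 1 \<or> occ s b = 2"
      using two(2) occT[of b] occT0[of "Inl b"] nInl[of b] thr_Inl[of b] unfolding xy occE occL by fastforce
    consider "occ s a = 2" "occ s b = 2" | "occ s a = 2" "occ s b = 1" | "occ s a = 1" "occ s b = 2"
      | "occ s a = 1" "occ s b = 1" using oa ob by blast
    then show ?thesis
    proof cases
      case 1
      have "restr (Inl a) (Inl b) (lmap (through s) s) = []"
        using occT0 nInl 1 by (intro restr_none) blast+
      then have "map ?l (restr a b s) = [Inl a, Inl b, Inl a, Inl b] \<or> map ?l (restr a b s) = [Inl b, Inl a, Inl b, Inl a]"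
        using crossD(2)[OF c] unfolding xy E iL by simp
      then have "restr a b s = [a, b, a, b] \<or> restr a b s = [b, a, b, a]" by auto
      moreover have "restr a b R = []" using oR[of a] oR[of b] 1 by (intro restr_none) simp_all
      ultimately show ?thesis using \<open>a \<noteq> b\<close> by (simp add: cross_def)
    next
      case 2
      have "restr (Inl a) (Inl b) (lmap (through s) s) = replicate (occ (lmap (through s) s) (Inl b)) (Inl b)"
        using occT0 nInl 2 by (intro restr_replicate') blast
      also have "\<dots> = [Inl b]" using occT[of b] thr_Inl[of b] 2 by simp
      finally have "map ?l (restr a b s) @ [Inl b] = [Inl a, Inl b, Inl a, Inl b] \<or> map ?l (restr a b s) @ [Inl b] = [Inl b, Inl a, Inl b, Inl a]"
        using crossD(2)[OF c] unfolding xy E iL by simp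
      then have "restr a b s = [a, b, a]" using restr_2_1[OF \<open>a \<noteq> b\<close> 2] \<open>a \<noteq> b\<close> by auto
      moreover have "restr a b R = replicate (occ R b) b" using oR[of a] 2 by (intro restr_replicate') simp
      moreover have "occ R b = 1" using oR[of b] 2 by simp
      ultimately show ?thesis using \<open>a \<noteq> b\<close> by (simp add: cross_def)
    next
      case 3
      have "restr (Inl a) (Inl b) (lmap (through s) s) = replicate (occ (lmap (through s) s) (Inl a)) (Inl a)"
        using occT0 nInl 3 by (intro restr_replicate) blast
      also have "\<dots> = [Inl a]" using occT[of a] thr_Inl[of a] 3 by simp
      finally have "map ?l (restr a b s) @ [Inl a] = [Inl a, Inl b, Inl a, Inl b] \<or> map ?l (restr a b s) @ [Inl a] = [Inl b, Inl a, Inl b, Inl a]"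
        using crossD(2)[OF c] unfolding xy E iL by simp
      then have "restr a b s = [b, a, b]"
        using restr_2_1[OF \<open>a \<noteq> b\<close>[symmetric] 3(2,1)] \<open>a \<noteq> b\<close> unfolding restr_commute[of b a] by auto
      moreover have "restr a b R = replicate (occ R a) a" using oR[of b] 3 by (intro restr_replicate) simp
      moreover have "occ R a = 1" using oR[of a] 3 by simp
      ultimately show ?thesis using \<open>a \<noteq> b\<close> by (simp add: cross_def)
    next
      case 4
      have "restr (Inl a) (Inl b) (lmap (through s) s) = map Inl (restr a b s)"
        using iT[of a b] thr_Inl[of a] thr_Inl[of b] restr_1_1[OF \<open>a \<noteq> b\<close> 4] 4 by auto
      then show ?thesis using crossD(2)[OF c] restr_1_1[OF \<open>a \<noteq> b\<close> 4] \<open>a \<noteq> b\<close> unfolding xy E iL by auto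
    qed
  qed
  \<comment> \<open>\<open>b\<close> lives in the second copy alone. If both ends of
    \<open>a\<close> were in the first copy, they would precede both ends of \<open>b\<close>; so
    \<open>a\<close> runs through.\<close>
  have LR: "cross (s @ R) a b"
    if "restr (Inl a) (Inr b) (dbl s) = [Inl a, Inr b, Inl a, Inr b] \<or> restr (Inl a) (Inr b) (dbl s) = [Inr b, Inl a, Inr b, Inl a]"
    and occab: "occ (dbl s) (Inl a) = 2" "occ (dbl s) (Inr b) = 2" for a b
  proof -
    have ob: "occ s b = 2"
      using occab(2) occT0[of "Inr b"] nInr[of b] unfolding occE occL by fastforce
    have rL: "restr (Inl a) (Inr b) (lmap Inl s) = replicate (occ s a) (Inl a)"
      using occL by (simp add: restr_replicate)
    show ?thesis
    proof (cases "occ s a = 2")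
      case True
      have "restr (Inl a) (Inr b) (lmap (through s) s) = replicate (occ (lmap (through s) s) (Inr b)) (Inr b)"
        using occT0 nInl True by (intro restr_replicate') blast
      then show ?thesis using that(1) True unfolding E rL by (auto simp: numeral_2_eq_2)
    next
      case False
      then have oa: "occ s a = 1"
        using occab(1) occT[of a] thr_Inl[of a] unfolding occE occL by simp
      then have "a \<noteq> b" using ob by auto
      have "restr (Inl a) (Inr b) (lmap (through s) s) = map (through s) (restr a b s)"
        using iT[of a b] thr_Inl[OF False] thr_Inr[OF ob] by simp
      then have "Inl a # rev (map (through s) (restr a b s)) = [Inl a, Inr b, Inl a, Inr b]"
        using that(1) unfolding E rL oa by auto
      then have "restr a b s = [b, a, b]"
        using restr_2_1[OF \<open>a \<noteq> b\<close>[symmetric] ob oa] thr_Inl[OF False] thr_Inr[OF ob]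
        unfolding restr_commute[of b a] by auto
      moreover have "restr a b R = replicate (occ R a) a" using oR[of b] ob by (intro restr_replicate) simp
      moreover have "occ R a = 1" using oR[of a] oa by simp
      ultimately show ?thesis using \<open>a \<noteq> b\<close> by (simp add: cross_def)
    qed
  qed
  have RR: "cross (s @ R) a b" if xy: "x = Inr a" "y = Inr b" for a b
  proof -
    have "a \<noteq> b" using crossD(1)[OF c] xy by simp
    have o: "occ s a = 2" "occ s b = 2"
      using two occT0[of "Inr a"] occT0[of "Inr b"] nInr[of a] nInr[of b] unfolding xy occE occL by fastforce+
    have "restr (Inr a) (Inr b) (lmap Inl s) = []" using occL by (intro restr_none) blast+
    moreover have "restr (Inr a) (Inr b) (lmap (through s) s) = map (through s) (restr a b s)"
      using iT[of a b] thr_Inr o by simp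
    ultimately have "rev (map (through s) (restr a b s)) = map (through s) [a, b, a, b] \<or>
        rev (map (through s) (restr a b s)) = map (through s) [b, a, b, a]"
      using crossD(2)[OF c] thr_Inr o unfolding xy E by simp
    then have "map (through s) (restr a b s) = map (through s) [b, a, b, a] \<or>
       map (through s) (restr a b s) = map (through s) [a, b, a, b]"
      by (simp only: rev_swap) auto
    then have "restr a b s = [b, a, b, a] \<or> restr a b s = [a, b, a, b]"
      using inj_map_eq_map[OF inj_through] by blast
    moreover have "restr a b R = []" using oR[of a] oR[of b] o by (intro restr_none) simp_all
    ultimately show ?thesis using \<open>a \<noteq> b\<close> by (auto simp: cross_def)
  qed
  obtain a b where "(x = Inl a \<and> y = Inl b) \<or> (x = Inl a \<and> y = Inr b) \<or> (x = Inr a \<and> y = Inl b) \<or> (x = Inr a \<and> y = Inr b)"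
    by (cases x; cases y) auto
  then consider "x = Inl a" "y = Inl b" | "x = Inl a" "y = Inr b" | "x = Inr a" "y = Inl b" | "x = Inr a" "y = Inr b"
    by blast
  then show ?thesis
  proof cases
    case 1
    then show ?thesis using LL by simp
  next
    case 2
    then show ?thesis using LR[of a b] crossD(2)[OF c] two by simp
  next
    case 3
    have "cross (s @ R) b a"
      using LR[of b a] crossD(2)[OF c] two restr_commute[of "Inl b" "Inr a"] unfolding 3 by auto
    then show ?thesis unfolding 3 by (simp add: cross_commute)
  next
    case 4
    then show ?thesis using RR by simp
  qed
qed

lemma legal_dbl:
  assumes g: "gauss (s @ R)" and p: "path lv k s k" and ok: "okay D lv (s @ R)"
  shows "legal D (dbl s)"
proof -
  let ?lv = "\<lambda>e. lv (case_sum id id e)"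
  have "path ?lv k (lmap Inl s) k" using p by (simp add: path_lmap)
  moreover have "path (\<lambda>a. ?lv (through s a)) k s k"
    using p by (rule iffD1[OF path_cong, rotated]) (simp add: through_def)
  then have "path ?lv k (mirror (lmap (through s) s)) k"
    by (simp only: path_mirror path_lmap)
  ultimately have "path ?lv k (dbl s) k" unfolding dbl_def path_append by blast
  moreover have "okay D ?lv (dbl s)"
  proof (rule okayI)
    fix x y assume "cross (dbl s) x y"
    from okayD[OF ok cross_dbl[OF g this]]
    show "nat \<bar>?lv x - ?lv y\<bar> \<notin> D" .
  qed
  ultimately show ?thesis using gauss_dbl[OF g] unfolding legal_def by blast
qed

subsection \<open>The congruence of a category\<close>

text \<open>A word stands for an element of the free group on its labels, with \<open>(a, Wh)\<close> for \<open>a\<close> and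
  \<open>(a, Bl)\<close> for its inverse.  Labels may be identified arbitrarily, so that the words related to
  \<open>[]\<close> form a normal subgroup invariant under all substitutions of labels for labels.\<close>

definition eqv :: "part set \<Rightarrow> 'a word \<Rightarrow> 'a word \<Rightarrow> bool" where
  "eqv G U L \<longleftrightarrow> (\<exists>(U0 :: nat word) (L0 :: nat word) \<phi>. gauss (L0 @ mirror U0) \<and> gp U0 L0 \<in> gen_cat G \<and>
    U = lmap \<phi> U0 \<and> L = lmap \<phi> L0)"

lemma labels_cyc: "labels U \<subseteq> labels (cyc U L)" "labels L \<subseteq> labels (cyc U L)"
  by (simp_all add: image_Un)

text \<open>\<open>eqv\<close> is defined with \<open>nat\<close> labels because a definition cannot
  quantify over types. An injection of the finite label set into the numbers makes every label type
  available.\<close>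

lemma eqv_gp:
  fixes U0 L0 :: "'b word" and \<phi> :: "'b \<Rightarrow> 'a"
  assumes g: "gauss (L0 @ mirror U0)" and G: "gp U0 L0 \<in> gen_cat G"
  shows "eqv G (lmap \<phi> U0) (lmap \<phi> L0)"
proof -
  let ?S = "labels (L0 @ mirror U0)"
  have "finite ?S" by simp
  from finite_imp_inj_to_nat_seg[OF this] obtain f :: "'b \<Rightarrow> nat" where f: "inj_on f ?S" by blast
  have "gauss (lmap f (L0 @ mirror U0))" using g gauss_lmap_inj[OF f] by blast
  then have 1: "gauss (lmap f L0 @ mirror (lmap f U0))" by simp
  have 2: "gp (lmap f U0) (lmap f L0) \<in> gen_cat G" using gp_inj[OF f] G by simp
  have inv: "(\<phi> \<circ> inv_into ?S f) (f a) = \<phi> a" if "a \<in> ?S" for a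
    using inv_into_f_f[OF f that] by simp
  have 3: "lmap \<phi> U0 = lmap (\<phi> \<circ> inv_into ?S f) (lmap f U0)"
    unfolding lmap_lmap
  proof (rule lmap_cong)
    fix a assume "a \<in> labels U0"
    then have "a \<in> ?S" using labels_cyc(1)[of U0 L0] by blast
    then show "\<phi> a = (\<phi> \<circ> inv_into ?S f \<circ> f) a" using inv by simp
  qed
  have 4: "lmap \<phi> L0 = lmap (\<phi> \<circ> inv_into ?S f) (lmap f L0)"
    unfolding lmap_lmap
  proof (rule lmap_cong)
    fix a assume "a \<in> labels L0"
    then have "a \<in> ?S" using labels_cyc(2)[of L0 U0] by blast
    then show "\<phi> a = (\<phi> \<circ> inv_into ?S f \<circ> f) a" using inv by simp
  qed
  show ?thesis unfolding eqv_def using 1 2 3 4 by blast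
qed

lemma eqv_gp': "gauss (L0 @ mirror U0) \<Longrightarrow> gp U0 L0 \<in> gen_cat G \<Longrightarrow> eqv G U0 L0"
  using eqv_gp[of L0 U0 G id] by simp

lemma eqv_lmap:
  assumes "eqv G U L"
  shows "eqv G (lmap f U) (lmap f L)"
proof -
  obtain U0 L0 :: "nat word" and \<phi> where "gauss (L0 @ mirror U0)" "gp U0 L0 \<in> gen_cat G"
    "U = lmap \<phi> U0" "L = lmap \<phi> L0" using assms unfolding eqv_def by blast
  then show ?thesis using eqv_gp[of L0 U0 G "f \<circ> \<phi>"] by simp
qed

lemma eqv_sym: "eqv G U L \<Longrightarrow> eqv G L U"
proof -
  assume "eqv G U L"
  then obtain U0 L0 :: "nat word" and \<phi> where *: "gauss (L0 @ mirror U0)" "gp U0 L0 \<in> gen_cat G"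
    "U = lmap \<phi> U0" "L = lmap \<phi> L0" unfolding eqv_def by blast
  have "gauss (U0 @ mirror L0)" using *(1) gauss_mirror[of "L0 @ mirror U0"] by simp
  moreover have "gp L0 U0 \<in> gen_cat G" using gen_cat.invol[OF *(2)] by (simp only: invol_gp)
  ultimately show ?thesis using *(3,4) eqv_gp by blast
qed

lemma eqv_append:
  fixes U L U' L' :: "'a word"
  assumes "eqv G U L" "eqv G U' L'"
  shows "eqv G (U @ U') (L @ L')"
proof -
  obtain U0 L0 :: "nat word" and \<phi> where 1: "gauss (L0 @ mirror U0)" "gp U0 L0 \<in> gen_cat G"
    "U = lmap \<phi> U0" "L = lmap \<phi> L0" using assms(1) unfolding eqv_def by blast
  obtain U1 L1 :: "nat word" and \<phi>' where 2: "gauss (L1 @ mirror U1)" "gp U1 L1 \<in> gen_cat G"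
    "U' = lmap \<phi>' U1" "L' = lmap \<phi>' L1" using assms(2) unfolding eqv_def by blast
  let ?l = "Inl :: nat \<Rightarrow> nat + nat" and ?r = "Inr :: nat \<Rightarrow> nat + nat"
  have 3: "gp (lmap ?l U0) (lmap ?l L0) = gp U0 L0" "gp (lmap ?r U1) (lmap ?r L1) = gp U1 L1"
    by (rule gp_inj, simp)+
  have dj: "labels (lmap ?l L0 @ mirror (lmap ?l U0)) \<inter> labels (lmap ?r L1 @ mirror (lmap ?r U1)) = {}"
    using disjoint_sum[of "L0 @ mirror U0" "L1 @ mirror U1"] by (simp only: lmap_simps)
  have "gp (lmap ?l U0 @ lmap ?r U1) (lmap ?l L0 @ lmap ?r L1) \<in> gen_cat G"
    using gen_cat.tens[OF 1(2) 2(2)] tens_gp[OF dj] unfolding 3 by simp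
  moreover have "gauss ((lmap ?l L0 @ lmap ?r L1) @ mirror (lmap ?l U0 @ lmap ?r U1))"
  proof -
    have "gauss (lmap ?l (L0 @ mirror U0) @ lmap ?r (L1 @ mirror U1))"
      by (intro gauss_append disjoint_sum) (use 1(1) 2(1) in \<open>simp_all add: gauss_lmap_inj del: lmap_simps\<close>)
    then show ?thesis by (subst gauss_cong) (auto simp: add_ac)
  qed
  ultimately have "eqv G (lmap (case_sum \<phi> \<phi>') (lmap ?l U0 @ lmap ?r U1)) (lmap (case_sum \<phi> \<phi>') (lmap ?l L0 @ lmap ?r L1))"
    by (intro eqv_gp)
  then show ?thesis unfolding 1(3,4) 2(3,4) by (simp only: lmap_simps lmap_lmap case_sum_o_inj)
qed

text \<open>Composition of partitions. The two labellings agree on the middle row, and contraction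
  identifies only labels with equal images, so together they induce a labelling of the
  composite.\<close>

lemma eqv_trans [trans]:
  fixes U K L :: "'a word"
  assumes "eqv G U K" "eqv G K L"
  shows "eqv G U L"
proof -
  obtain U0 M1 :: "nat word" and \<phi> where 1: "gauss (M1 @ mirror U0)" "gp U0 M1 \<in> gen_cat G"
    "U = lmap \<phi> U0" "K = lmap \<phi> M1" using assms(1) unfolding eqv_def by blast
  obtain M2 L0 :: "nat word" and \<phi>' where 2: "gauss (L0 @ mirror M2)" "gp M2 L0 \<in> gen_cat G"
    "K = lmap \<phi>' M2" "L = lmap \<phi>' L0" using assms(2) unfolding eqv_def by blast
  have e: "lmap \<phi> M1 = lmap \<phi>' M2" using 1(4) 2(3) by simp
  have z: "gauss (lmap Inl (L0 @ mirror M2) @ lmap Inr (M1 @ mirror U0))"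
    by (intro gauss_append disjoint_sum) (use 1(1) 2(1) in \<open>simp_all add: gauss_lmap_inj del: lmap_simps\<close>)
  obtain f1 f2 :: "nat \<Rightarrow> nat + nat" where m: "lmap f1 M1 = lmap f2 M2"
    and l: "gauss (lmap f2 L0 @ mirror (lmap f1 U0))"
    and \<phi>: "case_sum \<phi>' \<phi> \<circ> f1 = \<phi>" "case_sum \<phi>' \<phi> \<circ> f2 = \<phi>'"
    by (rule contract_composite[where Q = gauss, OF _ z e]) (erule gauss_contract, rule that)
  have "comp (gp M2 L0) (gp U0 M1) \<in> gen_cat G"
    by (rule gen_cat.comp[OF 2(2) 1(2)]) (simp only: gp_simps lmap_snd[OF e])
  then have "gp (lmap f1 U0) (lmap f2 L0) \<in> gen_cat G"
    by (simp only: comp_gp[OF 1(1) 2(1) m l])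
  from eqv_gp[OF l this, of "case_sum \<phi>' \<phi>"] show ?thesis
    unfolding 1(3) 2(4) lmap_lmap \<phi> .
qed

lemma eqv_cup: "eqv G [] [(a, c), (a, opp c)]"
proof -
  have g: "gauss ([(a, c), (a, opp c)] @ mirror [])" using legal_gauss[OF legal_pair[of "{}" a c]] by simp
  have "gp [] [(a, c), (a, opp c)] \<in> gen_cat G"
    using gen_cat.pairWB[of G] gen_cat.pairBW[of G] gp_pair[of c "opp c" a] by (cases c) simp_all
  from eqv_gp'[OF g this] show ?thesis .
qed

lemma eqv_Nil: "eqv G ([] :: 'a word) []"
proof -
  have "eqv G ([] :: 'a word) [(undefined, Wh), (undefined, opp Wh)]" by (rule eqv_cup)
  then show ?thesis using eqv_trans eqv_sym by blast
qed

lemma eqv_refl: "eqv G w w"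
proof (induction w)
  case (Cons x w)
  obtain a c where x: "x = (a, c)" by (cases x)
  have g: "gauss ([(a, c)] @ mirror [(a, c)])" using legal_gauss[OF legal_pair[of "{}" a c]] by simp
  have "gp [(a, c)] [(a, c)] \<in> gen_cat G" unfolding gp_idp[symmetric] by (rule gen_cat.idp)
  from eqv_append[OF eqv_gp'[OF g this] Cons] show ?case by (simp add: x)
qed (rule eqv_Nil)

lemma eqv_context: "eqv G u v \<Longrightarrow> eqv G (A @ u @ B) (A @ v @ B)"
  by (intro eqv_append eqv_refl)

lemma eqv_cancel_letters: "eqv G (A @ (a, c) # (a, opp c) # B) (A @ B)"
  using eqv_context[OF eqv_sym[OF eqv_cup], of G A a c B] by simp

lemma eqv_inverse: "eqv G (w @ mirror w) []"
proof (induction w)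
  case (Cons x w)
  have "eqv G ([x] @ (w @ mirror w) @ [(fst x, opp (snd x))]) ([x] @ [] @ [(fst x, opp (snd x))])"
    by (rule eqv_context[OF Cons])
  also have "eqv G ([x] @ [] @ [(fst x, opp (snd x))]) []"
    using eqv_cancel_letters[of G "[]" "fst x" "snd x" "[]"] by simp
  finally show ?case by simp
qed (simp add: eqv_Nil)

lemma eqv_cancel: "eqv G (A @ w @ mirror w @ B) (A @ B)" "eqv G (A @ mirror w @ w @ B) (A @ B)"
  using eqv_context[OF eqv_inverse, of G A w B] eqv_context[OF eqv_inverse, of G A "mirror w" B]
  by simp_all

lemma eqv_rotate:
  assumes "eqv G [] (A @ B)"
  shows "eqv G [] (B @ A)"
proof -
  have "eqv G [] (B @ mirror B)" by (rule eqv_sym[OF eqv_inverse])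
  also have "eqv G (B @ mirror B) (B @ (A @ B) @ mirror B)"
    using eqv_context[OF assms, of B "mirror B"] by simp
  also have "eqv G (B @ (A @ B) @ mirror B) (B @ A)"
    using eqv_cancel(1)[of G "B @ A" B "[]"] by simp
  finally show ?thesis .
qed

lemma eqv_of_quotient:
  assumes "eqv G [] (u @ mirror v)"
  shows "eqv G v u"
proof -
  have "eqv G v ((u @ mirror v) @ v)" using eqv_append[OF assms eqv_refl[of G v]] by simp
  also have "eqv G ((u @ mirror v) @ v) u" using eqv_cancel(2)[of G u v "[]"] by simp
  finally show ?thesis .
qed

lemma occ_lmap_merge: "a \<noteq> b \<Longrightarrow> f a = f b \<Longrightarrow> occ z a + occ z b \<le> occ (lmap f z) (f b)"
  by (induction z) auto

text \<open>The way back from words to partitions. If the substitution merged two labels, the merged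
  label would occur four times, against the Gauss property of the result; so the substitution is
  injective and does not change the partition.\<close>

lemma eqv_imp_gen_cat:
  assumes "eqv G U L" and g: "gauss (cyc U L)"
  shows "gp U L \<in> gen_cat G"
proof -
  obtain U0 L0 :: "nat word" and \<phi> where *: "gauss (L0 @ mirror U0)" "gp U0 L0 \<in> gen_cat G"
    "U = lmap \<phi> U0" "L = lmap \<phi> L0" using assms(1) unfolding eqv_def by blast
  let ?z = "L0 @ mirror U0"
  have z: "L @ mirror U = lmap \<phi> ?z" using * by simp
  have "inj_on \<phi> (labels ?z)"
  proof (rule inj_onI, rule ccontr)
    fix a b assume ab: "a \<in> labels ?z" "b \<in> labels ?z" "\<phi> a = \<phi> b" "a \<noteq> b"
    have "occ ?z a + occ ?z b = 4" using gauss_occ[OF *(1)] ab(1,2) by simp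
    then show False
      using occ_lmap_merge[OF ab(4,3), of ?z] gauss_occ_cases[OF g, of "\<phi> b"] unfolding z by linarith
  qed
  then show ?thesis using gp_inj[of \<phi> L0 U0] *(2) unfolding *(3,4) by simp
qed

subsection \<open>Consequences of the bracket relations\<close>

text \<open>\<open>a\<close> labels lines and \<open>c\<close> labels arcs. Level \<open>0\<close>
  counts with \<open>D\<close> because a bracket set never contains \<open>0\<close>, so that level
  always carries lines.\<close>

definition lw :: "nat set \<Rightarrow> (nat \<Rightarrow> 'a) \<Rightarrow> (nat \<Rightarrow> 'a) \<Rightarrow> nat \<Rightarrow> 'a" where
  "lw D a c i = (if i = 0 \<or> i \<in> D then a i else c i)"

definition Pw :: "nat set \<Rightarrow> (nat \<Rightarrow> 'a) \<Rightarrow> (nat \<Rightarrow> 'a) \<Rightarrow> nat \<Rightarrow> 'a word" where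
  "Pw D a c k = map (\<lambda>i. (lw D a c i, Wh)) [0..<k]"

lemma Pw_Suc: "Pw D a c (Suc k) = Pw D a c k @ [(lw D a c k, Wh)]"
  by (simp add: Pw_def)

lemma Pw_cong: "(\<And>i. i < k \<Longrightarrow> c i = d i) \<Longrightarrow> Pw D a c k = Pw D a d k"
  by (simp add: Pw_def lw_def)

text \<open>The relation given by \<open>Br\<close>, with the black and the white halves of its rows on different sides:
  \<open>a'\<close> and \<open>a\<close> label the vertical lines on the black and the white side, \<open>c\<close> and \<open>d\<close> the upper and
  the lower arcs.\<close>

definition bracket_rel :: "part set \<Rightarrow> nat set \<Rightarrow> bool" where
  "bracket_rel G D \<longleftrightarrow> (\<forall>k. \<forall>(a :: nat \<Rightarrow> nat) a' c d.
     eqv G (Pw D a c k @ mirror (Pw D a d k)) (Pw D a' c k @ mirror (Pw D a' d k)))"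

text \<open>Solving the bracket relation for \<open>c\<close> on one side and \<open>d\<close> on
  the other: what translates between the line labels \<open>a\<close> and \<open>a'\<close> does not
  see the arcs.\<close>

lemma transition_indep:
  fixes c d :: "nat \<Rightarrow> nat"
  assumes "bracket_rel G D"
  shows "eqv G (mirror (Pw D a' c k) @ Pw D a c k) (mirror (Pw D a' d k) @ Pw D a d k)"
proof -
  let ?P = "Pw D a c k" and ?Q = "Pw D a d k" and ?P' = "Pw D a' c k" and ?Q' = "Pw D a' d k"
  have "eqv G (mirror ?P' @ ?P) ((mirror ?P' @ ?P) @ mirror ?Q @ ?Q @ [])"
    using eqv_sym[OF eqv_cancel(2)[of G "mirror ?P' @ ?P" ?Q "[]"]] by simp
  also have "eqv G ((mirror ?P' @ ?P) @ mirror ?Q @ ?Q @ []) (mirror ?P' @ (?P' @ mirror ?Q') @ ?Q)"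
    using eqv_context[of G "?P @ mirror ?Q" "?P' @ mirror ?Q'" "mirror ?P'" ?Q] assms
    unfolding bracket_rel_def by simp
  also have "eqv G (mirror ?P' @ (?P' @ mirror ?Q') @ ?Q) (mirror ?Q' @ ?Q)"
    using eqv_cancel(2)[of G "[]" ?P' "mirror ?Q' @ ?Q"] by simp
  finally show ?thesis .
qed

text \<open>With \<open>g k = mirror (Pw D a' c k) @ Pw D a c k\<close>, which does not depend on \<open>c\<close>, every letter
  \<open>x\<close> leading from height \<open>k\<close> to height \<open>l\<close> satisfies \<open>g k x = x' g l\<close>.\<close>

lemma transition_letter:
  fixes c :: "nat \<Rightarrow> nat"
  assumes G: "bracket_rel G D"
    and e: "if k = 0 \<or> k \<in> D then e = a k \<and> e' = a' k else e = e'"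
  shows "eqv G ((mirror (Pw D a' c k) @ Pw D a c k) @ [(e, Wh)]) ((e', Wh) # mirror (Pw D a' c (Suc k)) @ Pw D a c (Suc k))"
    and "eqv G ((mirror (Pw D a' c (Suc k)) @ Pw D a c (Suc k)) @ [(e, Bl)]) ((e', Bl) # mirror (Pw D a' c k) @ Pw D a c k)"
proof -
  \<comment> \<open>Since the arc labels may be altered freely, level \<open>k\<close> is given the
    letter \<open>e\<close> itself. Then one further letter of the word extends the two ascending
    words from \<open>k\<close> to \<open>Suc k\<close>.\<close>
  define d where "d = c(k := e)"
  have P: "Pw D b d k = Pw D b c k" for b by (rule Pw_cong) (simp add: d_def)
  have "lw D a d k = e" "lw D a' d k = e'" using e by (auto simp: lw_def d_def split: if_splits)
  then have S: "Pw D a d (Suc k) = Pw D a c k @ [(e, Wh)]" "Pw D a' d (Suc k) = Pw D a' c k @ [(e', Wh)]"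
    by (simp_all add: Pw_Suc P)
  let ?g = "mirror (Pw D a' c k) @ Pw D a c k"
  have i: "eqv G (mirror (Pw D a' c (Suc k)) @ Pw D a c (Suc k)) ((e', Bl) # ?g @ [(e, Wh)])"
    using transition_indep[OF G, of a' c "Suc k" a d] unfolding S by simp
  have "eqv G (?g @ [(e, Wh)]) ((e', Wh) # (e', Bl) # ?g @ [(e, Wh)])"
    using eqv_sym[OF eqv_cancel_letters[of G "[]" e' Wh "?g @ [(e, Wh)]"]] by simp
  also have "eqv G ((e', Wh) # (e', Bl) # ?g @ [(e, Wh)]) ((e', Wh) # mirror (Pw D a' c (Suc k)) @ Pw D a c (Suc k))"
    using eqv_context[OF eqv_sym[OF i], of "[(e', Wh)]" "[]"] by simp
  finally show "eqv G (?g @ [(e, Wh)]) ((e', Wh) # mirror (Pw D a' c (Suc k)) @ Pw D a c (Suc k))" .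
  have "eqv G ((mirror (Pw D a' c (Suc k)) @ Pw D a c (Suc k)) @ [(e, Bl)]) (((e', Bl) # ?g) @ [(e, Wh), (e, Bl)])"
    using eqv_context[OF i, of "[]" "[(e, Bl)]"] by simp
  also have "eqv G (((e', Bl) # ?g) @ [(e, Wh), (e, Bl)]) ((e', Bl) # ?g)"
    using eqv_cancel_letters[of G "(e', Bl) # ?g" e Wh "[]"] by simp
  finally show "eqv G ((mirror (Pw D a' c (Suc k)) @ Pw D a c (Suc k)) @ [(e, Bl)]) ((e', Bl) # ?g)" .
qed

text \<open>The transition element is pushed through the word letter by letter, turning
  \<open>\<rho>\<close> into \<open>\<rho>'\<close>. At height \<open>0\<close> it is empty, so for
  a closed path based there the two relabelled words become equivalent.\<close>

lemma collapse_levels: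
  fixes \<rho> \<rho>' :: "'b \<Rightarrow> nat" and c :: "nat \<Rightarrow> nat"
  assumes G: "bracket_rel G D"
    and "path lv (int j) s (int j')" "\<And>b. b \<in> labels s \<Longrightarrow> lv b \<ge> 0"
    and "\<And>b. b \<in> labels s \<Longrightarrow>
      if lv b = 0 \<or> nat (lv b) \<in> D then \<rho> b = a (nat (lv b)) \<and> \<rho>' b = a' (nat (lv b)) else \<rho> b = \<rho>' b"
  shows "eqv G ((mirror (Pw D a' c j) @ Pw D a c j) @ lmap \<rho> s) (lmap \<rho>' s @ (mirror (Pw D a' c j') @ Pw D a c j'))"
  using assms(2-)
proof (induction s arbitrary: j)
  case Nil
  then show ?case by (simp add: eqv_refl)
next
  case (Cons x s)
  let ?g = "\<lambda>k. mirror (Pw D a' c k) @ Pw D a c k"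
  obtain b col where x: "x = (b, col)" by (cases x)
  have lb: "lv b \<ge> 0" using Cons.prems(2)[of b] x by simp
  have r: "if lv b = 0 \<or> nat (lv b) \<in> D then \<rho> b = a (nat (lv b)) \<and> \<rho>' b = a' (nat (lv b)) else \<rho> b = \<rho>' b"
    using Cons.prems(3)[of b] x by simp
  have step: "eqv G (?g j @ lmap \<rho> (x # s)) (lmap \<rho>' (x # s) @ ?g j')"
    if l: "eqv G (?g j @ [(\<rho> b, col)]) ((\<rho>' b, col) # ?g i)" and p: "path lv (int i) s (int j')" for i
  proof -
    have "eqv G (?g i @ lmap \<rho> s) (lmap \<rho>' s @ ?g j')"
      using Cons.IH[OF p] Cons.prems(2,3) by simp
    from eqv_context[OF this, of "[(\<rho>' b, col)]" "[]"]
    have 2: "eqv G ((\<rho>' b, col) # ?g i @ lmap \<rho> s) ((\<rho>' b, col) # lmap \<rho>' s @ ?g j')" by simp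
    have "eqv G (?g j @ lmap \<rho> (x # s)) ((\<rho>' b, col) # ?g i @ lmap \<rho> s)"
      using eqv_context[OF l, of "[]" "lmap \<rho> s"] by (simp add: x)
    also note 2
    finally show ?thesis by (simp add: x)
  qed
  show ?case
  proof (cases col)
    case Wh
    then have p: "lv b = int j" "path lv (int (Suc j)) s (int j')"
      using Cons.prems(1) x by (simp_all add: add.commute)
    show ?thesis
      by (rule step[OF _ p(2)]) (use transition_letter(1)[OF G, of j "\<rho> b" a "\<rho>' b" a' c] r p(1) Wh in simp)
  next
    case Bl
    then have p: "lv b = int j - 1" "path lv (int j - 1) s (int j')" using Cons.prems(1) x by simp_all
    \<comment> \<open>A black step from height \<open>0\<close> would have level \<open>-1\<close>;
      nonnegative levels exclude it.\<close>
    then obtain i where i: "j = Suc i" using lb by (cases j) simp_all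
    have p': "lv b = int i" "path lv (int i) s (int j')" using p i by simp_all
    show ?thesis
      by (rule step[OF _ p'(2)]) (use transition_letter(2)[OF G, of i "\<rho> b" a "\<rho>' b" a' c] r p'(1) Bl i in simp)
  qed
qed

text \<open>The strings inside \<open>s\<close> whose level lies in \<open>D\<close> are first cut and afterwards restored
  by means of the doubled word.\<close>

lemma exchange_arc:
  fixes s :: "nat word" and x u :: nat
  assumes G: "bracket_rel G D"
    and dbl: "eqv G [] (dbl s)" and p: "path lv 1 s 1"
    and lv: "\<And>a. a \<in> labels s \<Longrightarrow> lv a \<ge> 1"
    and thr: "\<And>a. a \<in> labels s \<Longrightarrow> occ s a \<noteq> 2 \<Longrightarrow> nat (lv a) \<notin> D"
  shows "eqv G ((x, Wh) # s @ [(x, Bl)]) ((u, Wh) # s @ [(u, Bl)])"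
proof -
  \<comment> \<open>Cutting: all strings with level in \<open>D\<close> get the dummy label
    \<open>0\<close>, as \<open>collapse_levels\<close> requires one label per such level. Strings
    leaving \<open>s\<close> are untouched by \<open>thr\<close>, so the doubled word specializes to
    the quotient of \<open>s\<close> by its cut version.\<close>
  define r where "r a = (if nat (lv a) \<in> D then 0 else a)" for a
  have "lmap (case_sum id r) (dbl s) = s @ mirror (lmap r s)"
  proof -
    have "lmap (case_sum id r) (lmap Inl s) = s" by (simp only: lmap_lmap case_sum_o_inj lmap_id)
    moreover have "lmap (case_sum id r) (lmap (through s) s) = lmap r s"
      unfolding lmap_lmap by (rule lmap_cong) (use thr in \<open>auto simp: through_def r_def\<close>)
    ultimately show ?thesis unfolding dbl_def by (simp only: lmap_simps)
  qed
  then have "eqv G [] (s @ mirror (lmap r s))" using eqv_lmap[OF dbl, of "case_sum id r"] by simp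
  then have cut: "eqv G (lmap r s) s" by (rule eqv_of_quotient)
  \<comment> \<open>The outer arc gets the separate label \<open>None\<close> because
    \<open>x\<close> and \<open>u\<close> may also occur in \<open>s\<close>.\<close>
  define v where "v = (None, Wh) # lmap Some s @ [(None, Bl)]"
  define lv' where "lv' = case_option 0 lv"
  define \<rho> where "\<rho> y = case_option y r" for y :: nat
  have pv: "path lv' (int 0) v (int 0)"
    using p by (simp add: v_def lv'_def path_append path_lmap)
  have "eqv G ((mirror (Pw D (\<lambda>k. if k = 0 then u else 0) (\<lambda>_. 0) 0) @ Pw D (\<lambda>k. if k = 0 then x else 0) (\<lambda>_. 0) 0) @ lmap (\<rho> x) v)
      (lmap (\<rho> u) v @ (mirror (Pw D (\<lambda>k. if k = 0 then u else 0) (\<lambda>_. 0) 0) @ Pw D (\<lambda>k. if k = 0 then x else 0) (\<lambda>_. 0) 0))"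
  proof (rule collapse_levels[OF G pv])
    fix b assume b: "b \<in> labels v"
    then have b': "b = None \<or> (\<exists>a \<in> labels s. b = Some a)"
    proof -
      have "labels v = insert None (Some ` (labels s))"
        unfolding v_def by (simp only: list.set set_append image_insert image_Un lmap_simps image_empty fst_conv) simp
      then have "b = None \<or> b \<in> Some ` (labels s)" using b by simp
      then show ?thesis by (elim disjE imageE) blast+
    qed
    then show "lv' b \<ge> 0" using lv by (fastforce simp: lv'_def)
    show "if lv' b = 0 \<or> nat (lv' b) \<in> D
      then \<rho> x b = (if nat (lv' b) = 0 then x else 0) \<and> \<rho> u b = (if nat (lv' b) = 0 then u else 0)
      else \<rho> x b = \<rho> u b"
      using b'
    proof
      assume "\<exists>a \<in> labels s. b = Some a"
      then obtain a where a: "a \<in> labels s" "b = Some a" by blast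
      then have "lv a \<ge> 1" using lv by blast
      then show ?thesis using a(2) by (simp add: lv'_def \<rho>_def r_def)
    qed (simp add: lv'_def \<rho>_def)
  qed
  then have "eqv G (lmap (\<rho> x) v) (lmap (\<rho> u) v)" by (simp add: Pw_def)
  moreover have "lmap (\<rho> y) v = (y, Wh) # lmap r s @ [(y, Bl)]" for y
  proof -
    have "\<rho> y \<circ> Some = r" by (rule ext) (simp add: \<rho>_def)
    then have "lmap (\<rho> y) (lmap Some s) = lmap r s" by (simp only: lmap_lmap)
    moreover have "\<rho> y None = y" by (simp add: \<rho>_def)
    ultimately show ?thesis unfolding v_def by (simp only: lmap_simps fst_conv snd_conv)
  qed
  ultimately have 1: "eqv G ((x, Wh) # lmap r s @ [(x, Bl)]) ((u, Wh) # lmap r s @ [(u, Bl)])" by simp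
  have 2: "eqv G ((y, Wh) # lmap r s @ [(y, Bl)]) ((y, Wh) # s @ [(y, Bl)])" for y
    using eqv_context[OF cut, of "[(y, Wh)]" "[(y, Bl)]"] by simp
  show ?thesis using eqv_trans[OF eqv_trans[OF eqv_sym[OF 2] 1] 2] .
qed

subsection \<open>Every legal word is generated\<close>

definition good :: "nat set \<Rightarrow> ('a \<Rightarrow> int) \<Rightarrow> 'a word \<Rightarrow> bool" where
  "good D lv z \<longleftrightarrow> gauss z \<and> path lv 0 z 0 \<and> okay D lv z \<and> (\<forall>a\<in>labels z. lv a \<ge> 0)"

lemma goodD:
  assumes "good D lv z"
  shows "gauss z" "path lv 0 z 0" "okay D lv z" "\<And>a. a \<in> labels z \<Longrightarrow> lv a \<ge> 0"
  using assms unfolding good_def by blast+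

lemma good_rotate:
  assumes "good D lv (A @ B)" "path lv 0 A 0"
  shows "good D lv (B @ A)"
  using goodD[OF assms(1)] gauss_commute[of A B] okay_rotate[of D lv A B] path_rotate[OF _ assms(2), of B]
  unfolding good_def by (auto simp: image_Un)

lemma partner:
  assumes "gauss z" "(x, c) \<in> set z"
  shows "cnt z x Wh = 1" "cnt z x Bl = 1"
proof -
  have "cnt z x c \<noteq> 0" using assms(2) by (simp add: cnt_0_iff)
  then have "cnt z x c = 1" using gaussD(2)[OF assms(1), of x c] by simp
  then show "cnt z x Wh = 1" "cnt z x Bl = 1" using gaussD(1)[OF assms(1), of x] by (cases c; simp)+
qed

lemma split_cnt: "cnt z x c \<noteq> 0 \<Longrightarrow> \<exists>A B. z = A @ (x, c) # B"
  by (metis cnt_0_iff split_list)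

lemma path_stays_up:
  assumes "path lv k s i" "k \<ge> 1" "\<And>a. a \<in> labels s \<Longrightarrow> lv a \<ge> 1"
  shows "i \<ge> 1"
  using assms
proof (induction s arbitrary: k)
  case (Cons x s)
  obtain a c where x: "x = (a, c)" by (cases x)
  have a: "lv a \<ge> 1" using Cons.prems(3)[of a] x by simp
  show ?case
  proof (cases c)
    case Wh
    then show ?thesis using Cons.IH[of "k + 1"] Cons.prems x by simp
  next
    case Bl
    then show ?thesis using Cons.IH[of "k - 1"] Cons.prems x a by simp
  qed
qed simp

lemma path_starts_up:
  assumes "path lv 0 t i" "t \<noteq> []" "\<And>a. a \<in> labels t \<Longrightarrow> lv a \<ge> 0"
  obtains u t' where "t = (u, Wh) # t'" "lv u = 0" "path lv 1 t' i"
proof -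
  obtain u c t' where t: "t = (u, c) # t'" using assms(2) by (cases t) auto
  have "lv u \<ge> 0" using assms(3)[of u] t by simp
  then have "c = Wh" using assms(1) unfolding t by (cases c) simp_all
  then show thesis using that assms(1) unfolding t by simp
qed

definition shorter_generated :: "part set \<Rightarrow> nat set \<Rightarrow> nat \<Rightarrow> bool" where
  "shorter_generated G D n \<longleftrightarrow> (\<forall>z :: nat word. length z < n \<longrightarrow> legal D z \<longrightarrow> eqv G [] z)"

text \<open>The doubled word is legal and of length \<open>2 * length s\<close>, hence generated by
  the outer induction hypothesis.\<close>

lemma exchange_arc_legal:
  fixes s R :: "nat word" and x u :: nat
  assumes G: "bracket_rel G D" and IH: "shorter_generated G D n" and len: "2 * length s < n"
    and g: "gauss (s @ R)" and ok: "okay D lv (s @ R)" and p: "path lv 1 s 1"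
    and lv: "\<And>a. a \<in> labels s \<Longrightarrow> lv a \<ge> 1"
    and thr: "\<And>a. a \<in> labels s \<Longrightarrow> occ s a \<noteq> 2 \<Longrightarrow> nat (lv a) \<notin> D"
  shows "eqv G ((x, Wh) # s @ [(x, Bl)]) ((u, Wh) # s @ [(u, Bl)])"
proof (rule exchange_arc[OF G _ p lv thr])
  have l: "legal D (dbl s)" by (rule legal_dbl[OF g p ok])
  \<comment> \<open>Even and odd numbers encode the two copies, since the induction hypothesis
    speaks of \<open>nat\<close> words.\<close>
  define e :: "nat + nat \<Rightarrow> nat" where "e = case_sum (\<lambda>a. 2 * a) (\<lambda>a. 2 * a + 1)"
  have inj: "inj e"
  proof (rule injI)
    fix a b assume "e a = e b"
    then show "a = b" by (cases a; cases b) (simp_all add: e_def, presburger+)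
  qed
  have "legal D (lmap e (dbl s))"
    by (rule legal_lmap_inj[OF inj_on_subset[OF inj subset_UNIV] l])
  then have "eqv G [] (lmap e (dbl s))"
    using IH len unfolding shorter_generated_def by (simp add: length_dbl)
  from eqv_lmap[OF this, of "inv e"] show "eqv G [] (dbl s)"
    by (simp add: inv_o_cancel[OF inj])
qed assumption+

text \<open>The inner induction is on the length of the segment \<open>s\<close> below an arc \<open>x\<close> of the lowest level.
  If \<open>s\<close> reaches that level again, the next arc \<open>w\<close> starting there either has a shorter segment or
  crosses \<open>x\<close>; in the latter case exchanging the ends of \<open>x\<close> and \<open>w\<close> yields a shorter segment.  If
  \<open>s\<close> stays above, \<open>x\<close> is removed by moving \<open>s\<close> under the next arc.\<close>

lemma good_generated_aux:
  fixes s t :: "nat word"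
  assumes G: "bracket_rel G D"
    and H: "0 \<notin> D \<Longrightarrow> (\<And>x y w :: nat. eqv G [(x, Wh), (y, Bl), (w, Wh)] [(w, Wh), (y, Bl), (x, Wh)])"
    and IH: "shorter_generated G D n"
    and "good D lv ((x, Wh) # s @ (x, Bl) # t)" "length ((x, Wh) # s @ (x, Bl) # t) = n"
  shows "eqv G [] ((x, Wh) # s @ (x, Bl) # t)"
  using assms(4-)
proof (induction "length s" arbitrary: x s t rule: less_induct)
  case less
  let ?z = "(x, Wh) # s @ (x, Bl) # t"
  have g: "gauss ?z" and pz: "path lv 0 ?z 0" and ok: "okay D lv ?z"
    and pos: "\<And>a. a \<in> labels ?z \<Longrightarrow> lv a \<ge> 0"
    using goodD[OF less.prems(1)] by blast+
  have small: "eqv G [] z" if "length z < n" "legal D z" for z :: "nat word"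
    using IH that unfolding shorter_generated_def by blast
  have x0: "lv x = 0" and "path lv 1 (s @ (x, Bl) # t) 0" using pz by simp_all
  then obtain i where i: "path lv 1 s i" "path lv i ((x, Bl) # t) 0" unfolding path_append by blast
  have "i = 1" using i(2) x0 by simp
  then have ps: "path lv 1 s 1" and pt: "path lv 0 t 0" using i x0 by simp_all
  have "occ ?z x = 2" by (rule gauss_occ[OF g]) simp
  then have xs: "occ s x = 0" and xt: "occ t x = 0" by simp_all
  have two: "occ ?z a = 2" if "a \<in> labels s \<or> a \<in> labels t" for a
    by (rule gauss_occ[OF g]) (use that in \<open>auto simp: image_Un\<close>)
  \<comment> \<open>Any other arc of level \<open>0\<close> with a shorter segment may be rotated to
    the front and handed to the inner induction.\<close>
  have rot: "eqv G [] ?z"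
    if "?z = P @ (w, Wh) # s' @ (w, Bl) # t'" "path lv 0 P 0" "length s' < length s" for P w s' t'
  proof -
    have "good D lv ((w, Wh) # s' @ (w, Bl) # (t' @ P))"
      using good_rotate[of D lv P "(w, Wh) # s' @ (w, Bl) # t'"] less.prems(1) that by simp
    moreover have "length ((w, Wh) # s' @ (w, Bl) # (t' @ P)) = n"
      using less.prems(2) unfolding that(1) by simp
    ultimately have "eqv G [] ((w, Wh) # s' @ (w, Bl) # (t' @ P))" using less.hyps that(3) by blast
    then show ?thesis using eqv_rotate[of G "(w, Wh) # s' @ (w, Bl) # t'" P] unfolding that(1) by simp
  qed
  show ?case
  proof (cases "\<forall>a\<in>labels s. lv a \<noteq> 0")
    case True
    have lv1: "lv a \<ge> 1" if "a \<in> labels s" for a using True pos[of a] that by force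
    show ?thesis
    proof (cases "t = []")
      \<comment> \<open>Here \<open>x\<close> encloses the whole word, and conjugation by it reduces
        the claim to \<open>s\<close>.\<close>
      case t: True
      have ax: "x \<noteq> a" if "a \<in> labels s" for a using True that x0 by blast
      have "gauss s"
      proof (rule gauss_sub[OF g])
        fix e show "(\<forall>c. cnt s e c = cnt ?z e c) \<or> (\<forall>c. cnt s e c = 0)"
          using xs t by (cases "e = x") (simp_all add: cnt_0_of_occ)
      qed
      moreover have "okay D lv s"
        by (rule okay_sub[OF ok]) (use ax t in simp)
      ultimately have "legal D s" using ps unfolding legal_def by blast
      then have "eqv G [] s" using small less.prems(2) by simp
      from eqv_context[OF this, of "[(x, Wh)]" "[(x, Bl)]"]
      have "eqv G [(x, Wh), (x, Bl)] ?z" using t by simp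
      with eqv_cup[of G x Wh] show ?thesis using eqv_trans by simp
    next
      case False
      have "lv a \<ge> 0" if "a \<in> labels t" for a using pos[of a] that by (simp add: image_Un)
      then obtain u t' where t: "t = (u, Wh) # t'" and u0: "lv u = 0" and pt': "path lv 1 t' 0"
        using path_starts_up[OF pt False] by metis
      have ux: "u \<noteq> x" using xt unfolding t by auto
      have "u \<notin> labels s" using True u0 by blast
      then have us: "occ s u = 0" unfolding occ_0_iff .
      have "(u, Wh) \<in> set ?z" by (simp add: t)
      then have "cnt ?z u Bl = 1" by (rule partner(2)[OF g])
      then have "cnt t' u Bl \<noteq> 0" using ux cnt_0_of_occ[OF us, of Bl] unfolding t by simp
      from split_cnt[OF this] obtain t1 t2 where t': "t' = t1 @ (u, Bl) # t2" by blast
      \<comment> \<open>The segments under the neighbouring arcs \<open>x\<close> and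
        \<open>u\<close> are compared. If \<open>s\<close> is not the longer one, then
        \<open>2 * length s < n\<close>, as the exchange of \<open>x\<close> against
        \<open>u\<close> over \<open>s\<close> requires.\<close>
      show ?thesis
      proof (cases "length t1 < length s")
        case shorter: True
        show ?thesis
          by (rule rot[of "(x, Wh) # s @ [(x, Bl)]" u t1 t2])
            (use ps x0 shorter in \<open>simp_all add: t t' path_append\<close>)
      next
        case longer: False
        let ?R = "(x, Bl) # t @ [(x, Wh)]"
        have gR: "gauss (s @ ?R)" using g gauss_commute[of "[(x, Wh)]" "s @ (x, Bl) # t"] by simp
        have okR: "okay D lv (s @ ?R)" using okay_rotate[of D lv "[(x, Wh)]" "s @ (x, Bl) # t"] ok by simp
        \<comment> \<open>A string leaving \<open>s\<close> ends in \<open>t\<close> and so crosses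
          \<open>x\<close>; as \<open>x\<close> has level \<open>0\<close>, its distance to
          \<open>x\<close> is its level.\<close>
        have thr: "nat (lv a) \<notin> D" if a: "a \<in> labels s" and o: "occ s a \<noteq> 2" for a
        proof -
          have ax: "a \<noteq> x" using True a x0 by blast
          have "occ s a \<noteq> 0" using a by (simp add: occ_0_iff)
          then have oa: "occ s a = 1" "occ t a = 1" using two[of a] a o ax by auto
          have "restr x a s = [a]" "restr x a t = [a]"
            using xs xt oa by (simp_all add: restr_replicate')
          then have "cross ?z x a" using ax by (simp add: cross_def)
          then show ?thesis using okayD[OF ok] x0 lv1[OF a] by fastforce
        qed
        have "2 * length s < n" using longer less.prems(2) unfolding t t' by simp
        then have ex: "eqv G ((x, Wh) # s @ [(x, Bl)]) ((u, Wh) # s @ [(u, Bl)])"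
          by (rule exchange_arc_legal[OF G IH _ gR okR ps lv1 thr])
        let ?z' = "(u, Wh) # s @ t1 @ (u, Bl) # t2"
        have "eqv G ?z ((u, Wh) # s @ (u, Bl) # (u, Wh) # t1 @ (u, Bl) # t2)"
          using eqv_context[OF ex, of "[]" t] unfolding t t' by simp
        also have "eqv G \<dots> ?z'"
          using eqv_cancel_letters[of G "(u, Wh) # s" u Bl "t1 @ (u, Bl) # t2"] by simp
        finally have "eqv G ?z ?z'" .
        moreover have "legal D ?z'"
        proof -
          have eq: "lv x = lv u" using x0 u0 by simp
          obtain i where i: "path lv 1 t1 i" "path lv i ((u, Bl) # t2) 0"
            using pt' unfolding t' path_append by blast
          then have "path lv 0 ?z' 0" using u0 ps by (auto simp: path_append)
          then show ?thesis
            using slide_arc[OF g[unfolded t t'] ok[unfolded t t'] eq] unfolding legal_def by blast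
        qed
        then have "eqv G [] ?z'" using small less.prems(2) unfolding t t' by simp
        ultimately show ?thesis using eqv_trans eqv_sym by blast
      qed
    qed
  next
    case False
    \<comment> \<open>Up to its first letter \<open>y\<close> of level \<open>0\<close> the path
      stays at height at least \<open>1\<close>, so \<open>y\<close> is black and leads down to
      \<open>0\<close>. The path has to come back to \<open>1\<close> and cannot go lower, so a
      white letter \<open>w\<close> of level \<open>0\<close> follows at once.\<close>
    then have "\<exists>p\<in>set s. lv (fst p) = 0" by auto
    then obtain s1 p s2 where s: "s = s1 @ p # s2" and p0: "lv (fst p) = 0"
      and s1: "\<forall>q\<in>set s1. lv (fst q) \<noteq> 0"
      using split_list_first_prop[of s "\<lambda>p. lv (fst p) = 0"] by blast
    obtain y c where p: "p = (y, c)" by (cases p)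
    have y0: "lv y = 0" using p0 p by simp
    have lv1: "lv a \<ge> 1" if "a \<in> labels s1" for a
      using s1 pos[of a] that unfolding s by force
    obtain j where j: "path lv 1 s1 j" "path lv j ((y, c) # s2) 1"
      using ps unfolding s p path_append by blast
    have "j \<ge> 1" using path_stays_up[OF j(1)] lv1 by simp
    then have c: "c = Bl" using j(2) y0 by (cases c) simp_all
    then have "j = 1" using j(2) y0 by simp
    then have ps1: "path lv 1 s1 1" and ps2: "path lv 0 s2 1" using j y0 c by simp_all
    then have "s2 \<noteq> []" by auto
    moreover have "lv a \<ge> 0" if "a \<in> labels s2" for a using pos[of a] that unfolding s by (simp add: image_Un)
    ultimately obtain w A where s2: "s2 = (w, Wh) # A" and w0: "lv w = 0" and pA: "path lv 1 A 1"
      using path_starts_up[OF ps2] by metis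
    note s = s[unfolded p c s2]
    have wx: "w \<noteq> x" using xs unfolding s by auto
    have zero_s1: "occ s1 e = 0" if "lv e = 0" for e
      using lv1[of e] that unfolding occ_0_iff by force
    show ?thesis
    proof (cases "y = w")
      case True
      let ?z' = "(x, Wh) # s1 @ A @ (x, Bl) # t"
      have "eqv G ?z ?z'"
        using eqv_cancel_letters[of G "(x, Wh) # s1" w Bl "A @ (x, Bl) # t"] unfolding s True by simp
      moreover have "legal D ?z'"
      proof -
        have "occ ?z w = 2" by (rule two) (simp add: s)
        then have w': "occ ?z' w = 0" using True wx unfolding s by simp
        then have nw: "w \<notin> labels ?z'" unfolding occ_0_iff .
        have "gauss ?z'"
        proof (rule gauss_sub[OF g])
          fix e show "(\<forall>c. cnt ?z' e c = cnt ?z e c) \<or> (\<forall>c. cnt ?z' e c = 0)"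
          proof (cases "e = w")
            case True
            then show ?thesis using cnt_0_of_occ[OF w'] by simp
          next
            case False
            then show ?thesis using True unfolding s by simp
          qed
        qed
        moreover have "okay D lv ?z'"
        proof (rule okay_sub[OF ok])
          fix a b assume ab: "a \<in> labels ?z'" "b \<in> labels ?z'"
          have "a \<noteq> w" "b \<noteq> w" using ab nw by blast+
          then show "restr a b ?z' = restr a b ?z" using True unfolding s by simp
        qed
        moreover have "path lv 0 ?z' 0"
          using ps1 pA pt x0 by (auto simp: path_append)
        ultimately show ?thesis unfolding legal_def by blast
      qed
      then have "eqv G [] ?z'" using small less.prems(2) unfolding s by simp
      ultimately show ?thesis using eqv_trans eqv_sym by blast
    next
      case yw: False
      have "(w, Wh) \<in> set ?z" by (simp add: s)
      then have "cnt ?z w Bl = 1" by (rule partner(2)[OF g])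
      then have "cnt A w Bl \<noteq> 0 \<or> cnt t w Bl \<noteq> 0"
        using wx yw cnt_0_of_occ[OF zero_s1[OF w0], of Bl] unfolding s by (auto split: if_splits)
      then show ?thesis
      proof
        assume "cnt A w Bl \<noteq> 0"
        from split_cnt[OF this] obtain A1 A2 where A: "A = A1 @ (w, Bl) # A2" by blast
        show ?thesis
          by (rule rot[of "(x, Wh) # s1 @ [(y, Bl)]" w A1 "A2 @ (x, Bl) # t"])
            (use ps1 x0 y0 in \<open>simp_all add: s A path_append\<close>)
      next
        assume "cnt t w Bl \<noteq> 0"
        from split_cnt[OF this] obtain B C where t: "t = B @ (w, Bl) # C" by blast
        have pP: "path lv 0 ((x, Wh) # s1 @ [(y, Bl)]) 0" using ps1 x0 y0 by (simp add: path_append)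
        \<comment> \<open>If the segment of \<open>w\<close> is not shorter than \<open>s\<close>,
          then \<open>B\<close> is longer than \<open>s1\<close>. This gives
          \<open>2 * length s1 < n\<close>, the bound for exchanging an arc over
          \<open>s1\<close>.\<close>
        show ?thesis
        proof (cases "length (A @ (x, Bl) # B) < length s")
          case True
          show ?thesis
            by (rule rot[of "(x, Wh) # s1 @ [(y, Bl)]" w "A @ (x, Bl) # B" C])
              (use pP True in \<open>simp_all add: s t\<close>)
        next
          case longer: False
          have yx: "y \<noteq> x" using xs unfolding s by auto
          have "occ ?z w = 2" by (rule two) (simp add: s)
          then have ow: "occ A w = 0" "occ B w = 0" "occ C w = 0" "occ s1 w = 0"
            using wx yw unfolding s t by auto
          have ox: "occ A x = 0" "occ B x = 0" "occ C x = 0" "occ s1 x = 0"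
            using xs xt unfolding s t by (auto split: if_splits)
          have "restr x w A = []" "restr x w B = []" "restr x w C = []" "restr x w s1 = []"
            using ow ox by (simp_all add: restr_none)
          then have "cross ?z x w" using wx yw yx unfolding s t by (simp add: cross_def)
          \<comment> \<open>\<open>x\<close> and \<open>w\<close> are crossing strings of the same
            level.\<close>
          then have D0: "0 \<notin> D" using okayD[OF ok] x0 w0 by fastforce
          \<comment> \<open>A string leaving \<open>s1\<close> ends in \<open>A\<close>,
            \<open>B\<close> or \<open>C\<close>. It crosses \<open>w\<close> in the first case,
            both arcs in the second and \<open>x\<close> in the third.\<close>
          have thr: "nat (lv a) \<notin> D" if a: "a \<in> labels s1" and o: "occ s1 a \<noteq> 2" for a
          proof -
            have ne: "a \<noteq> x" "a \<noteq> w" "a \<noteq> y" using lv1[OF a] x0 w0 y0 by auto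
            have "occ s1 a \<noteq> 0" using a by (simp add: occ_0_iff)
            moreover have "occ ?z a = 2" by (rule two, rule disjI1) (use a in \<open>simp add: s image_Un\<close>)
            ultimately have oa: "occ s1 a = 1" "occ A a + occ B a + occ C a = 1"
              using o ne unfolding s t by auto
            have r: "restr e a s1 = replicate (occ s1 a) a" "restr e a A = replicate (occ A a) a"
              "restr e a B = replicate (occ B a) a" "restr e a C = replicate (occ C a) a"
              if "e = x \<or> e = w" for e
              using that ow ox by (auto simp: restr_replicate')
            have "(occ A a = 1 \<and> occ B a = 0 \<and> occ C a = 0) \<or> (occ A a = 0 \<and> occ B a = 1 \<and> occ C a = 0) \<or>
              (occ A a = 0 \<and> occ B a = 0 \<and> occ C a = 1)" using oa(2) by presburger
            then have "cross ?z x a \<or> cross ?z w a"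
              using oa(1) ne wx yw yx unfolding s t cross_def
              by (elim disjE conjE) (simp_all add: r)
            then show ?thesis
            proof
              assume "cross ?z x a"
              then show ?thesis using okayD[OF ok] x0 lv1[OF a] by fastforce
            next
              assume "cross ?z w a"
              then show ?thesis using okayD[OF ok] w0 lv1[OF a] by fastforce
            qed
          qed
          let ?R = "(y, Bl) # (w, Wh) # A @ (x, Bl) # t @ [(x, Wh)]"
          have gR: "gauss (s1 @ ?R)" using g gauss_commute[of "[(x, Wh)]" "s @ (x, Bl) # t"] unfolding s by simp
          have okR: "okay D lv (s1 @ ?R)" using okay_rotate[of D lv "[(x, Wh)]" "s @ (x, Bl) # t"] ok unfolding s by simp
          have "2 * length s1 < n" using longer less.prems(2) unfolding s t by simp
          then have ex: "eqv G ((x, Wh) # s1 @ [(x, Bl)]) ((w, Wh) # s1 @ [(w, Bl)])"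
            by (rule exchange_arc_legal[OF G IH _ gR okR ps1 lv1 thr])
          let ?E = "A @ (x, Bl) # B @ (w, Bl) # C"
          let ?z' = "(w, Wh) # (s1 @ [(y, Bl)]) @ (x, Wh) # ?E"
          \<comment> \<open>A cancelling pair of letters \<open>x\<close> closes an arc over
            \<open>s1\<close>. This arc is renamed to \<open>w\<close>, then \<open>h\<close>
            interchanges \<open>x\<close> and \<open>w\<close> across \<open>y\<close>, and the
            adjacent letters \<open>w\<close> cancel.\<close>
          have "eqv G ?z ((x, Wh) # s1 @ (x, Bl) # (x, Wh) # (y, Bl) # (w, Wh) # ?E)"
            using eqv_sym[OF eqv_cancel_letters[of G "(x, Wh) # s1" x Bl "(y, Bl) # (w, Wh) # ?E"]]
            unfolding s t by simp
          also have "eqv G \<dots> ((w, Wh) # s1 @ (w, Bl) # (x, Wh) # (y, Bl) # (w, Wh) # ?E)"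
            using eqv_context[OF ex, of "[]" "(x, Wh) # (y, Bl) # (w, Wh) # ?E"] by simp
          also have "eqv G \<dots> ((w, Wh) # s1 @ (w, Bl) # (w, Wh) # (y, Bl) # (x, Wh) # ?E)"
            using eqv_context[OF H[OF D0, of x y w], of "(w, Wh) # s1 @ [(w, Bl)]" ?E] by simp
          also have "eqv G \<dots> ?z'"
            using eqv_cancel_letters[of G "(w, Wh) # s1" w Bl "(y, Bl) # (x, Wh) # ?E"] by simp
          finally have z': "eqv G ?z ?z'" .
          have eq: "lv x = lv w" using x0 w0 by simp
          have gz: "gauss ((x, Wh) # (s1 @ [(y, Bl)]) @ (w, Wh) # ?E)" using g unfolding s t by simp
          have okz: "okay D lv ((x, Wh) # (s1 @ [(y, Bl)]) @ (w, Wh) # ?E)" using ok unfolding s t by simp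
          have "path lv 0 ?z' 0"
          proof -
            have "path lv 0 ((x, Wh) # ?E) 0"
              using pt pA x0 unfolding t by (auto simp: path_append)
            moreover have pP': "path lv 0 ((w, Wh) # s1 @ [(y, Bl)]) 0"
              using ps1 w0 y0 by (simp add: path_append)
            ultimately show ?thesis
              using path_append[of lv 0 "(w, Wh) # s1 @ [(y, Bl)]" "(x, Wh) # ?E" 0] by auto
          qed
          moreover have "labels ?z' = labels ?z" unfolding s t by auto
          then have "\<forall>a\<in>labels ?z'. lv a \<ge> 0" using pos by simp
          ultimately have good: "good D lv ?z'"
            using swap_arcs[OF gz okz eq wx[symmetric]] unfolding good_def by blast
          \<comment> \<open>Rotated to begin with \<open>x\<close>, the new word has the segment
            \<open>A\<close>, a proper part of the old \<open>s\<close>; the total length is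
            unchanged, so the inner induction applies.\<close>
          let ?P = "(w, Wh) # s1 @ [(y, Bl)]"
          have "path lv 0 ?P 0" using ps1 w0 y0 by (simp add: path_append)
          then have "good D lv (((x, Wh) # ?E) @ ?P)"
            using good_rotate[of D lv ?P "(x, Wh) # ?E"] good by simp
          then have "good D lv ((x, Wh) # A @ (x, Bl) # (B @ (w, Bl) # C @ ?P))" by simp
          moreover have "length ((x, Wh) # A @ (x, Bl) # (B @ (w, Bl) # C @ ?P)) = n"
            using less.prems(2) unfolding s t by simp
          moreover have "length A < length s" unfolding s by simp
          ultimately have "eqv G [] ((x, Wh) # A @ (x, Bl) # (B @ (w, Bl) # C @ ?P))"
            using less.hyps by blast
          then have "eqv G [] (((x, Wh) # ?E) @ ?P)" by simp
          from eqv_rotate[OF this] have "eqv G [] ?z'" by simp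
          then show ?thesis using z' eqv_trans eqv_sym by blast
        qed
      qed
    qed
  qed
qed

text \<open>The lowest level is shifted to \<open>0\<close> and the word rotated to begin with a
  white letter of that level. Such a letter exists because the minimum is attained and every label
  occurs in both colours.\<close>

lemma legal_generated:
  fixes z :: "nat word"
  assumes G: "bracket_rel G D"
    and H: "0 \<notin> D \<Longrightarrow> (\<And>x y w :: nat. eqv G [(x, Wh), (y, Bl), (w, Wh)] [(w, Wh), (y, Bl), (x, Wh)])"
    and "legal D z"
  shows "eqv G [] z"
  using assms(3)
proof (induction "length z" arbitrary: z rule: less_induct)
  case less
  have IH: "shorter_generated G D (length z)"
    using less.hyps unfolding shorter_generated_def by blast
  show ?case
  proof (cases "z = []")
    case True
    then show ?thesis by (simp add: eqv_Nil)
  next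
    case False
    obtain lv k where z: "gauss z" "path lv k z k" "okay D lv z"
      using less.prems unfolding legal_def by blast
    define m where "m = Min (lv ` labels z)"
    define lv' where "lv' a = lv a + (- m)" for a
    have ne: "lv ` labels z \<noteq> {}" "finite (lv ` labels z)" using False by simp_all
    have pos: "lv' a \<ge> 0" if "a \<in> labels z" for a
    proof -
      have "m \<le> lv a" unfolding m_def by (rule Min_le[OF ne(2) imageI[OF that]])
      then show ?thesis by (simp add: lv'_def)
    qed
    have "m \<in> lv ` (labels z)" unfolding m_def using Min_in[OF ne(2,1)] .
    then obtain a where a: "a \<in> labels z" "lv' a = 0" unfolding lv'_def by force
    have p: "path lv' (k + (- m)) z (k + (- m))" unfolding lv'_def path_shift by (rule z(2))
    have ok: "okay D lv' z" using z(3) by (simp add: okay_def lv'_def)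
    from a(1) obtain c where "(a, c) \<in> set z" by auto
    then have "cnt z a Wh \<noteq> 0" using partner(1)[OF z(1)] by simp
    from split_cnt[OF this] obtain A B where AB: "z = A @ (a, Wh) # B" by blast
    obtain i where i: "path lv' (k + (- m)) A i" "path lv' i ((a, Wh) # B) (k + (- m))"
      using p unfolding AB path_append by blast
    have "i = 0" using i(2) a(2) by simp
    let ?z' = "(a, Wh) # B @ A"
    have p': "path lv' 0 ?z' 0"
      using path_rotate[of lv' "k + (- m)" A "(a, Wh) # B" i] p i(1) \<open>i = 0\<close> unfolding AB by simp
    have g': "gauss ?z'" using z(1) gauss_commute[of A "(a, Wh) # B"] unfolding AB by simp
    have "okay D lv' ?z'" using ok okay_rotate[of D lv' A "(a, Wh) # B"] unfolding AB by simp
    moreover have "labels ?z' = labels z" unfolding AB by auto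
    ultimately have good: "good D lv' ?z'" using g' p' pos unfolding good_def by simp
    have "(a, Wh) \<in> set ?z'" by simp
    then have "cnt ?z' a Bl = 1" by (rule partner(2)[OF g'])
    then have "cnt (B @ A) a Bl \<noteq> 0" by simp
    from split_cnt[OF this] obtain s t where st: "B @ A = s @ (a, Bl) # t" by blast
    have "length ((a, Wh) # s @ (a, Bl) # t) = length z" unfolding AB st[symmetric] by simp
    from good_generated_aux[OF G H IH good[unfolded st] this]
    have "eqv G [] (((a, Wh) # B) @ A)" unfolding st[symmetric] by simp
    from eqv_rotate[OF this] show ?thesis unfolding AB .
  qed
qed

subsection \<open>The bracket generators\<close>

text \<open>The row \<open>s\<close> of a bracket, \<open>0\<close> for the lower and \<open>1\<close> for the upper one.  On level \<open>k\<close> the arc in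
  row \<open>s\<close> has label \<open>(s, k)\<close>, the black line \<open>(2, k)\<close> and the white line \<open>(3, k)\<close>.\<close>

definition bra_row :: "nat set \<Rightarrow> nat \<Rightarrow> nat \<Rightarrow> (nat \<times> nat) word" where
  "bra_row w n s = rev (map (\<lambda>k. ((if k \<in> w then s else 2, k), Bl)) [0..<n]) @
     map (\<lambda>k. ((if k \<in> w then s else 3, k), Wh)) [0..<n]"

lemma length_bra_row [simp]: "length (bra_row w n s) = n + n"
  by (simp add: bra_row_def)

lemma snd_bra_row: "map snd (bra_row w n s) = replicate n Bl @ replicate n Wh"
  by (simp add: bra_row_def rev_map[symmetric] o_def map_replicate_const)

lemma nth_bra_row:
  "k < n \<Longrightarrow> bra_row w n s ! (n - Suc k) = ((if k \<in> w then s else 2, k), Bl)"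
  "k < n \<Longrightarrow> bra_row w n s ! (n + k) = ((if k \<in> w then s else 3, k), Wh)"
  by (simp_all add: bra_row_def nth_append rev_nth)

lemma cnt_rev [simp]: "cnt (rev z) a c = cnt z a c"
  by (induction z) auto

lemma cnt_graph:
  "cnt (map (\<lambda>k. ((f k, k), c)) [0..<n]) (t, k) d = (if k < n \<and> f k = t \<and> c = d then 1 else 0)"
  by (induction n) (auto simp: less_Suc_eq)

lemma gauss_bra: "gauss (bra_row w n 0 @ mirror (bra_row w n 1))"
proof -
  have "cnt (bra_row w n 0 @ mirror (bra_row w n 1)) a Wh = cnt (bra_row w n 0 @ mirror (bra_row w n 1)) a Bl \<and>
     cnt (bra_row w n 0 @ mirror (bra_row w n 1)) a Wh \<le> 1" for a
    by (cases a) (simp add: bra_row_def cnt_graph)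
  then show ?thesis unfolding gauss_def by blast
qed

definition bra_blocks :: "nat set \<Rightarrow> nat \<Rightarrow> pt set set" where
  "bra_blocks w m = {{Lo (m - k), Lo (m + 1 + k)} | k. k \<in> w}
      \<union> {{Up (m - k), Up (m + 1 + k)} | k. k \<in> w}
      \<union> {{Lo (m - k), Up (m - k)} | k. k \<le> m \<and> k \<notin> w}
      \<union> {{Lo (m + 1 + k), Up (m + 1 + k)} | k. k \<le> m \<and> k \<notin> w}"

lemma maxw_ge: "finite w \<Longrightarrow> k \<in> w \<Longrightarrow> k \<le> maxw w"
  by (auto simp: maxw_def)

lemma Br_gp:
  assumes fin: "finite w"
  shows "Br w = gp (bra_row w (Suc (maxw w)) 1) (bra_row w (Suc (maxw w)) 0)"
proof -
  define m where "m = maxw w"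
  let ?n = "Suc m"
  let ?U = "bra_row w ?n 1" and ?L = "bra_row w ?n 0"
  have le: "k \<le> m" if "k \<in> w" for k using maxw_ge[OF fin that] by (simp add: m_def)
  have n1: "bra_row w ?n s ! (m - k) = ((if k \<in> w then s else 2, k), Bl)"
    and n2: "bra_row w ?n s ! (m + 1 + k) = ((if k \<in> w then s else 3, k), Wh)" if "k \<le> m" for s k
    using nth_bra_row[of k ?n w s] that by simp_all
  have "(map snd ?U, map snd ?L, bra_blocks w m) = gp ?U ?L"
  proof (rule gp_eqI[OF gauss_bra])
    fix B assume "B \<in> bra_blocks w m"
    then show "\<exists>x y. B = {x, y} \<and> x \<noteq> y \<and> x \<in> pts ?U ?L \<and> y \<in> pts ?U ?L \<and> labp ?U ?L x = labp ?U ?L y"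
      unfolding bra_blocks_def
    proof (elim UnE CollectE exE conjE)
      fix k assume k: "B = {Lo (m - k), Lo (m + 1 + k)}" "k \<in> w"
      show ?thesis
        using k le[OF k(2)] n1[OF le[OF k(2)], of 0] n2[OF le[OF k(2)], of 0]
        by (intro exI[of _ "Lo (m - k)"] exI[of _ "Lo (m + 1 + k)"]) (simp add: pts_def)
    next
      fix k assume k: "B = {Up (m - k), Up (m + 1 + k)}" "k \<in> w"
      show ?thesis
        using k le[OF k(2)] n1[OF le[OF k(2)], of 1] n2[OF le[OF k(2)], of 1]
        by (intro exI[of _ "Up (m - k)"] exI[of _ "Up (m + 1 + k)"]) (simp add: pts_def)
    next
      fix k assume k: "B = {Lo (m - k), Up (m - k)}" "k \<le> m" "k \<notin> w"
      show ?thesis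
        using k n1[OF k(2), of 0] n1[OF k(2), of 1]
        by (intro exI[of _ "Lo (m - k)"] exI[of _ "Up (m - k)"]) (simp add: pts_def)
    next
      fix k assume k: "B = {Lo (m + 1 + k), Up (m + 1 + k)}" "k \<le> m" "k \<notin> w"
      show ?thesis
        using k n2[OF k(2), of 0] n2[OF k(2), of 1]
        by (intro exI[of _ "Lo (m + 1 + k)"] exI[of _ "Up (m + 1 + k)"]) (simp add: pts_def)
    qed
  next
    have b1: "{Lo (m - k), Lo (m + 1 + k)} \<in> bra_blocks w m" if "k \<in> w" for k
      unfolding bra_blocks_def
      by (rule UnI1, rule UnI1, rule UnI1, rule CollectI, rule exI[of _ k]) (simp add: that)
    have b2: "{Up (m - k), Up (m + 1 + k)} \<in> bra_blocks w m" if "k \<in> w" for k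
      unfolding bra_blocks_def
      by (rule UnI1, rule UnI1, rule UnI2, rule CollectI, rule exI[of _ k]) (simp add: that)
    have b3: "{Lo (m - k), Up (m - k)} \<in> bra_blocks w m" if "k \<le> m" "k \<notin> w" for k
      unfolding bra_blocks_def
      by (rule UnI1, rule UnI2, rule CollectI, rule exI[of _ k]) (simp add: that)
    have b4: "{Lo (m + 1 + k), Up (m + 1 + k)} \<in> bra_blocks w m" if "k \<le> m" "k \<notin> w" for k
      unfolding bra_blocks_def
      by (rule UnI2, rule CollectI, rule exI[of _ k]) (simp add: that)
    show "pts ?U ?L \<subseteq> \<Union> (bra_blocks w m)"
    proof
      fix x assume x: "x \<in> pts ?U ?L"
      then obtain i where i: "i < ?n + ?n" "x = Lo i \<or> x = Up i" by (auto simp: pts_def)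
      show "x \<in> \<Union> (bra_blocks w m)"
      proof (cases "i \<le> m")
        case True
        then have k: "i = m - (m - i)" "m - i \<le> m" by simp_all
        show ?thesis
        proof (cases "m - i \<in> w")
          case True
          then show ?thesis using i(2) UnionI[OF b1[OF True], of x] UnionI[OF b2[OF True], of x] k(1) by auto
        next
          case False
          then show ?thesis using i(2) UnionI[OF b3[OF k(2) False], of x] k(1) by auto
        qed
      next
        case False
        then have k: "i = m + 1 + (i - (m + 1))" "i - (m + 1) \<le> m" using i(1) by simp_all
        show ?thesis
        proof (cases "i - (m + 1) \<in> w")
          case True
          then show ?thesis using i(2) UnionI[OF b1[OF True], of x] UnionI[OF b2[OF True], of x] k(1) by auto
        next
          case False
          then show ?thesis using i(2) UnionI[OF b4[OF k(2) False], of x] k(1) by auto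
        qed
      qed
    qed
  qed
  moreover have "Br w = (map snd ?U, map snd ?L, bra_blocks w m)"
    unfolding Br_def Let_def m_def snd_bra_row bra_blocks_def by simp
  ultimately show ?thesis by (simp only: m_def)
qed

lemma path_down: "path (\<lambda>e. int (snd e)) (int n) (rev (map (\<lambda>k. ((f k, k), Bl)) [0..<n])) 0"
  by (induction n) simp_all

lemma path_up: "path (\<lambda>e. int (snd e)) 0 (map (\<lambda>k. ((f k, k), Wh)) [0..<n]) (int n)"
  by (induction n) (simp_all add: path_snoc)

lemma path_bra: "path (\<lambda>e. int (snd e)) (int n) (bra_row w n s) (int n)"
  using path_down[of n "\<lambda>k. if k \<in> w then s else 2"] path_up[of "\<lambda>k. if k \<in> w then s else 3" n]
  unfolding bra_row_def path_append by blast

lemma restr_rev: "restr a b (rev z) = rev (restr a b z)"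
  by (simp add: restr_def rev_filter rev_map)

lemma restr_graph:
  "k < k' \<Longrightarrow> restr (t, k) (t', k') (map (\<lambda>j. ((f j, j), c)) [0..<n]) =
    (if k < n \<and> f k = t then [(t, k)] else []) @ (if k' < n \<and> f k' = t' then [(t', k')] else [])"
  by (induction n) (auto simp: less_Suc_eq)

lemma restr_graph_same:
  "t \<noteq> t' \<Longrightarrow> restr (t, k) (t', k) (map (\<lambda>j. ((f j, j), c)) [0..<n]) =
    (if k < n \<and> (f k = t \<or> f k = t') then [(f k, k)] else [])"
  by (induction n) (auto simp: less_Suc_eq)

text \<open>Within a row an arc encloses exactly the lower levels, whose lines must pass through it.
  Arcs of one row are nested, and lines do not cross each other.\<close>

lemma cross_bra:
  assumes "cross (bra_row w n 0 @ mirror (bra_row w n 1)) (t, k) (t', k')" and "k \<le> k'"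
  shows "k \<notin> w \<and> k' \<in> w \<and> k < k' \<and> k' < n"
proof (cases "k = k'")
  case True
  then have "t \<noteq> t'" using crossD(1)[OF assms(1)] by simp
  then show ?thesis
    using crossD(2)[OF assms(1)] True
    by (cases "k \<in> w") (auto simp: bra_row_def restr_rev restr_graph_same split: if_splits)
next
  case False
  then have "k < k'" using assms(2) by simp
  then show ?thesis
    using crossD(2)[OF assms(1)]
    by (cases "k \<in> w"; cases "k' \<in> w") (auto simp: bra_row_def restr_rev restr_graph split: if_splits)
qed

text \<open>A condition up to the maximum of \<open>w\<close> only, so that it covers the full
  complement of \<open>D\<close> as well as its truncations.\<close>

definition complements :: "nat set \<Rightarrow> nat set \<Rightarrow> bool" where
  "complements w D \<longleftrightarrow> finite w \<and> (\<forall>k\<le>maxw w. k \<notin> w \<longleftrightarrow> k = 0 \<or> k \<in> D)"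

text \<open>An arc of level \<open>k'\<close> crosses a line of lower level \<open>k\<close>, where
  \<open>k\<close> is \<open>0\<close> or in \<open>D\<close>. If the distance \<open>k' - k\<close>
  were in \<open>D\<close>, closure under addition would put \<open>k'\<close> into
  \<open>D\<close>, but \<open>k'\<close> belongs to \<open>w\<close>.\<close>

lemma Br_in_I_D:
  assumes semigroup: "\<forall>x\<in>D. \<forall>y\<in>D. x + y \<in> D" and w: "complements w D"
  shows "Br w \<in> I_D D"
proof -
  let ?n = "Suc (maxw w)" and ?lv = "\<lambda>e :: nat \<times> nat. int (snd e)"
  let ?z = "bra_row w ?n 0 @ mirror (bra_row w ?n 1)"
  have diff: "k' - k \<notin> D" if "k \<notin> w" "k' \<in> w" "k < k'" "k' < ?n" for k k'
  proof
    assume d: "k' - k \<in> D"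
    have "k = 0 \<or> k \<in> D" using w that unfolding complements_def by auto
    then have "k' \<in> D"
    proof
      assume "k \<in> D"
      then have "k + (k' - k) \<in> D" using semigroup d by blast
      then show ?thesis using that by simp
    qed (use d in simp)
    moreover have "k' \<le> maxw w" using that by simp
    ultimately have "k' \<notin> w" using w unfolding complements_def by blast
    then show False using that by simp
  qed
  have "okay D ?lv ?z"
  proof (rule okayI)
    fix a b assume c: "cross ?z a b"
    obtain t k t' k' where ab: "a = (t, k)" "b = (t', k')" by (cases a; cases b)
    show "nat \<bar>?lv a - ?lv b\<bar> \<notin> D"
    proof (cases "k \<le> k'")
      case True
      have "nat \<bar>?lv a - ?lv b\<bar> = k' - k" using True ab by simp
      then show ?thesis using cross_bra[OF c[unfolded ab] True] diff by simp
    next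
      case False
      then have le: "k' \<le> k" by simp
      have c': "cross ?z (t', k') (t, k)" using c cross_commute[of ?z a b] unfolding ab by blast
      have "nat \<bar>?lv a - ?lv b\<bar> = k - k'" using le ab by simp
      then show ?thesis using cross_bra[OF c' le] diff by simp
    qed
  qed
  moreover have "path ?lv (int ?n) ?z (int ?n)"
    using path_bra[of ?n w] path_mirror[of ?lv "int ?n" "bra_row w ?n 1" "int ?n"]
    unfolding path_append by blast
  ultimately have "legal D ?z" using gauss_bra unfolding legal_def by blast
  then show ?thesis
    using w unfolding complements_def by (simp only: Br_gp) (rule gp_legal)
qed

section \<open>From bracket generators to the bracket relation\<close>

definition bracket_at :: "part set \<Rightarrow> nat set \<Rightarrow> nat \<Rightarrow> bool" where
  "bracket_at G D k \<longleftrightarrow> (\<forall>(a :: nat \<Rightarrow> nat) a' c d.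
     eqv G (Pw D a c k @ mirror (Pw D a d k)) (Pw D a' c k @ mirror (Pw D a' d k)))"

text \<open>Each row reads as the inverse of the black ascending word followed by the white one.
  Multiplying the resulting relation from both sides separates black from white.\<close>

lemma bracket_at_Br:
  assumes w: "complements w D" and "Br w \<in> G"
  shows "bracket_at G D (Suc (maxw w))"
  unfolding bracket_at_def
proof (intro allI)
  fix a a' c d :: "nat \<Rightarrow> nat"
  let ?n = "Suc (maxw w)"
  \<comment> \<open>The first components are the kinds of \<open>bra_row\<close>: \<open>0\<close>
    lower arcs, \<open>1\<close> upper arcs, \<open>2\<close> black lines, \<open>3\<close> white
    lines.\<close>
  define \<phi> where "\<phi> e = (if fst e = 0 then d (snd e) else if fst e = 1 then c (snd e)
    else if fst e = 2 then a' (snd e) else a (snd e))" for e :: "nat \<times> nat"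
  have w': "k \<notin> w \<longleftrightarrow> k = 0 \<or> k \<in> D" if "k < ?n" for k
    using w that unfolding complements_def by simp
  have "gp (bra_row w ?n 1) (bra_row w ?n 0) \<in> gen_cat G"
    using gen_cat.base[OF assms(2)] Br_gp w unfolding complements_def by simp
  from eqv_gp[OF gauss_bra this, of \<phi>]
  have e: "eqv G (lmap \<phi> (bra_row w ?n 1)) (lmap \<phi> (bra_row w ?n 0))" .
  have row: "lmap \<phi> (bra_row w ?n s) = mirror (Pw D a' b ?n) @ Pw D a b ?n"
    if s: "s = 0 \<and> b = d \<or> s = 1 \<and> b = c" for s b
  proof -
    have pt: "\<phi> (if k \<in> w then s else 2, k) = lw D a' b k \<and> \<phi> (if k \<in> w then s else 3, k) = lw D a b k"
      if k: "k < ?n" for k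
    proof (cases "k \<in> w")
      case True
      then have "k \<noteq> 0 \<and> k \<notin> D" using w'[OF k] by simp
      then show ?thesis using True s by (auto simp: \<phi>_def lw_def)
    next
      case False
      then have "k = 0 \<or> k \<in> D" using w'[OF k] by simp
      then show ?thesis using False by (auto simp: \<phi>_def lw_def)
    qed
    have 1: "lmap \<phi> (rev z) = rev (lmap \<phi> z)" for z by (simp add: lmap_def rev_map)
    have 2: "lmap \<phi> (map (\<lambda>k. (f k, col)) ks) = map (\<lambda>k. (\<phi> (f k), col)) ks" for f col ks
      by (simp add: lmap_def)
    have 3: "mirror (Pw D a' b ?n) = rev (map (\<lambda>k. (lw D a' b k, Bl)) [0..<?n])"
      by (simp add: mirror_def Pw_def)
    have "map (\<lambda>k. (\<phi> (if k \<in> w then s else 2, k), Bl)) [0..<?n] = map (\<lambda>k. (lw D a' b k, Bl)) [0..<?n]"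
      by (rule map_cong) (simp_all add: pt del: upt_Suc)
    moreover have "map (\<lambda>k. (\<phi> (if k \<in> w then s else 3, k), Wh)) [0..<?n] = Pw D a b ?n"
      unfolding Pw_def by (rule map_cong) (simp_all add: pt del: upt_Suc)
    ultimately show ?thesis unfolding bra_row_def lmap_simps 1 2 3 by simp
  qed
  let ?P = "Pw D a c ?n" and ?Q = "Pw D a d ?n" and ?P' = "Pw D a' c ?n" and ?Q' = "Pw D a' d ?n"
  have e: "eqv G (mirror ?P' @ ?P) (mirror ?Q' @ ?Q)"
    using e row[of 1 c] row[of 0 d] by simp
  have "eqv G (?P @ mirror ?Q) (?P' @ (mirror ?P' @ ?P) @ mirror ?Q)"
    using eqv_sym[OF eqv_cancel(1)[of G "[]" ?P' "?P @ mirror ?Q"]] by simp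
  also have "eqv G \<dots> (?P' @ (mirror ?Q' @ ?Q) @ mirror ?Q)" by (rule eqv_context[OF e])
  also have "eqv G \<dots> (?P' @ mirror ?Q')"
    using eqv_cancel(1)[of G "?P' @ mirror ?Q'" ?Q "[]"] by simp
  finally show "eqv G (?P @ mirror ?Q) (?P' @ mirror ?Q')" .
qed

lemma Pw_split: "k \<le> n \<Longrightarrow> Pw D a c n = Pw D a c k @ map (\<lambda>i. (lw D a c i, Wh)) [k..<n]"
  unfolding Pw_def by (metis le_add_diff_inverse map_append upt_add_eq_append zero_le)

text \<open>A bracket yields the relation at lower heights by giving upper and lower arcs equal
  labels above \<open>k\<close>, and at greater heights if all further levels lie in
  \<open>D\<close>: in both cases the letters in between are the same on both sides and
  cancel.\<close>

lemma bracket_relI: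
  assumes "\<And>k. \<exists>n. bracket_at G D n \<and> (k \<le> n \<or> (0 < n \<and> (\<forall>i\<ge>n. i \<in> D)))"
  shows "bracket_rel G D"
  unfolding bracket_rel_def
proof (intro allI)
  fix k and a a' c d :: "nat \<Rightarrow> nat"
  obtain n where at: "bracket_at G D n" and n: "k \<le> n \<or> (0 < n \<and> (\<forall>i\<ge>n. i \<in> D))"
    using assms by blast
  show "eqv G (Pw D a c k @ mirror (Pw D a d k)) (Pw D a' c k @ mirror (Pw D a' d k))"
  proof (cases "k \<le> n")
    case True
    \<comment> \<open>The value \<open>0\<close> above \<open>k\<close> stands for an arbitrary
      label common to both arc labellings.\<close>
    define cut where "cut f i = (if i < k then f i else 0)" for f :: "nat \<Rightarrow> nat" and i
    have cut: "Pw D b (cut f) n = Pw D b f k @ map (\<lambda>i. (lw D b (\<lambda>_. 0) i, Wh)) [k..<n]" for b f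
    proof -
      have "Pw D b (cut f) k = Pw D b f k" by (rule Pw_cong) (simp add: cut_def)
      then show ?thesis unfolding Pw_split[OF True] by (simp add: cut_def lw_def)
    qed
    have c: "eqv G (Pw D b (cut f) n @ mirror (Pw D b (cut g) n)) (Pw D b f k @ mirror (Pw D b g k))" for b f g
      using eqv_cancel(1)[of G "Pw D b f k" _ "mirror (Pw D b g k)"] unfolding cut by simp
    show ?thesis
      using eqv_trans[OF eqv_trans[OF eqv_sym[OF c]] c] at unfolding bracket_at_def by blast
  next
    case False
    then have le: "n \<le> k" and D: "0 < n" "\<And>i. i \<ge> n \<Longrightarrow> i \<in> D" using n by auto
    have c: "eqv G (Pw D b f k @ mirror (Pw D b g k)) (Pw D b f n @ mirror (Pw D b g n))" for b f g :: "nat \<Rightarrow> nat"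
    proof -
      have e: "map (\<lambda>i. (lw D b f i, Wh)) [n..<k] = map (\<lambda>i. (lw D b g i, Wh)) [n..<k]"
        using D by (intro map_cong) (auto simp: lw_def)
      show ?thesis
        using eqv_cancel(1)[of G "Pw D b f n" "map (\<lambda>i. (lw D b g i, Wh)) [n..<k]" "mirror (Pw D b g n)"]
        unfolding Pw_split[OF le] e by (simp only: mirror_simps append_assoc)
    qed
    show ?thesis
      using eqv_trans[OF eqv_trans[OF c] eqv_sym[OF c]] at unfolding bracket_at_def by blast
  qed
qed

lemma eqv_h:
  fixes x y w :: nat
  assumes "h \<in> G"
  shows "eqv G [(x, Wh), (y, Bl), (w, Wh)] [(w, Wh), (y, Bl), (x, Wh)]"
proof -
  have "gp h_up h_lo \<in> gen_cat G" using gen_cat.base[OF assms] by (simp only: h_gp)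
  from eqv_gp[OF gauss_h this, of "\<lambda>i. if i = 0 then w else if i = 1 then y else x"]
  show ?thesis by (simp add: h_up_def h_lo_def)
qed

section \<open>Assembling the four cases\<close>

text \<open>A legal cyclic word is trivial in the quotient; moving the mirrored upper row to the
  other side recovers the partition.\<close>

lemma I_D_eq_gen_cat:
  assumes "G \<subseteq> I_D D" "bracket_rel G D" "0 \<notin> D \<Longrightarrow> h \<in> G"
  shows "I_D D = gen_cat G"
proof
  show "gen_cat G \<subseteq> I_D D" by (rule gen_cat_subset_I_D[OF assms(1)])
  show "I_D D \<subseteq> gen_cat G"
  proof
    fix p assume "p \<in> I_D D"
    then obtain U L :: "nat word" where p: "p = gp U L" "legal D (cyc U L)" by (rule I_D_gp)
    have "eqv G [] (cyc U L)"
      by (rule legal_generated[OF assms(2) _ p(2)]) (rule eqv_h[OF assms(3)])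
    then have "eqv G U L" by (rule eqv_of_quotient)
    then show "p \<in> gen_cat G" unfolding p(1) by (rule eqv_imp_gen_cat[OF _ legal_gauss[OF p(2)]])
  qed
qed

lemma complements_finite: "finite {n. 0 < n \<and> n \<notin> D} \<Longrightarrow> complements {n. 0 < n \<and> n \<notin> D} D"
  by (auto simp: complements_def)

lemma complements_segment: "complements ({1..v} - D) D"
proof -
  have "maxw ({1..v} - D) \<le> v"
    unfolding maxw_def by (auto simp: Max_le_iff)
  then show ?thesis by (auto simp: complements_def)
qed

text \<open>One bracket suffices because all levels above its maximum lie in
  \<open>D\<close>.\<close>

lemma bracket_rel_finite:
  assumes fin: "finite {n. 0 < n \<and> n \<notin> D}" and G: "Br {n. 0 < n \<and> n \<notin> D} \<in> G"
  shows "bracket_rel G D"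
proof (rule bracket_relI)
  fix k
  let ?n = "Suc (maxw {n. 0 < n \<and> n \<notin> D})"
  have "i \<in> D" if i: "i \<ge> ?n" for i
  proof (rule ccontr)
    assume "i \<notin> D"
    then have "i \<le> maxw {n. 0 < n \<and> n \<notin> D}" using i by (intro maxw_ge[OF fin]) auto
    then show False using i by simp
  qed
  then show "\<exists>n. bracket_at G D n \<and> (k \<le> n \<or> (0 < n \<and> (\<forall>i\<ge>n. i \<in> D)))"
    using bracket_at_Br[OF complements_finite[OF fin] G] by blast
qed

text \<open>Beyond every height \<open>k\<close> there is some \<open>v\<close> outside
  \<open>D\<close>; it belongs to its own truncation, so that bracket is high enough.\<close>

lemma bracket_rel_infinite:
  assumes inf: "infinite {n. 0 < n \<and> n \<notin> D}" and G: "\<And>v. v \<ge> 1 \<Longrightarrow> Br ({1..v} - D) \<in> G"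
  shows "bracket_rel G D"
proof (rule bracket_relI)
  fix k
  have "\<not> {n. 0 < n \<and> n \<notin> D} \<subseteq> {..k}" using inf finite_subset by blast
  then obtain v where "0 < v" "v \<notin> D" "v \<notin> {..k}" by blast
  then have v: "v > k" "0 < v" "v \<notin> D" by simp_all
  have "v \<le> maxw ({1..v} - D)" using v by (intro maxw_ge) auto
  then have "k \<le> Suc (maxw ({1..v} - D))" using v by simp
  then show "\<exists>n. bracket_at G D n \<and> (k \<le> n \<or> (0 < n \<and> (\<forall>i\<ge>n. i \<in> D)))"
    using bracket_at_Br[OF complements_segment G[of v]] v by (metis Suc_leI One_nat_def)
qed

theorem theorem1:
  fixes D :: "nat set"
  assumes semigroup: "\<forall>x\<in>D. \<forall>y\<in>D. x + y \<in> D"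
  shows "(finite {n. 0 < n \<and> n \<notin> D} \<and> 0 \<in> D \<longrightarrow>
            I_D D = gen_cat {Br {n. 0 < n \<and> n \<notin> D}})
       \<and> (finite {n. 0 < n \<and> n \<notin> D} \<and> 0 \<notin> D \<longrightarrow>
            I_D D = gen_cat {Br {n. 0 < n \<and> n \<notin> D}, h})
       \<and> (infinite {n. 0 < n \<and> n \<notin> D} \<and> 0 \<in> D \<longrightarrow>
            I_D D = gen_cat {Br ({1..v} - D) | v. v \<ge> 1})
       \<and> (infinite {n. 0 < n \<and> n \<notin> D} \<and> 0 \<notin> D \<longrightarrow>
            I_D D = gen_cat (insert h {Br ({1..v} - D) | v. v \<ge> 1}))"
proof (intro conjI impI; elim conjE)
  note Br = Br_in_I_D[OF semigroup complements_finite] Br_in_I_D[OF semigroup complements_segment]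
  {
    assume "finite {n. 0 < n \<and> n \<notin> D}" "0 \<in> D"
    then show "I_D D = gen_cat {Br {n. 0 < n \<and> n \<notin> D}}"
      by (intro I_D_eq_gen_cat bracket_rel_finite) (simp_all add: Br)
  next
    assume "finite {n. 0 < n \<and> n \<notin> D}" "0 \<notin> D"
    then show "I_D D = gen_cat {Br {n. 0 < n \<and> n \<notin> D}, h}"
      by (intro I_D_eq_gen_cat bracket_rel_finite) (simp_all add: Br h_in_I_D)
  next
    assume "infinite {n. 0 < n \<and> n \<notin> D}" "0 \<in> D"
    then show "I_D D = gen_cat {Br ({1..v} - D) | v. v \<ge> 1}"
      using Br(2) by (intro I_D_eq_gen_cat bracket_rel_infinite) blast+
  next
    assume "infinite {n. 0 < n \<and> n \<notin> D}" "0 \<notin> D"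
    then show "I_D D = gen_cat (insert h {Br ({1..v} - D) | v. v \<ge> 1})"
      using Br(2) h_in_I_D by (intro I_D_eq_gen_cat bracket_rel_infinite) blast+
  }
qed

end
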